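(* For every integer $N\ge1$ and every $\varphi=(\varphi_1,\varphi_2) \in H^N_c$, \[\kappa_n= i \big(\hat\varphi_1(-n)-\hat\varphi_2(n)\big)+\frac{\ell^2_n}{n^{N+1}} \qquad \text{as } |n|\to \infty,\] uniformly on bounded sets of $H^N_c$.
   Context: For an integer $N\ge0$, $H^N$ is the Sobolev space of 1-periodic complex-valued functions on $\mathbb{R}$ with its standard norm, $H^0=L^2$, and $H^N_c:=H^N\times H^N$. For $u\in L^2$, $\hat u(n):=\int_0^1u(x)e^{-2\pi i n x}\,dx$, $n\in\mathbb{Z}$. For $\varphi=(\varphi_1,\varphi_2)\in L^2_c:=H^0_c$ the Zakharov--Shabat operator is \[L(\varphi)= i \begin{pmatrix}1&0\\0&-1\end{pmatrix}\partial_x + \begin{pmatrix}0& \varphi_1 \\ \varphi_2 &0\end{pmatrix}.\] The Dirichlet spectrum of $L(\varphi)$ is the spectrum of $L(\varphi)$ on $[0,1]$ with domain the set of $F=(F_1,F_2)\in H^1([0,1],\mathbb{C})^2$ with $F_1(0)=F_2(0)$, $F_1(1)=F_2(1)$. It is discrete, and the eigenvalues, counted with algebraic multiplicities, are listed in lexicographic order $\cdots\preceq\mu_n\preceq\mu_{n+1}\preceq\cdots$ in such a way that $(\mu_n-n\pi)_{n\in\mathbb{Z}}\in\ell^2$. Here $a\preceq b$ means $\operatorname{Re}a<\operatorname{Re}b$, or $\operatorname{Re}a=\operatorname{Re}b$ and $\operatorname{Im}a\le\operatorname{Im}b$. $M(x,\lambda)=\begin{pmatrix} m_1 & m_2 \\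 m_3 & m_4 \end{pmatrix}$ is the fundamental solution of $L(\varphi)M=\lambda M$ with $M(0,\lambda)=\mathrm{Id}$; $\Delta(\lambda):=m_1(1,\lambda)+m_4(1,\lambda)$ and $\delta(\lambda):=m_2(1,\lambda)+m_3(1,\lambda)$. For $|n|$ sufficiently large (uniformly for $\varphi$ in bounded sets of $H^1_c$) one defines \[\kappa_n:= 2\log\Big((-1)^n\frac{\Delta(\mu_n)+ \delta(\mu_n)}{2}\Big)\] with the principal branch of the logarithm (the argument tends to $1$ as $|n|\to\infty$). Notation: $x_n=y_n+\frac{\ell^p_n}{n^{s}}$ as $|n|\to\infty$ means that $x_n=y_n+\frac{e_n}{|n|^{s}}$ for $|n|$ large with $\sum|e_n|^p<\infty$. "Uniformly on bounded sets" means that for every bounded set of potentials there are $n_0\ge1$ and $C>0$ such that $\sum_{|n|\ge n_0}|e_n|^p\le C$ for all potentials in that set. *)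

theory Defs
  imports "HOL-Analysis.Analysis" "HOL-Library.Function_Algebras"
begin

section \<open>Periodic Sobolev spaces\<close>

text \<open>Elements of \<open>L\<^sup>2\<close> are represented by functions; equality in \<open>L\<^sup>2\<close> is equality almost everywhere.\<close>

definition L2_01 :: "(real \<Rightarrow> 'a::euclidean_space) set" where
  "L2_01 = {f. f \<in> borel_measurable (lebesgue_on {0..1}) \<and>
               integrable (lebesgue_on {0..1}) (\<lambda>x. (norm (f x))\<^sup>2)}"

definition L2_norm_01 :: "(real \<Rightarrow> 'a::euclidean_space) \<Rightarrow> real" where
  "L2_norm_01 f = sqrt (\<integral>x. (norm (f x))\<^sup>2 \<partial>lebesgue_on {0..1})"

definition fourier :: "(real \<Rightarrow> complex) \<Rightarrow> int \<Rightarrow> complex" where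
  "fourier u n =
     (\<integral>x. u x * exp (- 2 * complex_of_real pi * \<i> * of_int n * complex_of_real x)
        \<partial>lebesgue_on {0..1})"

definition sobolev :: "nat \<Rightarrow> (real \<Rightarrow> complex) set" where
  "sobolev N = {u. (\<forall>x. u (x + 1) = u x) \<and> u \<in> L2_01 \<and>
     (\<lambda>n::int. (1 + (of_int n)\<^sup>2) ^ N * (cmod (fourier u n))\<^sup>2) summable_on UNIV}"

definition sobolev_norm :: "nat \<Rightarrow> (real \<Rightarrow> complex) \<Rightarrow> real" where
  "sobolev_norm N u =
     sqrt (\<Sum>\<^sub>\<infinity>n::int. (1 + (of_int n)\<^sup>2) ^ N * (cmod (fourier u n))\<^sup>2)"

type_synonym potential = "(real \<Rightarrow> complex) \<times> (real \<Rightarrow> complex)"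

definition sobolev_c :: "nat \<Rightarrow> potential set" where
  "sobolev_c N = sobolev N \<times> sobolev N"

definition sobolev_c_norm :: "nat \<Rightarrow> potential \<Rightarrow> real" where
  "sobolev_c_norm N \<phi> = sqrt ((sobolev_norm N (fst \<phi>))\<^sup>2 + (sobolev_norm N (snd \<phi>))\<^sup>2)"


section \<open>The Zakharov--Shabat operator on the unit interval\<close>

text \<open>
  \<open>has_H1_deriv F D\<close>: on \<open>[0,1]\<close>, \<open>F\<close> is (the absolutely continuous representative of) an
  element of \<open>H\<^sup>1\<close>, and \<open>D\<close> is its weak derivative. \<open>D\<close> is determined almost everywhere by \<open>F\<close>.
\<close>
definition has_H1_deriv :: "(real \<Rightarrow> complex^2) \<Rightarrow> (real \<Rightarrow> complex^2) \<Rightarrow> bool" where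
  "has_H1_deriv F D \<longleftrightarrow> D \<in> L2_01 \<and> (\<forall>x\<in>{0..1}. F x = F 0 + integral {0..x} D)"

definition zs_principal :: "complex^2^2" where
  "zs_principal = vector [vector [\<i>, 0], vector [0, - \<i>]]"

definition zs_potential :: "potential \<Rightarrow> real \<Rightarrow> complex^2^2" where
  "zs_potential \<phi> x = vector [vector [0, fst \<phi> x], vector [snd \<phi> x, 0]]"

text \<open>\<open>zs \<phi> F G\<close>: \<open>F\<close> belongs to \<open>H\<^sup>1\<close> on \<open>[0,1]\<close> and \<open>L(\<phi>) F = G\<close> in \<open>L\<^sup>2\<close> on \<open>[0,1]\<close>.\<close>

definition zs :: "potential \<Rightarrow> (real \<Rightarrow> complex^2) \<Rightarrow> (real \<Rightarrow> complex^2) \<Rightarrow> bool" where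
  "zs \<phi> F G \<longleftrightarrow> (\<exists>D. has_H1_deriv F D \<and>
     (AE x in lebesgue_on {0..1}. zs_principal *v D x + zs_potential \<phi> x *v F x = G x))"


section \<open>Dirichlet spectrum\<close>

text \<open>
  Each element of the domain is given by exactly one function: absolutely continuous on \<open>[0,1]\<close>
  and, by convention, zero outside.
\<close>
definition dir_domain :: "(real \<Rightarrow> complex^2) set" where
  "dir_domain = {F. (\<exists>D. has_H1_deriv F D) \<and> F 0 $ 1 = F 0 $ 2 \<and> F 1 $ 1 = F 1 $ 2 \<and>
     (\<forall>x. x \<notin> {0..1} \<longrightarrow> F x = 0)}"

text \<open>\<open>dir_shift \<phi> z F G\<close>: \<open>F\<close> is in the domain and \<open>(L(\<phi>) - z) F = G\<close> in \<open>L\<^sup>2\<close>.\<close>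

definition dir_shift ::
    "potential \<Rightarrow> complex \<Rightarrow> (real \<Rightarrow> complex^2) \<Rightarrow> (real \<Rightarrow> complex^2) \<Rightarrow> bool" where
  "dir_shift \<phi> z F G \<longleftrightarrow> F \<in> dir_domain \<and> zs \<phi> F (\<lambda>x. z *s F x + G x)"

text \<open>The resolvent set: \<open>L(\<phi>) - z\<close> is a bijection of the domain onto \<open>L\<^sup>2\<close> with bounded inverse.\<close>

definition dir_resolvent_set :: "potential \<Rightarrow> complex set" where
  "dir_resolvent_set \<phi> = {z.
     (\<forall>G\<in>L2_01. \<exists>!F. dir_shift \<phi> z F G) \<and>
     (\<exists>C. \<forall>F. \<forall>G\<in>L2_01. dir_shift \<phi> z F G \<longrightarrow> L2_norm_01 F \<le> C * L2_norm_01 G)}"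

definition dir_spectrum :: "potential \<Rightarrow> complex set" where
  "dir_spectrum \<phi> = - dir_resolvent_set \<phi>"

text \<open>\<open>dir_ker \<phi> z k\<close> is the kernel of \<open>(L(\<phi>) - z)\<^sup>k\<close> (on the domain of the \<open>k\<close>-th power).\<close>

primrec dir_ker :: "potential \<Rightarrow> complex \<Rightarrow> nat \<Rightarrow> (real \<Rightarrow> complex^2) set" where
  "dir_ker \<phi> z 0 = {0}"
| "dir_ker \<phi> z (Suc k) = {F. \<exists>G\<in>dir_ker \<phi> z k. dir_shift \<phi> z F G}"

definition fun_scale :: "complex \<Rightarrow> (real \<Rightarrow> complex^2) \<Rightarrow> real \<Rightarrow> complex^2" where
  "fun_scale c F = (\<lambda>x. c *s F x)"

interpretation fun_vs: vector_space fun_scale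
  by unfold_locales (auto simp: fun_scale_def fun_eq_iff vec_eq_iff algebra_simps)

definition dir_alg_mult :: "potential \<Rightarrow> complex \<Rightarrow> nat" where
  "dir_alg_mult \<phi> z = fun_vs.dim (\<Union>k. dir_ker \<phi> z k)"

definition lex_le :: "complex \<Rightarrow> complex \<Rightarrow> bool" where
  "lex_le a b \<longleftrightarrow> Re a < Re b \<or> (Re a = Re b \<and> Im a \<le> Im b)"

text \<open>
  \<open>dir_listing \<phi> \<mu>\<close>: \<open>\<mu>\<close> lists the Dirichlet eigenvalues of \<open>L(\<phi>)\<close> with algebraic multiplicities,
  in lexicographic order. The last condition fixes the index shift, so \<open>\<mu>\<close> is unique; it also
  forces all the sets \<open>{n. \<mu> n = z}\<close> to be finite.
\<close>
definition dir_listing :: "potential \<Rightarrow> (int \<Rightarrow> complex) \<Rightarrow> bool" where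
  "dir_listing \<phi> \<mu> \<longleftrightarrow>
     range \<mu> = dir_spectrum \<phi> \<and>
     (\<forall>z\<in>dir_spectrum \<phi>. card {n. \<mu> n = z} = dir_alg_mult \<phi> z) \<and>
     (\<forall>n. lex_le (\<mu> n) (\<mu> (n + 1))) \<and>
     (\<lambda>n. (cmod (\<mu> n - of_int n * complex_of_real pi))\<^sup>2) summable_on UNIV"


section \<open>Fundamental solution\<close>

text \<open>The fundamental solution is unique on \<open>[0,1]\<close>; only its value at \<open>x = 1\<close> is used below.\<close>

definition zs_fund :: "potential \<Rightarrow> complex \<Rightarrow> real \<Rightarrow> complex^2^2" where
  "zs_fund \<phi> z = (SOME M. M 0 = mat 1 \<and>
     (\<forall>j. zs \<phi> (\<lambda>x. column j (M x)) (\<lambda>x. z *s column j (M x))))"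

definition zs_Delta :: "potential \<Rightarrow> complex \<Rightarrow> complex" where
  "zs_Delta \<phi> z = zs_fund \<phi> z 1 $ 1 $ 1 + zs_fund \<phi> z 1 $ 2 $ 2"

definition zs_delta :: "potential \<Rightarrow> complex \<Rightarrow> complex" where
  "zs_delta \<phi> z = zs_fund \<phi> z 1 $ 1 $ 2 + zs_fund \<phi> z 1 $ 2 $ 1"

definition kappa :: "potential \<Rightarrow> (int \<Rightarrow> complex) \<Rightarrow> int \<Rightarrow> complex" where
  "kappa \<phi> \<mu> n = 2 * Ln ((-1) powi n * ((zs_Delta \<phi> (\<mu> n) + zs_delta \<phi> (\<mu> n)) / 2))"

end

theory Submission imports Defs begin

text \<open>
  Throughout, \<open>a\<^sub>m\<close> is the Fourier coefficient of \<open>\<phi>\<^sub>1\<close> at \<open>- m\<close> and \<open>b\<^sub>m\<close> that of \<open>\<phi>\<^sub>2\<close> at \<open>m\<close>, so that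
  the leading term is \<open>\<i> * (a\<^sub>n - b\<^sub>n)\<close>.

  A Dirichlet eigenfunction \<open>f\<close> has boundary values \<open>f(0) = c(1,1)\<close> and \<open>f(1) = c'(1,1)\<close>, hence
  it is a Floquet solution with multiplier \<open>c'/c\<close>. As the fundamental matrix at 1 maps \<open>(1,1)\<close> to
  \<open>(c'/c)(1,1)\<close>, adding the two components gives \<open>(\<Delta> + \<delta>)/2 = c'/c\<close> at the eigenvalue
  (\<open>fundamental_sum\<close>). So \<open>\<kappa>\<^sub>n = 2\<tau>\<close>, where \<open>exp \<tau> = (-1)\<^sup>n c'/c\<close>, and everything is about the
  Floquet exponent of one periodic problem.

  For the eigenvalue \<open>z\<close>, the functions \<open>u = exp((\<i>\<pi>n - \<tau>)x) f\<^sub>1\<close> and \<open>v = exp((-\<i>\<pi>n - \<tau>)x) f\<^sub>2\<close>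
  are 1-periodic. Let \<open>u\<^sub>k\<close> be the Fourier coefficients of \<open>u\<close>, let \<open>w\<^sub>k\<close> be the coefficient of \<open>v\<close> at
  \<open>- k\<close>, and let \<open>A = z - \<pi>n - \<i>\<tau>\<close> and \<open>B = z - \<pi>n + \<i>\<tau>\<close>. The differential equation becomes
  (\<open>floquet_hankel_system\<close>)
    \<open>(A + 2\<pi>k) u\<^sub>k = (a * w)(n - k)\<close> and \<open>(B + 2\<pi>k) w\<^sub>k = (b * u)(n - k)\<close>,
  and \<open>\<kappa>\<^sub>n = \<i>(A - B)\<close>. Solving the equations with \<open>k \<noteq> 0\<close> by iteration expresses \<open>u\<close> and \<open>w\<close> through
  the zero modes \<open>u\<^sub>0\<close> and \<open>w\<^sub>0\<close> (\<open>even_solution_exists\<close>, \<open>hankel_system_decompose\<close>). One step of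
  the iteration is not small, but two steps gain a factor \<open>1/n\<close>, with a majorant in the same
  weighted \<open>l\<^sup>2\<close> space as the coefficients that does not depend on \<open>n\<close> (\<open>norm_hop_hop_le\<close>). The
  equations with \<open>k = 0\<close> are then \<open>A = \<alpha>\<^sub>1 + s\<beta>\<^sub>1\<close> and \<open>B = \<alpha>\<^sub>2 + \<beta>\<^sub>2/s\<close>, where \<open>s = w\<^sub>0/u\<^sub>0\<close> and
  \<open>\<beta>\<^sub>1 - a\<^sub>n\<close> and \<open>\<beta>\<^sub>2 - b\<^sub>n\<close> have the required size \<open>l\<^sup>2/n\<^sup>N\<^sup>+\<^sup>1\<close>. The terms \<open>\<alpha>\<^sub>1\<close> and \<open>\<alpha>\<^sub>2\<close> are only
  of order \<open>1/n\<close>, but the matrices \<open>(a\<^sub>n\<^sub>-\<^sub>k\<^sub>-\<^sub>j)\<close> and \<open>(b\<^sub>n\<^sub>-\<^sub>k\<^sub>-\<^sub>j)\<close> are symmetric, and this forces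
  \<open>\<alpha>\<^sub>1 - \<alpha>\<^sub>2 = - (A - B)\<gamma>\<close> with \<open>\<gamma> = O(1/n\<^sup>2)\<close> (\<open>diagonal_difference\<close>). The Dirichlet condition
  \<open>u(0) = v(0)\<close> gives \<open>s = 1 + O(1/n)\<close>. Therefore \<open>A - B = a\<^sub>n - b\<^sub>n\<close> up to an error
  \<open>l\<^sup>2/n\<^sup>N\<^sup>+\<^sup>1\<close> (\<open>hankel_system_asymptotics\<close>), with constants that depend only on a bound for the
  potential.

  It remains to identify the eigenvalue that carries the index \<open>n\<close> in the listing. The integer \<open>n\<close>
  above is not given: the pair of \<open>n\<close> and \<open>\<tau>\<close> is chosen so that the real parts of \<open>A\<close> and \<open>B\<close> lie
  in \<open>[-\<pi>, \<pi>]\<close> (\<open>floquet_exponent_exists\<close>), and the estimates then show that every eigenvalue with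
  a large real part is close to some \<open>\<pi>n\<close> and has an eigenfunction close to a multiple of
  \<open>(exp(-\<i>\<pi>nx), exp(\<i>\<pi>nx))\<close> (\<open>eigen_asymptotics\<close>). Since \<open>L(\<phi>)\<close> is symmetric for the bilinear
  pairing \<open>\<integral> F\<^sub>1H\<^sub>2 + F\<^sub>2H\<^sub>1\<close>, and this pairing does not vanish on such functions, the eigenvalue
  near \<open>\<pi>n\<close> is unique and algebraically simple (\<open>eigen_unique\<close>, \<open>simple_eigenvalue\<close>). It exists by
  Brouwer's theorem (\<open>dirichlet_eigenvalue_exists\<close>). As the listing is \<open>\<pi>n\<close> plus a null
  sequence, ordered by real part, it therefore has exactly one entry near each \<open>\<pi>n\<close> with \<open>|n|\<close>
  beyond a bound that is uniform in the potential, and that entry has index \<open>n\<close>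
  (\<open>listing_localized\<close>).
\<close>

section \<open>Weighted sequence spaces and convolution\<close>

text \<open>
  Equivalent to the Sobolev weight \<open>sqrt (1 + k\<^sup>2)\<close>, and chosen instead of it because it satisfies
  the inequalities for \<open>i + j\<close> below without constants.
\<close>
definition wgt :: "int \<Rightarrow> real" where
  "wgt k = 1 + \<bar>of_int k\<bar>"

lemma wgt_ge_1 [simp]: "1 \<le> wgt k" and wgt_pos [simp]: "0 < wgt k"
  and wgt_nonneg [simp]: "0 \<le> wgt k" and wgt_neq_0 [simp]: "wgt k \<noteq> 0"
  and wgt_0 [simp]: "wgt 0 = 1" and wgt_minus [simp]: "wgt (- k) = wgt k"
  by (auto simp: wgt_def)

lemma wgt_add_le: "wgt (i + j) \<le> wgt i + wgt j"
  by (auto simp: wgt_def)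

text \<open>
  Used with \<open>i = n - k\<close> and \<open>j = k\<close>: two divisions, by the frequencies \<open>n - k\<close> and \<open>k\<close>, together give
  decay in \<open>n\<close>.
\<close>
lemma wgt_add_le_mult: "wgt (i + j) \<le> wgt i * wgt j"
proof -
  have "\<bar>real_of_int (i + j)\<bar> \<le> \<bar>real_of_int i\<bar> + \<bar>real_of_int j\<bar>"
    by (metis abs_triangle_ineq of_int_add)
  moreover have "0 \<le> \<bar>real_of_int i\<bar> * \<bar>real_of_int j\<bar>"
    by simp
  ultimately show ?thesis
    unfolding wgt_def distrib_left distrib_right by linarith
qed

lemma wgt_power_add_le: "wgt (i + j) ^ M \<le> 2 ^ M * (wgt i ^ M + wgt j ^ M)"
proof -
  have "wgt (i + j) \<le> 2 * max (wgt i) (wgt j)"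
    using wgt_add_le[of i j] by linarith
  then have "wgt (i + j) ^ M \<le> (2 * max (wgt i) (wgt j)) ^ M"
    by (intro power_mono) auto
  also have "\<dots> = 2 ^ M * max (wgt i) (wgt j) ^ M"
    by (simp add: power_mult_distrib)
  also have "\<dots> \<le> 2 ^ M * (wgt i ^ M + wgt j ^ M)"
    by (intro mult_left_mono) (auto simp: max_def)
  finally show ?thesis .
qed

lemma L2_set_inverse_wgt_le:
  assumes "finite F"
  shows "L2_set (\<lambda>k. 1 / wgt k) F \<le> 2"
proof -
  \<comment> \<open>The upper bound telescopes, since \<open>1 / (m + 2)\<^sup>2 \<le> 1 / (m + 1) - 1 / (m + 2)\<close>.\<close>
  have sym: "(\<Sum>k\<in>{- int m..int m}. (1 / wgt k)\<^sup>2) \<le> 3 - 2 / real (m + 1)" for m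
  proof (induction m)
    case 0
    then show ?case by simp
  next
    case (Suc m)
    have "{- int (Suc m)..int (Suc m)} = insert (int (Suc m)) (insert (- int (Suc m)) {- int m..int m})"
      by auto
    then have "(\<Sum>k\<in>{- int (Suc m)..int (Suc m)}. (1 / wgt k)\<^sup>2)
        = 2 * (1 / real (m + 2))\<^sup>2 + (\<Sum>k\<in>{- int m..int m}. (1 / wgt k)\<^sup>2)"
      by (simp add: wgt_def)
    also have "\<dots> \<le> 2 * (1 / real (m + 2))\<^sup>2 + (3 - 2 / real (m + 1))"
      using Suc by simp
    also have "\<dots> \<le> 3 - 2 / real (Suc m + 1)"
    proof -
      have "(1 / real (m + 2))\<^sup>2 \<le> 1 / (real (m + 1) * real (m + 2))"
        unfolding power2_eq_square times_divide_times_eq mult_1 of_nat_add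
        by (intro divide_left_mono mult_right_mono) auto
      also have "\<dots> = 1 / real (m + 1) - 1 / real (m + 2)"
        by (simp add: field_simps)
      finally show ?thesis by (simp add: algebra_simps)
    qed
    finally show ?case .
  qed
  obtain m where m: "F \<subseteq> {- int m..int m}"
  proof -
    obtain c where "\<forall>k\<in>F. \<bar>k\<bar> \<le> c"
      using assms by (metis finite_imageI finite_has_maximal bdd_above.E bdd_above_finite imageI)
    then have "F \<subseteq> {- int (nat c)..int (nat c)}" by fastforce
    then show ?thesis using that by blast
  qed
  have "(\<Sum>k\<in>F. (1 / wgt k)\<^sup>2) \<le> (\<Sum>k\<in>{- int m..int m}. (1 / wgt k)\<^sup>2)"
    using m by (intro sum_mono2) auto
  also have "\<dots> \<le> 3"
    by (rule order_trans[OF sym]) simp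
  finally show ?thesis
    unfolding L2_set_def by (intro real_le_lsqrt) (auto intro: sum_nonneg)
qed

text \<open>
  Norm bounds in \<open>l\<^sup>1\<close> and in weighted \<open>l\<^sup>2\<close> are stated through all finite sets of indices. Summability
  is then part of the bound, bounds survive pointwise limits, and constants remain explicit, as
  uniformity over bounded sets of potentials demands.
\<close>
definition l1_le :: "real \<Rightarrow> (int \<Rightarrow> 'a::real_normed_vector) \<Rightarrow> bool" where
  "l1_le C x \<longleftrightarrow> (\<forall>F. finite F \<longrightarrow> (\<Sum>k\<in>F. norm (x k)) \<le> C)"

definition wl2_le :: "nat \<Rightarrow> real \<Rightarrow> (int \<Rightarrow> 'a::real_normed_vector) \<Rightarrow> bool" where
  "wl2_le M C x \<longleftrightarrow> (\<forall>F. finite F \<longrightarrow> L2_set (\<lambda>k. wgt k ^ M * norm (x k)) F \<le> C)"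

lemma l1_leI: "(\<And>F. finite F \<Longrightarrow> (\<Sum>k\<in>F. norm (x k)) \<le> C) \<Longrightarrow> l1_le C x"
  and l1_leD: "l1_le C x \<Longrightarrow> finite F \<Longrightarrow> (\<Sum>k\<in>F. norm (x k)) \<le> C"
  by (auto simp: l1_le_def)

lemma wl2_leI: "(\<And>F. finite F \<Longrightarrow> L2_set (\<lambda>k. wgt k ^ M * norm (x k)) F \<le> C) \<Longrightarrow> wl2_le M C x"
  and wl2_leD: "wl2_le M C x \<Longrightarrow> finite F \<Longrightarrow> L2_set (\<lambda>k. wgt k ^ M * norm (x k)) F \<le> C"
  by (auto simp: wl2_le_def)

lemma l1_le_nonneg: "l1_le C x \<Longrightarrow> 0 \<le> C"
  using l1_leD[of C x "{}"] by simp

lemma wl2_le_nonneg: "wl2_le M C x \<Longrightarrow> 0 \<le> C"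
  using wl2_leD[of M C x "{}"] by simp

lemma l1_le_mono: "l1_le C y \<Longrightarrow> (\<And>k. norm (x k) \<le> norm (y k)) \<Longrightarrow> C \<le> D \<Longrightarrow> l1_le D x"
  by (rule l1_leI) (blast intro: order_trans[OF sum_mono order_trans[OF l1_leD]])

lemma wl2_le_mono: "wl2_le M C y \<Longrightarrow> (\<And>k. norm (x k) \<le> norm (y k)) \<Longrightarrow> C \<le> D \<Longrightarrow> wl2_le M D x"
  by (rule wl2_leI, rule order_trans[OF L2_set_mono order_trans[OF wl2_leD]]) (auto intro: mult_left_mono)

lemma wl2_le_power_mono:
  assumes "wl2_le M C x" "M' \<le> M"
  shows "wl2_le M' C x"
proof (rule wl2_leI)
  fix F :: "int set" assume "finite F"
  have "L2_set (\<lambda>k. wgt k ^ M' * norm (x k)) F \<le> L2_set (\<lambda>k. wgt k ^ M * norm (x k)) F"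
    using assms(2) by (intro L2_set_mono mult_right_mono power_increasing) auto
  then show "L2_set (\<lambda>k. wgt k ^ M' * norm (x k)) F \<le> C"
    using wl2_leD[OF assms(1) \<open>finite F\<close>] by linarith
qed

lemma wl2_le_norm_iff [simp]: "wl2_le M C (\<lambda>k. norm (x k)) \<longleftrightarrow> wl2_le M C x"
  by (simp add: wl2_le_def)

lemma l1_le_norm_iff [simp]: "l1_le C (\<lambda>k. norm (x k)) \<longleftrightarrow> l1_le C x"
  by (simp add: l1_le_def)

lemma l1_le_add:
  assumes "l1_le C x" "l1_le D y" shows "l1_le (C + D) (\<lambda>k. x k + y k)"
proof (rule l1_leI)
  fix F :: "int set" assume "finite F"
  have "(\<Sum>k\<in>F. norm (x k + y k)) \<le> (\<Sum>k\<in>F. norm (x k)) + (\<Sum>k\<in>F. norm (y k))"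
    by (simp add: norm_triangle_ineq sum.distrib[symmetric] sum_mono)
  then show "(\<Sum>k\<in>F. norm (x k + y k)) \<le> C + D"
    using l1_leD[OF assms(1) \<open>finite F\<close>] l1_leD[OF assms(2) \<open>finite F\<close>] by linarith
qed

lemma wl2_le_add:
  assumes "wl2_le M C x" "wl2_le M D y" shows "wl2_le M (C + D) (\<lambda>k. x k + y k)"
proof (rule wl2_leI)
  fix F :: "int set" assume "finite F"
  have "L2_set (\<lambda>k. wgt k ^ M * norm (x k + y k)) F
      \<le> L2_set (\<lambda>k. wgt k ^ M * norm (x k) + wgt k ^ M * norm (y k)) F"
    by (intro L2_set_mono) (auto simp: distrib_left[symmetric] intro!: mult_left_mono norm_triangle_ineq)
  also have "\<dots> \<le> L2_set (\<lambda>k. wgt k ^ M * norm (x k)) F + L2_set (\<lambda>k. wgt k ^ M * norm (y k)) F"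
    by (rule L2_set_triangle_ineq)
  finally show "L2_set (\<lambda>k. wgt k ^ M * norm (x k + y k)) F \<le> C + D"
    using wl2_leD[OF assms(1) \<open>finite F\<close>] wl2_leD[OF assms(2) \<open>finite F\<close>] by linarith
qed

lemma wl2_le_cmult:
  assumes "wl2_le M C x" "0 \<le> c" shows "wl2_le M (c * C) (\<lambda>k. c *\<^sub>R x k)"
proof (rule wl2_leI)
  fix F :: "int set" assume "finite F"
  have "L2_set (\<lambda>k. wgt k ^ M * norm (c *\<^sub>R x k)) F = c * L2_set (\<lambda>k. wgt k ^ M * norm (x k)) F"
    using assms(2) by (subst L2_set_right_distrib) (auto simp: mult_ac)
  then show "L2_set (\<lambda>k. wgt k ^ M * norm (c *\<^sub>R x k)) F \<le> c * C"
    using wl2_leD[OF assms(1) \<open>finite F\<close>] assms(2) by (simp add: mult_left_mono)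
qed

lemma wl2_le_pointwise:
  assumes "wl2_le M C x"
  shows "wgt k ^ M * norm (x k) \<le> C"
  using wl2_leD[OF assms, of "{k}"] by simp

lemma wl2_le_bounded:
  assumes "wl2_le M C x"
  shows "norm (x k) \<le> C"
  using wl2_le_pointwise[OF wl2_le_power_mono[OF assms, of 0], of k] by simp

lemma l1_le_bounded: "l1_le C x \<Longrightarrow> norm (x k) \<le> C"
  using l1_leD[of C x "{k}"] by simp

lemma l1_le_reindex:
  assumes "l1_le C x" "inj f" shows "l1_le C (\<lambda>k. x (f k))"
proof (rule l1_leI)
  fix F :: "int set" assume "finite F"
  have "(\<Sum>k\<in>F. norm (x (f k))) = (\<Sum>k\<in>f ` F. norm (x k))"
    using assms(2) by (subst sum.reindex) (auto intro: inj_on_subset)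
  then show "(\<Sum>k\<in>F. norm (x (f k))) \<le> C"
    using l1_leD[OF assms(1)] \<open>finite F\<close> by simp
qed

lemma wl2_0_reindex:
  assumes "wl2_le 0 C x" "inj f" shows "wl2_le 0 C (\<lambda>k. x (f k))"
proof (rule wl2_leI)
  fix F :: "int set" assume "finite F"
  have "L2_set (\<lambda>k. norm (x (f k))) F = L2_set (\<lambda>k. norm (x k)) (f ` F)"
    unfolding L2_set_def using assms(2) by (subst sum.reindex) (auto intro: inj_on_subset)
  then show "L2_set (\<lambda>k. wgt k ^ 0 * norm (x (f k))) F \<le> C"
    using wl2_leD[OF assms(1), of "f ` F"] \<open>finite F\<close> by simp
qed

lemma inj_diff_int: "inj (\<lambda>j. n - j :: int)" and inj_uminus_int: "inj (\<lambda>j. - j :: int)"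
  by (auto simp: inj_def)

lemma wl2_le_weighted: "wl2_le M C x \<longleftrightarrow> wl2_le 0 C (\<lambda>k. wgt k ^ M *\<^sub>R x k)"
  by (simp add: wl2_le_def)

lemma wl2_le_weighted': "wl2_le (Suc M) C x \<longleftrightarrow> wl2_le M C (\<lambda>k. wgt k *\<^sub>R x k)"
  by (simp add: wl2_le_def mult_ac)

lemma wl2_le_reflect:
  assumes "wl2_le M C x" shows "wl2_le M C (\<lambda>k. x (- k))"
  using wl2_0_reindex[OF assms[unfolded wl2_le_weighted[of M]] inj_uminus_int]
  by (simp add: wl2_le_weighted[of M])

text \<open>
  Cauchy--Schwarz with the square summable sequence \<open>1 / wgt j\<close>.
\<close>
lemma wl2_le_sum_div_wgt:
  assumes "wl2_le 0 C x" "finite F"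
  shows "(\<Sum>j\<in>F. norm (x (n - j)) / wgt j) \<le> 2 * C"
proof -
  have C: "wl2_le 0 C (\<lambda>j. x (n - j))"
    by (rule wl2_0_reindex[OF assms(1) inj_diff_int])
  have "(\<Sum>j\<in>F. norm (x (n - j)) / wgt j) = (\<Sum>j\<in>F. \<bar>norm (x (n - j))\<bar> * \<bar>1 / wgt j\<bar>)"
    by (simp add: divide_inverse)
  also have "\<dots> \<le> L2_set (\<lambda>j. norm (x (n - j))) F * L2_set (\<lambda>k. 1 / wgt k) F"
    by (rule L2_set_mult_ineq)
  also have "\<dots> \<le> C * 2"
    using wl2_leD[OF C assms(2)] L2_set_inverse_wgt_le[OF assms(2)] wl2_le_nonneg[OF C]
    by (intro mult_mono) auto
  finally show ?thesis by simp
qed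

text \<open>
  One power of the weight is the price for passing from \<open>l\<^sup>2\<close> to \<open>l\<^sup>1\<close>.
\<close>
lemma wl2_le_imp_l1_le:
  assumes "wl2_le (Suc M) C x"
  shows "l1_le (2 * C) (\<lambda>k. wgt k ^ M *\<^sub>R x k)"
proof (rule l1_leI)
  fix F :: "int set" assume F: "finite F"
  have "wl2_le 0 C (\<lambda>k. wgt k ^ Suc M *\<^sub>R x k)"
    using assms by (simp only: wl2_le_weighted[of "Suc M"])
  then have "wl2_le 0 C (\<lambda>k. wgt (- k) ^ Suc M *\<^sub>R x (- k))"
    by (rule wl2_0_reindex[OF _ inj_uminus_int])
  from wl2_le_sum_div_wgt[OF this F, of 0]
  show "(\<Sum>k\<in>F. norm (wgt k ^ M *\<^sub>R x k)) \<le> 2 * C"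
    by (simp add: mult_ac)
qed

lemma wl2_le_imp_l1_le_0:
  assumes "wl2_le (Suc M) C x"
  shows "l1_le (2 * C) x"
  using wl2_le_imp_l1_le[of 0 C x] wl2_le_power_mono[OF assms, of 1] by simp

text \<open>
  The decay in \<open>n\<close> comes from \<open>wgt n \<le> wgt (n - j) + wgt j\<close>: the first summand is absorbed by one
  weight of \<open>x\<close>, and the second cancels the denominator and leaves the \<open>l\<^sup>1\<close> norm of \<open>x\<close>.
\<close>
lemma wl2_le_sum_div_wgt_gain:
  assumes "wl2_le (Suc M) C x" "finite F"
  shows "(\<Sum>j\<in>F. norm (x (n - j)) / wgt j) \<le> 4 * C / wgt n"
proof -
  have x1: "wl2_le 0 C (\<lambda>k. wgt k *\<^sub>R x k)"
    using wl2_le_power_mono[OF assms(1), of 1] by (simp add: wl2_le_weighted')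
  have "wgt n * (\<Sum>j\<in>F. norm (x (n - j)) / wgt j)
      \<le> (\<Sum>j\<in>F. norm (wgt (n - j) *\<^sub>R x (n - j)) / wgt j + norm (x (n - j)))"
    unfolding sum_distrib_left
  proof (rule sum_mono)
    fix j
    have "wgt n \<le> wgt (n - j) + wgt j"
      using wgt_add_le[of "n - j" j] by simp
    then have "wgt n * (norm (x (n - j)) / wgt j) \<le> (wgt (n - j) + wgt j) * (norm (x (n - j)) / wgt j)"
      by (intro mult_right_mono) auto
    also have "\<dots> = norm (wgt (n - j) *\<^sub>R x (n - j)) / wgt j + norm (x (n - j))"
      by (simp add: field_simps)
    finally show "wgt n * (norm (x (n - j)) / wgt j) \<le> norm (wgt (n - j) *\<^sub>R x (n - j)) / wgt j + norm (x (n - j))" .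
  qed
  also have "\<dots> \<le> 2 * C + 2 * C"
    unfolding sum.distrib
    using wl2_le_sum_div_wgt[OF x1 assms(2), of n]
      l1_leD[OF l1_le_reindex[OF wl2_le_imp_l1_le_0[OF assms(1)] inj_diff_int] assms(2), of n]
    by (intro add_mono) auto
  finally show ?thesis by (simp add: field_simps)
qed

lemma l1_le_summable:
  fixes x :: "int \<Rightarrow> 'a::banach"
  assumes "l1_le C x"
  shows "(\<lambda>k. norm (x k)) summable_on A" and "x summable_on A"
proof -
  show "(\<lambda>k. norm (x k)) summable_on A"
    by (rule nonneg_bounded_partial_sums_imp_summable_on[of _ _ C])
      (auto intro!: eventually_finite_subsets_at_top_weakI l1_leD[OF assms])
  then show "x summable_on A"
    by (rule abs_summable_summable)
qed

lemma norm_infsum_le_l1: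
  fixes x :: "int \<Rightarrow> 'a::banach"
  assumes "l1_le C x"
  shows "norm (infsum x A) \<le> C" and "infsum (\<lambda>k. norm (x k)) A \<le> C"
proof -
  show *: "infsum (\<lambda>k. norm (x k)) A \<le> C"
    by (rule infsum_le_finite_sums[OF l1_le_summable(1)[OF assms]]) (auto intro: l1_leD[OF assms])
  show "norm (infsum x A) \<le> C"
    using norm_infsum_bound[OF l1_le_summable(1)[OF assms], of A] * by linarith
qed

definition conv :: "(int \<Rightarrow> 'a::{real_normed_field,banach}) \<Rightarrow> (int \<Rightarrow> 'a) \<Rightarrow> int \<Rightarrow> 'a" where
  "conv x y k = (\<Sum>\<^sub>\<infinity>j. x (k - j) * y j)"

lemma conv_commute: "conv x y k = conv y x k"
  unfolding conv_def
  by (rule infsum_reindex_bij_witness[of _ "\<lambda>j. k - j" "\<lambda>j. k - j"]) (auto simp: mult_ac)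

lemma l1_le_conv_terms:
  fixes x y :: "int \<Rightarrow> 'a::{real_normed_field,banach}"
  assumes "\<And>j. norm (x j) \<le> X" "l1_le C y"
  shows "l1_le (X * C) (\<lambda>j. x (k - j) * y j)"
proof (rule l1_leI)
  fix F :: "int set" assume F: "finite F"
  have X: "0 \<le> X" using assms(1)[of 0] norm_ge_zero order_trans by blast
  have "(\<Sum>j\<in>F. norm (x (k - j) * y j)) \<le> (\<Sum>j\<in>F. X * norm (y j))"
    by (intro sum_mono) (auto simp: norm_mult intro!: mult_right_mono assms)
  also have "\<dots> \<le> X * C"
    using l1_leD[OF assms(2) F] X by (simp add: sum_distrib_left[symmetric] mult_left_mono)
  finally show "(\<Sum>j\<in>F. norm (x (k - j) * y j)) \<le> X * C" .
qed

lemma l1_le_conv_terms':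
  fixes x y :: "int \<Rightarrow> 'a::{real_normed_field,banach}"
  assumes "l1_le C x" "\<And>j. norm (y j) \<le> X"
  shows "l1_le (X * C) (\<lambda>j. x (k - j) * y j)"
  using l1_le_reindex[OF l1_le_conv_terms[where x = y and y = x and k = k, OF assms(2,1)] inj_diff_int[of k]]
  by (simp add: mult.commute)

lemma norm_conv_le:
  fixes x y :: "int \<Rightarrow> 'a::{real_normed_field,banach}"
  assumes "l1_le C x" "\<And>j. norm (y j) \<le> Y"
  shows "norm (conv x y k) \<le> conv (\<lambda>j. norm (x j)) (\<lambda>j. norm (y j)) k" and "norm (conv x y k) \<le> Y * C"
proof -
  note l = l1_le_conv_terms'[OF assms, where k = k]
  show "norm (conv x y k) \<le> conv (\<lambda>j. norm (x j)) (\<lambda>j. norm (y j)) k"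
    unfolding conv_def using norm_infsum_bound[OF l1_le_summable(1)[OF l]] by (simp add: norm_mult)
  show "norm (conv x y k) \<le> Y * C"
    unfolding conv_def by (rule norm_infsum_le_l1(1)[OF l])
qed

lemma conv_add_right:
  assumes "l1_le C x" "\<And>j. norm (y j) \<le> Y" "\<And>j. norm (z j) \<le> Z"
  shows "conv x (\<lambda>j. y j + z j) k = conv x y k + conv x z k"
  unfolding conv_def distrib_left
  by (intro infsum_add l1_le_summable(2)[OF l1_le_conv_terms'[OF assms(1,2)]]
      l1_le_summable(2)[OF l1_le_conv_terms'[OF assms(1,3)]])

lemma conv_cmult_right: "conv x (\<lambda>j. c * y j) k = c * conv x y k"
proof -
  have "(\<lambda>j. x (k - j) * (c * y j)) = (\<lambda>j. c * (x (k - j) * y j))"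
    by (auto simp: mult_ac)
  then show ?thesis
    unfolding conv_def by (simp add: infsum_cmult_right')
qed

lemma conv_nonneg:
  fixes x y :: "int \<Rightarrow> real"
  shows "(\<And>j. 0 \<le> x j) \<Longrightarrow> (\<And>j. 0 \<le> y j) \<Longrightarrow> 0 \<le> conv x y k"
  unfolding conv_def by (intro infsum_nonneg) auto

lemma conv_mono_right:
  fixes x y :: "int \<Rightarrow> real"
  assumes "l1_le C x" "\<And>j. 0 \<le> x j" "\<And>j. 0 \<le> y j" "\<And>j. y j \<le> z j" "\<And>j. z j \<le> Z"
  shows "conv x y k \<le> conv x z k"
proof -
  have "\<And>j. norm (y j) \<le> Z" "\<And>j. norm (z j) \<le> Z"
    using assms(3,4,5) by (auto simp: abs_le_iff intro: order_trans) (smt (verit) assms)+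
  then show ?thesis
    unfolding conv_def using assms
    by (intro infsum_mono l1_le_summable(2)[OF l1_le_conv_terms'[OF assms(1)]] mult_left_mono) auto
qed

lemma L2_set_sum_le:
  assumes "finite J"
  shows "L2_set (\<lambda>k. norm (\<Sum>j\<in>J. f k j)) F \<le> (\<Sum>j\<in>J. L2_set (\<lambda>k. norm (f k j)) F)"
  using assms
proof (induction J)
  case (insert i J)
  have "L2_set (\<lambda>k. norm (\<Sum>j\<in>insert i J. f k j)) F
      \<le> L2_set (\<lambda>k. norm (f k i) + norm (\<Sum>j\<in>J. f k j)) F"
    using insert by (intro L2_set_mono) (auto intro: norm_triangle_ineq)
  also have "\<dots> \<le> L2_set (\<lambda>k. norm (f k i)) F + L2_set (\<lambda>k. norm (\<Sum>j\<in>J. f k j)) F"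
    by (rule L2_set_triangle_ineq)
  finally show ?case using insert by simp
qed (simp add: L2_set_def)

text \<open>
  Young's inequality: the bound for finite partial sums is Minkowski's inequality for translates of
  \<open>x\<close>, and it passes to the limit.
\<close>
lemma wl2_0_conv:
  fixes x y :: "int \<Rightarrow> 'a::{real_normed_field,banach}"
  assumes x: "wl2_le 0 X x" and y: "l1_le Y y"
  shows "wl2_le 0 (X * Y) (conv x y)"
proof (rule wl2_leI)
  fix F :: "int set" assume F: "finite F"
  let ?S = "\<lambda>J k. \<Sum>j\<in>J. x (k - j) * y j"
  have lim: "((\<lambda>J. L2_set (\<lambda>k. norm (?S J k)) F) \<longlongrightarrow> L2_set (\<lambda>k. norm (conv x y k)) F)
      (finite_subsets_at_top UNIV)"
    unfolding L2_set_def conv_def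
  proof (intro tendsto_real_sqrt tendsto_sum tendsto_power tendsto_norm)
    fix k
    have "(\<lambda>j. x (k - j) * y j) summable_on UNIV"
      by (rule l1_le_summable(2)[OF l1_le_conv_terms[OF wl2_le_bounded[OF x] y]])
    then show "((\<lambda>J. ?S J k) \<longlongrightarrow> (\<Sum>\<^sub>\<infinity>j. x (k - j) * y j)) (finite_subsets_at_top UNIV)"
      using has_sum_def summable_iff_has_sum_infsum by blast
  qed
  have bound: "L2_set (\<lambda>k. norm (?S J k)) F \<le> X * Y" if J: "finite J" for J
  proof -
    have "L2_set (\<lambda>k. norm (?S J k)) F \<le> (\<Sum>j\<in>J. L2_set (\<lambda>k. norm (x (k - j) * y j)) F)"
      by (rule L2_set_sum_le[OF J])
    also have "\<dots> \<le> (\<Sum>j\<in>J. X * norm (y j))"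
    proof (rule sum_mono)
      fix j
      have "wl2_le 0 X (\<lambda>k. x (k - j))"
        by (rule wl2_0_reindex[OF x]) (auto simp: inj_def)
      from wl2_leD[OF this F] show "L2_set (\<lambda>k. norm (x (k - j) * y j)) F \<le> X * norm (y j)"
        by (simp add: norm_mult L2_set_left_distrib[symmetric] mult_right_mono)
    qed
    also have "\<dots> \<le> X * Y"
      using l1_leD[OF y J] wl2_le_nonneg[OF x] by (simp add: sum_distrib_left[symmetric] mult_left_mono)
    finally show ?thesis .
  qed
  have "L2_set (\<lambda>k. norm (conv x y k)) F \<le> X * Y"
    by (rule tendsto_upperbound[OF lim])
      (auto intro!: eventually_finite_subsets_at_top_weakI bound)
  then show "L2_set (\<lambda>k. wgt k ^ 0 * norm (conv x y k)) F \<le> X * Y" by simp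
qed

text \<open>
  Up to the factor \<open>2 ^ M\<close>, a weight on a convolution can be moved to one of the two factors. The two
  alternatives in the last hypothesis say which factor is summable when the weight is on \<open>y\<close>.
\<close>
lemma weighted_norm_conv_le:
  fixes x y :: "int \<Rightarrow> 'a::{real_normed_field,banach}"
  assumes x: "wl2_le 0 X x" and y: "l1_le Y y"
    and wx: "wl2_le 0 X' (\<lambda>k. wgt k ^ M *\<^sub>R x k)"
    and wy: "l1_le Y' (\<lambda>k. wgt k ^ M *\<^sub>R y k) \<or> l1_le X'' x \<and> wl2_le 0 Y' (\<lambda>k. wgt k ^ M *\<^sub>R y k)"
  shows "wgt k ^ M * norm (conv x y k)
    \<le> 2 ^ M * (conv (\<lambda>j. wgt j ^ M * norm (x j)) (\<lambda>j. norm (y j)) k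
               + conv (\<lambda>j. norm (x j)) (\<lambda>j. wgt j ^ M * norm (y j)) k)"
proof -
  note l = l1_le_conv_terms[OF wl2_le_bounded[OF x] y, where k = k]
  have s1: "(\<lambda>j. (wgt (k - j) ^ M * norm (x (k - j))) * norm (y j)) summable_on UNIV"
    using l1_le_summable(1)[OF l1_le_conv_terms[of "\<lambda>j. wgt j ^ M *\<^sub>R x j" X' Y y k]]
      wl2_le_bounded[OF wx] y by (simp add: norm_mult mult_ac)
  have s2: "(\<lambda>j. norm (x (k - j)) * (wgt j ^ M * norm (y j))) summable_on UNIV"
    using wy
  proof
    assume "l1_le Y' (\<lambda>k. wgt k ^ M *\<^sub>R y k)"
    from l1_le_summable(1)[OF l1_le_conv_terms[OF wl2_le_bounded[OF x] this, where k = k]] show ?thesis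
      by (simp add: norm_mult mult_ac)
  next
    assume "l1_le X'' x \<and> wl2_le 0 Y' (\<lambda>k. wgt k ^ M *\<^sub>R y k)"
    then have "l1_le X'' x" and *: "wl2_le 0 Y' (\<lambda>k. wgt k ^ M *\<^sub>R y k)" by auto
    from l1_le_summable(1)[OF l1_le_conv_terms'[OF this(1) wl2_le_bounded[OF *], where k = k]] show ?thesis
      by (simp add: norm_mult mult_ac)
  qed
  have "norm (conv x y k) \<le> (\<Sum>\<^sub>\<infinity>j. norm (x (k - j) * y j))"
    unfolding conv_def using norm_infsum_bound[OF l1_le_summable(1)[OF l]] .
  then have "wgt k ^ M * norm (conv x y k) \<le> wgt k ^ M * (\<Sum>\<^sub>\<infinity>j. norm (x (k - j) * y j))"
    by (intro mult_left_mono) auto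
  also have "\<dots> = (\<Sum>\<^sub>\<infinity>j. wgt k ^ M * norm (x (k - j) * y j))"
    by (simp add: infsum_cmult_right')
  also have "\<dots> \<le> (\<Sum>\<^sub>\<infinity>j. 2 ^ M * ((wgt (k - j) ^ M * norm (x (k - j))) * norm (y j)
      + norm (x (k - j)) * (wgt j ^ M * norm (y j))))"
  proof (rule infsum_mono)
    show "(\<lambda>j. wgt k ^ M * norm (x (k - j) * y j)) summable_on UNIV"
      by (intro summable_on_cmult_right l1_le_summable(1)[OF l])
    show "(\<lambda>j. 2 ^ M * ((wgt (k - j) ^ M * norm (x (k - j))) * norm (y j)
      + norm (x (k - j)) * (wgt j ^ M * norm (y j)))) summable_on UNIV"
      by (intro summable_on_cmult_right summable_on_add s1 s2)
    fix j
    have "wgt k ^ M \<le> 2 ^ M * (wgt (k - j) ^ M + wgt j ^ M)"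
      using wgt_power_add_le[of "k - j" j M] by simp
    from mult_right_mono[OF this, of "norm (x (k - j)) * norm (y j)"]
    show "wgt k ^ M * norm (x (k - j) * y j) \<le> 2 ^ M * ((wgt (k - j) ^ M * norm (x (k - j))) * norm (y j)
      + norm (x (k - j)) * (wgt j ^ M * norm (y j)))"
      by (simp add: norm_mult algebra_simps)
  qed
  also have "\<dots> = 2 ^ M * (conv (\<lambda>j. wgt j ^ M * norm (x j)) (\<lambda>j. norm (y j)) k
               + conv (\<lambda>j. norm (x j)) (\<lambda>j. wgt j ^ M * norm (y j)) k)"
    unfolding conv_def by (subst infsum_cmult_right', subst infsum_add[OF s1 s2]) simp
  finally show ?thesis .
qed

text \<open>
  Weighted \<open>l\<^sup>2\<close> is an algebra under convolution. In the case \<open>M = P\<close> the first factor has one weight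
  less than the second, as happens in \<open>wl2_zop\<close> below, where a division by the frequency restores it.
\<close>
lemma wl2_conv:
  fixes x y :: "int \<Rightarrow> 'a::{real_normed_field,banach}"
  assumes x: "wl2_le M X x" and y: "wl2_le (Suc P) Y y" and M: "M = P \<or> M = Suc P"
  shows "wl2_le M (8 * 2 ^ P * X * Y) (conv x y)"
proof -
  have X: "0 \<le> X" and Y: "0 \<le> Y" using assms wl2_le_nonneg by auto
  have x0: "wl2_le 0 X x" and wx: "wl2_le 0 X (\<lambda>k. wgt k ^ M *\<^sub>R x k)"
    using x wl2_le_power_mono[OF x, of 0] by (auto simp: wl2_le_weighted[of M])
  have y1: "l1_le (2 * Y) y"
    by (rule wl2_le_imp_l1_le_0[OF y])
  have wy: "l1_le (2 * Y) (\<lambda>k. wgt k ^ M *\<^sub>R y k) \<or> l1_le (2 * X) x \<and> wl2_le 0 (2 * Y) (\<lambda>k. wgt k ^ M *\<^sub>R y k)"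
    using M
  proof
    assume "M = P"
    then show ?thesis using wl2_le_imp_l1_le[OF y] by auto
  next
    assume "M = Suc P"
    then show ?thesis using wl2_le_imp_l1_le_0[of P X x] x y Y
      by (auto simp: wl2_le_weighted[of "Suc P"] intro: wl2_le_mono)
  qed
  let ?A = "conv (\<lambda>j. wgt j ^ M * norm (x j)) (\<lambda>j. norm (y j))"
  let ?B = "conv (\<lambda>j. norm (x j)) (\<lambda>j. wgt j ^ M * norm (y j))"
  have A: "wl2_le 0 (X * (2 * Y)) ?A"
    by (rule wl2_0_conv) (use wx y1 in \<open>auto simp: wl2_le_def l1_le_def\<close>)
  have B: "wl2_le 0 (2 * X * Y) ?B"
    using M
  proof
    assume "M = P"
    then show ?thesis using wl2_0_conv[of X "\<lambda>j. norm (x j)" "2 * Y" "\<lambda>j. wgt j ^ M * norm (y j)"]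
      x0 wl2_le_imp_l1_le[OF y] by (auto simp: wl2_le_def l1_le_def mult_ac)
  next
    assume MS: "M = Suc P"
    have "wl2_le 0 (Y * (2 * X)) (conv (\<lambda>j. wgt j ^ M * norm (y j)) (\<lambda>j. norm (x j)))"
      by (rule wl2_0_conv) (use MS y wl2_le_imp_l1_le_0[of P X x] x in \<open>auto simp: wl2_le_def l1_le_def\<close>)
    moreover have "conv (\<lambda>j. wgt j ^ M * norm (y j)) (\<lambda>j. norm (x j)) = ?B"
      by (rule ext) (rule conv_commute)
    ultimately show ?thesis by (simp add: mult_ac)
  qed
  have "wl2_le 0 (2 ^ M * (X * (2 * Y) + 2 * X * Y)) (\<lambda>k. 2 ^ M *\<^sub>R (?A k + ?B k))"
    by (intro wl2_le_cmult wl2_le_add A B) auto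
  then have "wl2_le 0 (8 * 2 ^ P * X * Y) (\<lambda>k. wgt k ^ M *\<^sub>R conv x y k)"
  proof (rule wl2_le_mono)
    fix k
    show "norm (wgt k ^ M *\<^sub>R conv x y k) \<le> norm (2 ^ M *\<^sub>R (?A k + ?B k))"
      using weighted_norm_conv_le[OF x0 y1 wx wy, of k] by (simp add: norm_mult abs_le_iff)
  next
    have "(2::real) ^ M \<le> 2 * 2 ^ P" using M by auto
    from mult_right_mono[OF this, of "4 * X * Y"]
    show "2 ^ M * (X * (2 * Y) + 2 * X * Y) \<le> 8 * 2 ^ P * X * Y"
      using X Y by (simp add: algebra_simps)
  qed
  then show ?thesis by (simp add: wl2_le_weighted[of M])
qed

section \<open>Even and odd solutions of the Hankel system\<close>

text \<open>
  The equation \<open>(A + 2\<pi>k) u\<^sub>k = (a * x)(n - k)\<close> solved for \<open>u\<^sub>k\<close>. The mode \<open>k = 0\<close>, where the divisor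
  \<open>A\<close> may be small, is left out; a step of the iteration leads from one component of the system to
  the other.
\<close>
definition hop :: "int \<Rightarrow> complex \<Rightarrow> (int \<Rightarrow> complex) \<Rightarrow> (int \<Rightarrow> complex) \<Rightarrow> int \<Rightarrow> complex" where
  "hop n A a x k = (if k = 0 then 0 else conv a x (n - k) / (A + 2 * of_real pi * of_int k))"

definition delta0 :: "int \<Rightarrow> complex" where
  "delta0 k = of_bool (k = 0)"

text \<open>
  Majorant for \<open>wgt n\<close> times two steps of the iteration, in which \<open>n\<close> no longer occurs; see
  \<open>norm_hop_hop_le\<close>.
\<close>
definition zop :: "(int \<Rightarrow> complex) \<Rightarrow> (int \<Rightarrow> real) \<Rightarrow> int \<Rightarrow> real" where
  "zop b c k = conv (\<lambda>j. cmod (b (- j))) (\<lambda>j. wgt j * c j) k / wgt k"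

lemma delta0_simps [simp]: "delta0 0 = 1" "k \<noteq> 0 \<Longrightarrow> delta0 k = 0" and norm_delta0_le: "norm (delta0 k) \<le> 1"
  by (auto simp: delta0_def)

lemma hop_0 [simp]: "hop n A a x 0 = 0"
  by (simp add: hop_def)

text \<open>
  For \<open>k \<noteq> 0\<close> the divisor stays away from zero because the real part of \<open>A\<close> is at most half of the
  spacing \<open>2\<pi>\<close> of the frequencies.
\<close>
lemma wgt_le_symbol:
  assumes "\<bar>Re A\<bar> \<le> pi" "k \<noteq> 0"
  shows "wgt k \<le> cmod (A + 2 * of_real pi * of_int k)"
proof -
  have k: "1 \<le> \<bar>real_of_int k\<bar>" using assms(2) by linarith
  have "wgt k \<le> 2 * \<bar>real_of_int k\<bar>" using k by (simp add: wgt_def)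
  also have "\<dots> \<le> pi * \<bar>real_of_int k\<bar>"
    using pi_ge_two by (intro mult_right_mono) auto
  also have "\<dots> \<le> 2 * pi * \<bar>real_of_int k\<bar> - pi"
    using mult_left_mono[OF k, of pi] by simp
  also have "\<dots> \<le> \<bar>Re A + 2 * pi * real_of_int k\<bar>"
  proof -
    have "\<bar>2 * pi * real_of_int k\<bar> = 2 * pi * \<bar>real_of_int k\<bar>"
      by (simp add: abs_mult)
    then show ?thesis using assms(1) by linarith
  qed
  also have "\<dots> = \<bar>Re (A + 2 * of_real pi * of_int k)\<bar>"
    by simp
  also have "\<dots> \<le> cmod (A + 2 * of_real pi * of_int k)"
    by (rule abs_Re_le_cmod)
  finally show ?thesis .
qed

lemma norm_hop_le:
  assumes "\<bar>Re A\<bar> \<le> pi"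
  shows "norm (hop n A a x k) \<le> norm (conv a x (n - k)) / wgt k"
proof (cases "k = 0")
  case False
  have "norm (conv a x (n - k)) / cmod (A + 2 * of_real pi * of_int k) \<le> norm (conv a x (n - k)) / wgt k"
    by (intro divide_left_mono mult_pos_pos wgt_pos less_le_trans[OF wgt_pos wgt_le_symbol] wgt_le_symbol assms False) auto
  then show ?thesis using False by (simp add: hop_def norm_divide)
qed simp

lemma hop_bounded:
  assumes "\<bar>Re A\<bar> \<le> pi" "l1_le S a" "\<And>j. norm (x j) \<le> X"
  shows "norm (hop n A a x k) \<le> X * S / wgt k" "norm (hop n A a x k) \<le> X * S"
proof -
  show 1: "norm (hop n A a x k) \<le> X * S / wgt k"
    by (rule order_trans[OF norm_hop_le[OF assms(1)]])
      (intro divide_right_mono norm_conv_le[OF assms(2,3)] wgt_nonneg)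
  have "0 \<le> X * S" using norm_conv_le(2)[OF assms(2,3), of 0] norm_ge_zero order_trans by blast
  then show "norm (hop n A a x k) \<le> X * S"
    by (intro order_trans[OF 1] divide_le_eq_1_pos[THEN iffD2] ) (simp add: divide_le_eq mult_le_cancel_left1)
qed

lemma hop_add:
  assumes "l1_le S a" "\<And>j. norm (x j) \<le> X" "\<And>j. norm (y j) \<le> Y"
  shows "hop n A a (\<lambda>j. x j + y j) k = hop n A a x k + hop n A a y k"
  by (simp add: hop_def conv_add_right[OF assms] add_divide_distrib)

lemma hop_cmult: "hop n A a (\<lambda>j. c * x j) k = c * hop n A a x k"
  by (simp add: hop_def conv_cmult_right)

lemma conv_delta0 [simp]: "conv a delta0 k = a k"
proof -
  have "conv a delta0 k = (\<Sum>\<^sub>\<infinity>j\<in>{0}. a (k - j) * delta0 j)"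
    unfolding conv_def by (rule infsum_cong_neutral) auto
  then show ?thesis by simp
qed

lemma norm_conv_div_wgt_le:
  fixes b y :: "int \<Rightarrow> complex"
  assumes "wl2_le (Suc M) R b" "\<And>j. norm (y j) \<le> Y / wgt j"
  shows "norm (conv b y m) \<le> 4 * R * Y / wgt m"
proof -
  have Y: "0 \<le> Y" using order_trans[OF norm_ge_zero assms(2)[of 0]] by simp
  have "l1_le (4 * R * Y / wgt m) (\<lambda>j. b (m - j) * y j)"
  proof (rule l1_leI)
    fix F :: "int set" assume F: "finite F"
    have "(\<Sum>j\<in>F. norm (b (m - j) * y j)) \<le> (\<Sum>j\<in>F. Y * (norm (b (m - j)) / wgt j))"
    proof (rule sum_mono)
      fix j
      show "norm (b (m - j) * y j) \<le> Y * (norm (b (m - j)) / wgt j)"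
        using mult_left_mono[OF assms(2), of "norm (b (m - j))" j] by (simp add: norm_mult mult_ac)
    qed
    also have "\<dots> = Y * (\<Sum>j\<in>F. norm (b (m - j)) / wgt j)"
      by (simp add: sum_distrib_left)
    also have "\<dots> \<le> Y * (4 * R / wgt m)"
      by (intro mult_left_mono wl2_le_sum_div_wgt_gain[OF assms(1) F] Y)
    finally show "(\<Sum>j\<in>F. norm (b (m - j) * y j)) \<le> 4 * R * Y / wgt m" by (simp add: mult_ac)
  qed
  then show ?thesis unfolding conv_def by (rule norm_infsum_le_l1)
qed

text \<open>
  The two steps divide by the frequencies \<open>k\<close> and \<open>n - k\<close> (the second one after the convolution with
  \<open>b\<close>, by \<open>norm_conv_div_wgt_le\<close>), and \<open>wgt n \<le> wgt (n - k) * wgt k\<close>.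
\<close>
lemma norm_hop_hop_le_sup:
  assumes "wl2_le (Suc P) R a" "wl2_le (Suc P) R b" "\<bar>Re A\<bar> \<le> pi" "\<bar>Re B\<bar> \<le> pi"
    and x: "\<And>j. norm (x j) \<le> X"
  shows "norm (hop n B b (hop n A a x) k) \<le> 8 * R\<^sup>2 * X / wgt n"
proof -
  have X: "0 \<le> X" using x[of 0] norm_ge_zero order_trans by blast
  have "norm (hop n A a x j) \<le> (2 * R * X) / wgt j" for j
    using hop_bounded(1)[OF assms(3) wl2_le_imp_l1_le_0[OF assms(1)] x] by (simp add: mult_ac)
  then have "norm (conv b (hop n A a x) (n - k)) \<le> 4 * R * (2 * R * X) / wgt (n - k)"
    by (rule norm_conv_div_wgt_le[OF assms(2)])
  then have "norm (hop n B b (hop n A a x) k) \<le> 4 * R * (2 * R * X) / wgt (n - k) / wgt k"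
    by (intro order_trans[OF norm_hop_le[OF assms(4)]] divide_right_mono) auto
  also have "\<dots> = 8 * R\<^sup>2 * X / (wgt (n - k) * wgt k)"
    by (simp add: power2_eq_square)
  also have "\<dots> \<le> 8 * R\<^sup>2 * X / wgt n"
    using wgt_add_le_mult[of "n - k" k] X by (intro divide_left_mono) auto
  finally show ?thesis .
qed

lemma wl2_zop:
  assumes "wl2_le (Suc P) R b" "wl2_le (Suc P) C c"
  shows "wl2_le (Suc P) (8 * 2 ^ P * C * R) (zop b c)"
proof -
  let ?b = "\<lambda>j. cmod (b (- j))" and ?c = "\<lambda>j. wgt j * c j"
  have "wl2_le P (8 * 2 ^ P * C * R) (conv ?c ?b)"
    using wl2_conv[of P C ?c P R ?b] assms wl2_le_reflect[OF assms(1)]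
    by (simp add: wl2_le_weighted'[of P C c])
  moreover have "conv ?c ?b = (\<lambda>k. wgt k *\<^sub>R zop b c k)"
    by (auto simp: fun_eq_iff zop_def conv_commute)
  ultimately show ?thesis by (simp add: wl2_le_weighted'[of P])
qed

lemma zop_nonneg: "(\<And>j. 0 \<le> c j) \<Longrightarrow> 0 \<le> zop b c k"
  unfolding zop_def by (intro divide_nonneg_nonneg conv_nonneg) auto

text \<open>
  In contrast to \<open>norm_hop_hop_le_sup\<close> this keeps the weighted \<open>l\<^sup>2\<close> structure. Write
  \<open>wgt n \<le> wgt (n - j) * wgt j\<close>, where \<open>j\<close> is the index between the two steps. The second factor cancels
  the division in the first step, and the first factor is a weight for the inner convolution, which is
  evaluated at \<open>n - j\<close>. The substitution \<open>j \<mapsto> n - j\<close> then makes \<open>n\<close> disappear altogether.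
\<close>
lemma norm_hop_hop_le:
  assumes a: "wl2_le (Suc P) R a" and b: "wl2_le (Suc P) R b" and AB: "\<bar>Re A\<bar> \<le> pi" "\<bar>Re B\<bar> \<le> pi"
    and x: "wl2_le (Suc P) X x"
  shows "wgt n * norm (hop n B b (hop n A a x) k) \<le> zop b (conv (\<lambda>j. norm (a j)) (\<lambda>j. norm (x j))) k"
proof -
  let ?c = "conv (\<lambda>j. norm (a j)) (\<lambda>j. norm (x j))"
  note a1 = wl2_le_imp_l1_le_0[OF a]
  have c0: "0 \<le> ?c j" for j by (rule conv_nonneg) auto
  have c: "wl2_le (Suc P) (8 * 2 ^ P * R * X) ?c"
    by (rule wl2_conv) (use a x in auto)
  have cb: "norm (wgt j * ?c j) \<le> 8 * 2 ^ P * R * X" for j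
    using wl2_le_bounded[OF wl2_le_weighted'[THEN iffD1, OF c]] by simp
  have h: "wgt n * norm (hop n A a x j) \<le> wgt (n - j) * ?c (n - j)" for j
  proof -
    have "norm (hop n A a x j) \<le> ?c (n - j) / wgt j"
      by (rule order_trans[OF norm_hop_le[OF AB(1)]])
        (intro divide_right_mono norm_conv_le(1)[OF a1 wl2_le_bounded[OF x]] wgt_nonneg)
    then have "wgt n * norm (hop n A a x j) \<le> (wgt (n - j) * wgt j) * (?c (n - j) / wgt j)"
      using wgt_add_le_mult[of "n - j" j] by (intro mult_mono) (auto simp: c0)
    then show ?thesis by simp
  qed
  have b': "l1_le (2 * R) (\<lambda>j. norm (b (- j)))"
    using l1_le_reindex[OF wl2_le_imp_l1_le_0[OF b] inj_uminus_int] by simp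
  note l = l1_le_conv_terms'[OF b' cb, where k = k]
  have hb: "norm (hop n A a x j) \<le> X * (2 * R)" for j
    by (rule hop_bounded(2)[OF AB(1) a1 wl2_le_bounded[OF x]])
  have "wgt n * norm (conv b (hop n A a x) (n - k))
      \<le> (\<Sum>\<^sub>\<infinity>j. wgt n * norm (b (n - k - j) * hop n A a x j))"
    unfolding conv_def
    using norm_infsum_bound[OF l1_le_summable(1)[OF l1_le_conv_terms'[OF wl2_le_imp_l1_le_0[OF b] hb]], where A=UNIV]
    by (simp add: infsum_cmult_right' mult_left_mono)
  also have "\<dots> \<le> (\<Sum>\<^sub>\<infinity>j. norm (b (n - k - j)) * (wgt (n - j) * ?c (n - j)))"
  proof (rule infsum_mono)
    show "(\<lambda>j. wgt n * norm (b (n - k - j) * hop n A a x j)) summable_on UNIV"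
      by (intro summable_on_cmult_right l1_le_summable(1)[OF l1_le_conv_terms'[OF wl2_le_imp_l1_le_0[OF b] hb]])
    have "(\<lambda>j. norm (b (- (k - j))) * (wgt j * ?c j)) summable_on UNIV"
      by (rule l1_le_summable(2)[OF l])
    then have "((\<lambda>j. norm (b (- (k - j))) * (wgt j * ?c j)) \<circ> (\<lambda>j. n - j)) summable_on UNIV"
      by (subst summable_on_reindex[symmetric]) (auto simp: inj_def surj_def intro: summable_on_subset_banach)
    then show "(\<lambda>j. norm (b (n - k - j)) * (wgt (n - j) * ?c (n - j))) summable_on UNIV"
      by (simp add: o_def algebra_simps)
    show "wgt n * norm (b (n - k - j) * hop n A a x j) \<le> norm (b (n - k - j)) * (wgt (n - j) * ?c (n - j))" for j
      using mult_left_mono[OF h[of j], of "norm (b (n - k - j))"] by (simp add: norm_mult mult_ac)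
  qed
  also have "\<dots> = conv (\<lambda>j. norm (b (- j))) (\<lambda>j. wgt j * ?c j) k"
    unfolding conv_def
    by (rule infsum_reindex_bij_witness[of _ "\<lambda>j. n - j" "\<lambda>j. n - j"]) (auto simp: algebra_simps)
  finally have "wgt n * norm (conv b (hop n A a x) (n - k)) / wgt k \<le> zop b ?c k"
    unfolding zop_def by (intro divide_right_mono) auto
  moreover have "wgt n * norm (hop n B b (hop n A a x) k) \<le> wgt n * (norm (conv b (hop n A a x) (n - k)) / wgt k)"
    by (intro mult_left_mono norm_hop_le AB) auto
  ultimately show ?thesis by simp
qed

text \<open>
  The constant in the bound \<open>hconst P R / wgt n\<close> for two steps of the iteration, as an operator on the
  weighted \<open>l\<^sup>2\<close> space.
\<close>
definition hconst :: "nat \<Rightarrow> real \<Rightarrow> real" where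
  "hconst P R = (8 * 2 ^ P * R)\<^sup>2"

lemma hconst_ge: "8 * R\<^sup>2 \<le> hconst P R"
proof -
  have "8 * R\<^sup>2 \<le> (8 * 2 ^ P)\<^sup>2 * R\<^sup>2"
  proof (rule mult_right_mono)
    have "8 * 1 \<le> (8 * 2 ^ P :: real)" by (intro mult_left_mono one_le_power) auto
    moreover have "(8 * 2 ^ P :: real) * 1 \<le> (8 * 2 ^ P)\<^sup>2"
      unfolding power2_eq_square using calculation by (intro mult_left_mono) linarith+
    ultimately show "8 \<le> (8 * 2 ^ P :: real)\<^sup>2" by linarith
  qed auto
  then show ?thesis by (simp add: hconst_def power_mult_distrib)
qed

lemma wl2_hop_hop:
  assumes "wl2_le (Suc P) R a" "wl2_le (Suc P) R b" "\<bar>Re A\<bar> \<le> pi" "\<bar>Re B\<bar> \<le> pi" "wl2_le (Suc P) X x"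
  shows "wl2_le (Suc P) (hconst P R * X / wgt n) (hop n B b (hop n A a x))"
proof -
  let ?c = "conv (\<lambda>j. norm (a j)) (\<lambda>j. norm (x j))"
  have "wl2_le (Suc P) (8 * 2 ^ P * R * X) ?c"
    by (rule wl2_conv) (use assms in auto)
  then have "wl2_le (Suc P) (8 * 2 ^ P * (8 * 2 ^ P * R * X) * R) (zop b ?c)"
    by (rule wl2_zop[OF assms(2)])
  then have "wl2_le (Suc P) (1 / wgt n * (8 * 2 ^ P * (8 * 2 ^ P * R * X) * R)) (\<lambda>k. (1 / wgt n) *\<^sub>R zop b ?c k)"
    by (rule wl2_le_cmult) auto
  then show ?thesis
  proof (rule wl2_le_mono)
    show "norm (hop n B b (hop n A a x) k) \<le> norm ((1 / wgt n) *\<^sub>R zop b ?c k)" for k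
    proof -
      have "norm (hop n B b (hop n A a x) k) \<le> zop b ?c k / wgt n"
        using norm_hop_hop_le[OF assms, of n k] by (simp add: field_simps)
      also have "\<dots> \<le> \<bar>zop b ?c k / wgt n\<bar>" by (rule abs_ge_self)
      finally show ?thesis by simp
    qed
  qed (simp add: hconst_def power2_eq_square mult_ac)
qed

text \<open>
  Two steps of the iteration halve every bound for the supremum of \<open>d\<close>.
\<close>
lemma fixed_point_unique:
  assumes "wl2_le (Suc P) R a" "wl2_le (Suc P) R b" "\<bar>Re A\<bar> \<le> pi" "\<bar>Re B\<bar> \<le> pi"
    and n: "2 * hconst P R \<le> wgt n"
    and d: "\<And>k. norm (d k) \<le> X" and fix_d: "\<And>k. d k = hop n B b (hop n A a d) k"
  shows "d k = 0"
proof -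
  have half: "\<forall>k. norm (d k) \<le> X / 2 ^ m" for m
  proof (induction m)
    case (Suc m)
    show ?case
    proof
      fix k
      have X: "0 \<le> X / 2 ^ m" using Suc norm_ge_zero order_trans by blast
      have "norm (d k) \<le> 8 * R\<^sup>2 * (X / 2 ^ m) / wgt n"
        by (subst fix_d) (rule norm_hop_hop_le_sup[OF assms(1-4)], use Suc in auto)
      also have "\<dots> \<le> (wgt n / 2) * (X / 2 ^ m) / wgt n"
        using n hconst_ge[of R P] X by (intro divide_right_mono mult_right_mono) auto
      finally show "norm (d k) \<le> X / 2 ^ Suc m" by simp
    qed
  qed (use d in auto)
  have "(\<lambda>m. X / 2 ^ m) \<longlonglongrightarrow> 0"
    by real_asymp
  then have "norm (d k) \<le> 0"
    using half by (intro LIMSEQ_le_const) auto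
  then show ?thesis by simp
qed

lemma tendsto_wl2_le:
  assumes "\<And>k. (\<lambda>i::nat. x i k) \<longlonglongrightarrow> y k" "\<And>i. wl2_le M C (x i)"
  shows "wl2_le M C y"
proof (rule wl2_leI)
  fix F :: "int set" assume "finite F"
  have "(\<lambda>i. L2_set (\<lambda>k. wgt k ^ M * norm (x i k)) F) \<longlonglongrightarrow> L2_set (\<lambda>k. wgt k ^ M * norm (y k)) F"
    unfolding L2_set_def by (intro tendsto_intros assms)
  then show "L2_set (\<lambda>k. wgt k ^ M * norm (y k)) F \<le> C"
    by (rule LIMSEQ_le_const2) (use wl2_leD[OF assms(2) \<open>finite F\<close>] in blast)
qed

lemma wl2_delta0: "wl2_le M 1 delta0"
proof (rule wl2_leI)
  fix F :: "int set" assume F: "finite F"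
  have "L2_set (\<lambda>k. wgt k ^ M * norm (delta0 k)) F \<le> (\<Sum>k\<in>F. wgt k ^ M * norm (delta0 k))"
    by (rule L2_set_le_sum) auto
  also have "\<dots> \<le> (\<Sum>k\<in>insert 0 F. wgt k ^ M * norm (delta0 k))"
    using F by (intro sum_mono2) auto
  also have "\<dots> = (\<Sum>k\<in>{0}. wgt k ^ M * norm (delta0 k))"
    using F by (intro sum.mono_neutral_right) auto
  finally show "L2_set (\<lambda>k. wgt k ^ M * norm (delta0 k)) F \<le> 1" by simp
qed

text \<open>
  Banach's fixed point theorem with two notions of distance: the map contracts in the supremum norm,
  but its domain \<open>S\<close> only has to be closed under pointwise limits. A ball of the weighted \<open>l\<^sup>2\<close> space has
  this property, so the fixed point inherits a weighted \<open>l\<^sup>2\<close> bound from a contraction estimate in the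
  supremum norm.
\<close>
lemma sup_contraction_fixed_point:
  fixes T :: "('a \<Rightarrow> complex) \<Rightarrow> 'a \<Rightarrow> complex"
  assumes x0: "x0 \<in> S" and T: "\<And>x. x \<in> S \<Longrightarrow> T x \<in> S" and bnd: "\<And>x k. x \<in> S \<Longrightarrow> norm (x k) \<le> C"
    and clos: "\<And>x y. (\<And>i::nat. x i \<in> S) \<Longrightarrow> (\<And>k. (\<lambda>i. x i k) \<longlonglongrightarrow> y k) \<Longrightarrow> y \<in> S"
    and contr: "\<And>x y D k. x \<in> S \<Longrightarrow> y \<in> S \<Longrightarrow> (\<And>k. norm (x k - y k) \<le> D) \<Longrightarrow> norm (T x k - T y k) \<le> D / 2"
  obtains x where "x \<in> S" "T x = x"
proof -
  define x where "x m = (T ^^ m) x0" for m :: nat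
  have xS: "x m \<in> S" for m
    unfolding x_def by (induction m) (auto simp: x0 T)
  have step: "\<forall>k. norm (x (Suc m) k - x m k) \<le> 2 * C / 2 ^ m" for m
  proof (induction m)
    case 0
    have "norm (x 1 k - x 0 k) \<le> C + C" for k
      by (rule order_trans[OF norm_triangle_ineq4 add_mono]) (auto intro: bnd xS)
    then show ?case by simp
  next
    case (Suc m)
    then have "norm (T (x (Suc m)) k - T (x m) k) \<le> 2 * C / 2 ^ m / 2" for k
      by (intro contr xS) auto
    then show ?case by (simp add: x_def)
  qed
  have far: "norm (x (m + j) k - x m k) \<le> 4 * C / 2 ^ m - 4 * C / 2 ^ (m + j)" for m j k
  proof (induction j)
    case (Suc j)
    have "norm (x (m + Suc j) k - x m k) \<le> norm (x (Suc (m + j)) k - x (m + j) k) + norm (x (m + j) k - x m k)"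
      using norm_triangle_ineq[of "x (Suc (m + j)) k - x (m + j) k" "x (m + j) k - x m k"] by simp
    also have "\<dots> \<le> 2 * C / 2 ^ (m + j) + (4 * C / 2 ^ m - 4 * C / 2 ^ (m + j))"
      using step Suc by (intro add_mono) auto
    finally show ?case by simp
  qed simp
  have C: "0 \<le> C" using bnd[OF x0] norm_ge_zero order_trans by blast
  have far': "norm (x (m + j) k - x m k) \<le> 4 * C / 2 ^ m" for m j k
  proof -
    have "0 \<le> 4 * C / 2 ^ (m + j)" using C by simp
    then show ?thesis using far[where m = m and j = j and k = k] by linarith
  qed
  have z: "(\<lambda>m. 4 * C / 2 ^ m) \<longlonglongrightarrow> 0" for C :: real
    by real_asymp
  have "Cauchy (\<lambda>m. x m k)" for k
  proof (rule CauchyI')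
    fix e :: real assume "0 < e"
    then obtain M where M: "4 * C / 2 ^ M < e / 2"
      using order_tendstoD(2)[OF z[of C], of "e / 2"] by (auto simp: eventually_sequentially)
    have "dist (x m k) (x l k) < e" if ml: "M \<le> m" "m < l" for m l
    proof -
      have "dist (x m k) (x M k) \<le> 4 * C / 2 ^ M" "dist (x l k) (x M k) \<le> 4 * C / 2 ^ M"
        using far'[where m = M and j = "m - M" and k = k] far'[where m = M and j = "l - M" and k = k] ml by (auto simp: dist_norm)
      then show ?thesis using dist_triangle2[of "x m k" "x l k" "x M k"] M by linarith
    qed
    then show "\<exists>M. \<forall>m\<ge>M. \<forall>n>m. dist (x m k) (x n k) < e" by blast
  qed
  then have "\<exists>l. (\<lambda>m. x m k) \<longlonglongrightarrow> l" for k
    by (metis Cauchy_convergent_iff convergent_def)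
  then obtain y where y: "\<And>k. (\<lambda>m. x m k) \<longlonglongrightarrow> y k" by metis
  have yS: "y \<in> S" by (rule clos[of x, OF xS y])
  have near: "norm (y k - x m k) \<le> 4 * C / 2 ^ m" for k m
  proof (rule LIMSEQ_le_const2)
    show "(\<lambda>j. norm (x j k - x m k)) \<longlonglongrightarrow> norm (y k - x m k)"
      by (intro tendsto_intros y)
    have "norm (x j k - x m k) \<le> 4 * C / 2 ^ m" if "m \<le> j" for j
      using far'[where m = m and j = "j - m" and k = k] that by simp
    then show "\<exists>N. \<forall>j\<ge>N. norm (x j k - x m k) \<le> 4 * C / 2 ^ m" by blast
  qed
  have "T y k = y k" for k
  proof -
    have "(\<lambda>m. T (x m) k - T y k) \<longlonglongrightarrow> 0"
    proof (rule Lim_null_comparison)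
      show "\<forall>\<^sub>F m in sequentially. norm (T (x m) k - T y k) \<le> 4 * C / 2 ^ m / 2"
        using near by (intro always_eventually allI contr xS yS) (simp add: norm_minus_commute)
      show "(\<lambda>m. 4 * C / 2 ^ m / 2) \<longlonglongrightarrow> 0"
        by real_asymp
    qed
    then have "(\<lambda>m. T (x m) k) \<longlonglongrightarrow> T y k"
      by (simp add: LIM_zero_iff)
    moreover have "(\<lambda>m. T (x m) k) \<longlonglongrightarrow> y k"
      using LIMSEQ_Suc[OF y[of k]] by (simp add: x_def)
    ultimately show ?thesis by (rule LIMSEQ_unique)
  qed
  then show ?thesis using that[of y] yS by auto
qed

text \<open>
  The solution of the equations with \<open>k \<noteq> 0\<close> whose zero mode in the given component is 1; in this
  component only even numbers of steps contribute. It differs from \<open>delta0\<close> by at least two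
  steps, which accounts for the factor \<open>1 / wgt n\<close>.
\<close>
lemma even_solution_exists:
  assumes ab: "wl2_le (Suc P) R a" "wl2_le (Suc P) R b" "\<bar>Re A\<bar> \<le> pi" "\<bar>Re B\<bar> \<le> pi"
    and n: "2 * hconst P R \<le> wgt n"
  obtains E where "\<And>k. E k = delta0 k + hop n B b (hop n A a E) k" "wl2_le (Suc P) 2 E"
    "wl2_le (Suc P) (2 * hconst P R / wgt n) (\<lambda>k. E k - delta0 k)"
proof -
  define S where "S = {x :: int \<Rightarrow> complex. wl2_le (Suc P) 2 x}"
  define T where "T = (\<lambda>x k. delta0 k + hop n B b (hop n A a x) k)"
  have h2: "wl2_le (Suc P) (2 * hconst P R / wgt n) (hop n B b (hop n A a x))" if "wl2_le (Suc P) 2 x" for x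
    using wl2_hop_hop[OF ab that, of n] by (simp add: mult_ac)
  have le1: "2 * hconst P R / wgt n \<le> 1" using n by (simp add: divide_le_eq)
  obtain E where E: "E \<in> S" "T E = E"
  \<comment> \<open>The ball of radius 2 is invariant: \<open>delta0\<close> has norm 1, and two steps of the iteration
    have norm at most 1/2 by the choice of \<open>n\<close>.\<close>
  proof (rule sup_contraction_fixed_point[of delta0 S T 2])
    show "delta0 \<in> S"
      unfolding S_def using wl2_le_mono[OF wl2_delta0[of "Suc P"], of delta0 2] by simp
    show "T x \<in> S" if "x \<in> S" for x
      unfolding S_def T_def mem_Collect_eq
      by (rule wl2_le_mono[OF wl2_le_add[OF wl2_delta0 h2]]) (use le1 that in \<open>auto simp: S_def\<close>)
    show "norm (x k) \<le> 2" if "x \<in> S" for x k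
      using that wl2_le_bounded unfolding S_def by blast
    show "y \<in> S" if "\<And>i. x i \<in> S" "\<And>k. (\<lambda>i. x i k) \<longlonglongrightarrow> y k" for x :: "nat \<Rightarrow> int \<Rightarrow> complex" and y
      using that unfolding S_def by (auto intro: tendsto_wl2_le)
  next
    fix x y D k assume xy: "x \<in> S" "y \<in> S" and D: "\<And>k. norm (x k - y k) \<le> D"
    have D0: "0 \<le> D" using D norm_ge_zero order_trans by blast
    have bx: "norm (x j) \<le> 2" and by': "norm (- 1 * y j) \<le> 2" for j
      using xy by (auto simp: S_def intro: wl2_le_bounded)
    note a1 = wl2_le_imp_l1_le_0[OF ab(1)] and b1 = wl2_le_imp_l1_le_0[OF ab(2)]
    have *: "hop n A a (\<lambda>j. x j + - 1 * y j) = (\<lambda>j. hop n A a x j + - 1 * hop n A a y j)"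
      using hop_add[OF a1 bx by'] by (simp only: hop_cmult fun_eq_iff) simp
    have bhx: "norm (hop n A a x j) \<le> 2 * (2 * R)" for j
      by (rule hop_bounded(2)[OF ab(3) a1 bx])
    have bhy: "norm (- 1 * hop n A a y j) \<le> 2 * (2 * R)" for j
      using hop_bounded(2)[OF ab(3) a1, of y 2 n j] by' by simp
    have "T x k - T y k = hop n B b (hop n A a (\<lambda>j. x j + - 1 * y j)) k"
      unfolding T_def * hop_add[OF b1 bhx bhy] hop_cmult by simp
    also have "norm \<dots> \<le> 8 * R\<^sup>2 * D / wgt n"
      by (rule norm_hop_hop_le_sup[OF ab]) (use D in simp)
    also have "\<dots> \<le> (wgt n / 2) * D / wgt n"
      using n hconst_ge[of R P] D0 by (intro divide_right_mono mult_right_mono) auto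
    finally show "norm (T x k - T y k) \<le> D / 2" by simp
  qed
  show ?thesis
  proof (rule that[of E])
    show eq: "E k = delta0 k + hop n B b (hop n A a E) k" for k
      using fun_cong[OF E(2), of k] by (simp add: T_def)
    show "wl2_le (Suc P) 2 E"
      using E by (simp add: S_def)
    have "(\<lambda>k. E k - delta0 k) = hop n B b (hop n A a E)"
    proof
      fix k
      show "E k - delta0 k = hop n B b (hop n A a E) k"
        using eq[of k] by (metis add_diff_cancel_left')
    qed
    then show "wl2_le (Suc P) (2 * hconst P R / wgt n) (\<lambda>k. E k - delta0 k)"
      using h2[of E] E by (simp add: S_def)
  qed
qed

lemma infsum_diff_banach:
  fixes f g :: "'a \<Rightarrow> 'b::banach"
  assumes "f summable_on A" "g summable_on A"
  shows "(\<lambda>x. f x - g x) summable_on A" "infsum (\<lambda>x. f x - g x) A = infsum f A - infsum g A"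
proof -
  have "((\<lambda>x. f x + - g x) has_sum (infsum f A + - infsum g A)) A"
    by (intro has_sum_add has_sum_uminus[THEN iffD2]) (simp_all add: assms)
  then show "(\<lambda>x. f x - g x) summable_on A" "infsum (\<lambda>x. f x - g x) A = infsum f A - infsum g A"
    by (simp_all add: has_sum_imp_summable infsumI)
qed

text \<open>
  The matrix with entries \<open>a (n - k - j)\<close> is symmetric in \<open>k\<close> and \<open>j\<close>.
\<close>
lemma hankel_symmetric:
  fixes a x y :: "int \<Rightarrow> complex"
  assumes a: "\<And>j. norm (a j) \<le> R" and x: "l1_le X x" and y: "l1_le Y y"
  shows "(\<lambda>k. x k * conv a y (n - k)) summable_on UNIV"
    and "(\<Sum>\<^sub>\<infinity>k. x k * conv a y (n - k)) = (\<Sum>\<^sub>\<infinity>k. y k * conv a x (n - k))"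
proof -
  have "(\<lambda>k. norm (x k * conv a y (n - k))) summable_on UNIV" if x: "l1_le X x" and y: "l1_le Y y" for x y X Y
  proof (rule l1_le_summable)
    have "norm (conv a y m) \<le> R * Y" for m
      by (subst conv_commute) (rule norm_conv_le(2)[OF y a])
    with l1_le_conv_terms'[where k = 0 and x = "\<lambda>j. x (- j)" and y = "\<lambda>j. conv a y (n - j)" and X = "R * Y" and C = X]
      l1_le_reindex[OF x inj_uminus_int]
    show "l1_le (R * Y * X) (\<lambda>k. x k * conv a y (n - k))"
      by simp
  qed
  from this[OF x y] show "(\<lambda>k. x k * conv a y (n - k)) summable_on UNIV"
    by (rule abs_summable_summable)
  have "(\<lambda>p. norm (x (fst p) * y (snd p))) summable_on UNIV \<times> UNIV"
  proof (subst Infinite_Sum.abs_summable_on_Sigma_iff, intro conjI ballI)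
    show "(\<lambda>j. norm (x (fst (k, j)) * y (snd (k, j)))) summable_on UNIV" for k
      unfolding fst_conv snd_conv norm_mult by (rule summable_on_cmult_right[OF l1_le_summable(1)[OF y]])
    have "(\<lambda>k. norm (x k) * (\<Sum>\<^sub>\<infinity>j. norm (y j))) summable_on UNIV"
      by (rule summable_on_cmult_left[OF l1_le_summable(1)[OF x]])
    moreover have "norm (\<Sum>\<^sub>\<infinity>j. norm (x k * y j)) = norm (x k) * (\<Sum>\<^sub>\<infinity>j. norm (y j))" for k
      by (simp add: norm_mult infsum_cmult_right' abs_mult infsum_nonneg)
    ultimately show "(\<lambda>k. norm (\<Sum>\<^sub>\<infinity>j. norm (x (fst (k, j)) * y (snd (k, j))))) summable_on UNIV"
      by simp
  qed
  then have dom: "(\<lambda>p. R * norm (x (fst p) * y (snd p))) summable_on UNIV \<times> UNIV"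
    by (rule summable_on_cmult_right)
  have s: "(\<lambda>(k, j). x k * (a (n - k - j) * y j)) summable_on UNIV \<times> UNIV"
  proof (rule abs_summable_summable, rule Infinite_Sum.abs_summable_on_comparison_test'[OF dom])
    fix p :: "int \<times> int"
    obtain k j where p: "p = (k, j)" by force
    show "norm (case p of (k, j) \<Rightarrow> x k * (a (n - k - j) * y j)) \<le> R * norm (x (fst p) * y (snd p))"
      using mult_right_mono[OF a[of "n - k - j"], of "norm (x k * y j)"] by (simp add: p norm_mult mult_ac)
  qed
  have "(\<Sum>\<^sub>\<infinity>k. x k * conv a y (n - k)) = (\<Sum>\<^sub>\<infinity>k. \<Sum>\<^sub>\<infinity>j. x k * (a (n - k - j) * y j))"
    unfolding conv_def by (simp add: infsum_cmult_right')
  also have "\<dots> = (\<Sum>\<^sub>\<infinity>j. \<Sum>\<^sub>\<infinity>k. x k * (a (n - k - j) * y j))"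
    by (rule infsum_swap_banach[OF s])
  also have "\<dots> = (\<Sum>\<^sub>\<infinity>k. y k * conv a x (n - k))"
    unfolding conv_def infsum_cmult_right'[symmetric]
    by (intro infsum_cong) (simp add: algebra_simps)
  finally show "(\<Sum>\<^sub>\<infinity>k. x k * conv a y (n - k)) = (\<Sum>\<^sub>\<infinity>k. y k * conv a x (n - k))" .
qed

text \<open>
  The difference of the two diagonal terms in the equations for the zero modes is \<open>- (A - B)\<close> times a
  quantity that is quadratic in the small sequences \<open>E - delta0\<close>, \<open>E' - delta0\<close>, \<open>O1\<close> and \<open>O1'\<close>. To see this, use the
  symmetry of \<open>a (n - k - j)\<close> for the pair \<open>E\<close>, \<open>O1'\<close> and that of \<open>b (n - k - j)\<close> for the pair \<open>E'\<close>,
  \<open>O1\<close>. For \<open>k \<noteq> 0\<close> the convolutions are \<open>A + 2\<pi>k\<close> and \<open>B + 2\<pi>k\<close> times the same products; on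
  subtracting the two identities the parts \<open>2\<pi>k\<close> cancel. The terms with \<open>k = 0\<close> are the diagonal
  terms.
\<close>
lemma diagonal_difference:
  assumes a: "\<And>j. norm (a j) \<le> R" and b: "\<And>j. norm (b j) \<le> R"
    and l1: "l1_le C E" "l1_le C E'" "l1_le C O1" "l1_le C O1'"
    and AB: "\<bar>Re A\<bar> \<le> pi" "\<bar>Re B\<bar> \<le> pi"
    and E: "\<And>k. E k = delta0 k + hop n B b O1 k" and O1: "\<And>k. O1 k = hop n A a E k"
    and E': "\<And>k. E' k = delta0 k + hop n A a O1' k" and O1': "\<And>k. O1' k = hop n B b E' k"
  shows "conv a O1' n - conv b O1 n + (A - B) * (\<Sum>\<^sub>\<infinity>k. if k = 0 then 0 else E k * E' k - O1 k * O1' k) = 0"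
proof -
  let ?g = "\<lambda>k. E k * conv a O1' (n - k) - O1' k * conv a E (n - k)"
  let ?h = "\<lambda>k. E' k * conv b O1 (n - k) - O1 k * conv b E' (n - k)"
  let ?r = "\<lambda>k. if k = 0 then 0 else E k * E' k - O1 k * O1' k"
  have g: "?g summable_on UNIV" "infsum ?g UNIV = 0"
    using hankel_symmetric[where n = n, OF a l1(1,4)] hankel_symmetric(1)[where n = n, OF a l1(4,1)]
    by (auto simp: infsum_diff_banach)
  have h: "?h summable_on UNIV" "infsum ?h UNIV = 0"
    using hankel_symmetric[where n = n, OF b l1(2,3)] hankel_symmetric(1)[where n = n, OF b l1(3,2)]
    by (auto simp: infsum_diff_banach)
  have nz: "A + 2 * of_real pi * of_int k \<noteq> 0" "B + 2 * of_real pi * of_int k \<noteq> 0" if "k \<noteq> 0" for k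
    using wgt_le_symbol[OF AB(1) that] wgt_le_symbol[OF AB(2) that] wgt_pos[of k] by force+
  have gh: "?g k - ?h k = (conv a O1' n - conv b O1 n) * delta0 k + (A - B) * ?r k" for k
  proof (cases "k = 0")
    case True
    then show ?thesis using E[of 0] E'[of 0] O1[of 0] O1'[of 0] by simp
  next
    case False
    have "conv a O1' (n - k) = (A + 2 * of_real pi * of_int k) * E' k"
      "conv a E (n - k) = (A + 2 * of_real pi * of_int k) * O1 k"
      "conv b O1 (n - k) = (B + 2 * of_real pi * of_int k) * E k"
      "conv b E' (n - k) = (B + 2 * of_real pi * of_int k) * O1' k"
      using False nz[OF False] by (simp_all add: E[of k] E'[of k] O1[of k] O1'[of k] hop_def)
    with False show ?thesis by (simp add: algebra_simps)
  qed
  have s: "(\<lambda>k. x k * y k) summable_on UNIV - {0}" if x: "l1_le C x" and y: "l1_le C y" for x y :: "int \<Rightarrow> complex"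
    using l1_le_summable(2)[OF l1_le_conv_terms'[where k = 0 and x = "\<lambda>j. x (- j)" and y = y and C = C and X = C]]
      l1_le_reindex[OF x inj_uminus_int] l1_le_bounded[OF y] by simp
  have "?r summable_on UNIV"
  proof -
    have "(\<lambda>k. E k * E' k) summable_on UNIV - {0}" "(\<lambda>k. O1 k * O1' k) summable_on UNIV - {0}"
      by (intro s l1)+
    then have "(\<lambda>k. E k * E' k - O1 k * O1' k) summable_on UNIV - {0}"
      by (rule infsum_diff_banach)
    then show ?thesis
      by (rule summable_on_cong_neutral[THEN iffD1, rotated -1]) auto
  qed
  then have r: "(\<lambda>k. (A - B) * ?r k) summable_on UNIV"
    by (rule summable_on_cmult_right)
  have d: "((\<lambda>k. (conv a O1' n - conv b O1 n) * delta0 k) has_sum (conv a O1' n - conv b O1 n)) UNIV"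
    by (rule has_sum_finite_neutralI[of "{0}"]) auto
  have "0 = infsum (\<lambda>k. ?g k - ?h k) UNIV"
    using g h by (simp add: infsum_diff_banach)
  also have "\<dots> = (\<Sum>\<^sub>\<infinity>k. (conv a O1' n - conv b O1 n) * delta0 k + (A - B) * ?r k)"
    by (simp only: gh)
  also have "\<dots> = (conv a O1' n - conv b O1 n) + (\<Sum>\<^sub>\<infinity>k. (A - B) * ?r k)"
    using infsum_add[OF has_sum_imp_summable[OF d] r] infsumI[OF d] by simp
  finally show ?thesis by (simp add: infsum_cmult_right')
qed

section \<open>Decomposition into even and odd parts\<close>

text \<open>
  Majorant for \<open>wgt n\<close> times the first correction to the coefficient \<open>a n\<close>, taken at \<open>k = n\<close>.
\<close>
definition zmaj :: "(int \<Rightarrow> complex) \<Rightarrow> (int \<Rightarrow> complex) \<Rightarrow> int \<Rightarrow> real" where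
  "zmaj a b k = conv (\<lambda>j. norm (a j)) (zop b (\<lambda>j. norm (a j))) k"

lemma zmaj_nonneg: "0 \<le> zmaj a b k"
  unfolding zmaj_def by (intro conv_nonneg zop_nonneg) auto

lemma wl2_zmaj:
  assumes "wl2_le (Suc P) R a" "wl2_le (Suc P) R b"
  shows "wl2_le (Suc P) (8 * 2 ^ P * R * (8 * 2 ^ P * R * R)) (zmaj a b)"
  unfolding zmaj_def
  by (rule wl2_conv[OF _ wl2_zop]) (use assms in auto)

text \<open>
  The even solution \<open>E\<close> together with its image \<open>O1\<close> in the other component. In the last estimate the
  first two-step correction to \<open>E = delta0\<close> produces \<open>zmaj\<close>, a square summable quantity; all further
  corrections contain one more factor \<open>1 / wgt n\<close>, so that a pointwise bound for them suffices.
\<close>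
lemma even_odd_solution:
  assumes ab: "wl2_le (Suc P) R a" "wl2_le (Suc P) R b" "\<bar>Re A\<bar> \<le> pi" "\<bar>Re B\<bar> \<le> pi"
    and n: "2 * hconst P R \<le> wgt n"
  obtains E O1 where "\<And>k. E k = delta0 k + hop n B b O1 k" "\<And>k. O1 k = hop n A a E k"
    "l1_le ((4 * hconst P R + 64 * 2 ^ P * R) / wgt n) (\<lambda>k. E k - delta0 k)"
    "l1_le ((4 * hconst P R + 64 * 2 ^ P * R) / wgt n) O1"
    "wgt n * norm (conv a E n - a n) \<le> zmaj a b n + (8 * 2 ^ P * R) ^ 3 * (2 * hconst P R) / wgt n ^ (Suc (Suc P))"
proof -
  have R: "0 \<le> R" using ab wl2_le_nonneg by blast
  have h0: "0 \<le> hconst P R" by (simp add: hconst_def)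
  obtain E where E: "\<And>k. E k = delta0 k + hop n B b (hop n A a E) k" and E2: "wl2_le (Suc P) 2 E"
    and Ed: "wl2_le (Suc P) (2 * hconst P R / wgt n) (\<lambda>k. E k - delta0 k)"
    using even_solution_exists[OF ab n] by blast
  define O1 where "O1 = hop n A a E"
  let ?d = "\<lambda>k. E k - delta0 k"
  let ?a = "\<lambda>j. norm (a j)"
  note a1 = wl2_le_imp_l1_le_0[OF ab(1)] and b1 = wl2_le_imp_l1_le_0[OF ab(2)]
  show ?thesis
  proof (rule that)
    show "E k = delta0 k + hop n B b O1 k" for k using E unfolding O1_def .
    show "O1 k = hop n A a E k" for k by (simp add: O1_def)
    show "l1_le ((4 * hconst P R + 64 * 2 ^ P * R) / wgt n) ?d"
      by (rule l1_le_mono[OF wl2_le_imp_l1_le_0[OF Ed]]) (use R in \<open>auto simp: divide_right_mono\<close>)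
    show "l1_le ((4 * hconst P R + 64 * 2 ^ P * R) / wgt n) O1"
    proof (rule l1_leI)
      fix F :: "int set" assume F: "finite F"
      have c: "wl2_le (Suc P) (8 * 2 ^ P * R * 2) (conv a E)"
        by (rule wl2_conv) (use ab E2 in auto)
      have "(\<Sum>k\<in>F. norm (O1 k)) \<le> (\<Sum>k\<in>F. norm (conv a E (n - k)) / wgt k)"
        unfolding O1_def by (intro sum_mono norm_hop_le ab)
      also have "\<dots> \<le> 4 * (8 * 2 ^ P * R * 2) / wgt n"
        by (rule wl2_le_sum_div_wgt_gain[OF c F])
      also have "\<dots> \<le> (4 * hconst P R + 64 * 2 ^ P * R) / wgt n"
        using h0 by (intro divide_right_mono) auto
      finally show "(\<Sum>k\<in>F. norm (O1 k)) \<le> (4 * hconst P R + 64 * 2 ^ P * R) / wgt n" .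
    qed
    let ?c1 = "conv ?a (\<lambda>j. norm (?d j))"
    let ?X1 = "8 * 2 ^ P * R * (2 * hconst P R / wgt n)"
    have c1: "wl2_le (Suc P) ?X1 ?c1"
      by (rule wl2_conv) (use ab Ed in auto)
    have c1_0: "0 \<le> ?c1 j" for j by (rule conv_nonneg) auto
    have cd: "conv ?a (\<lambda>j. norm (delta0 j)) = ?a"
    proof
      fix k
      have "conv ?a (\<lambda>j. norm (delta0 j)) k = (\<Sum>\<^sub>\<infinity>j\<in>{0}. ?a (k - j) * norm (delta0 j))"
        unfolding conv_def by (rule infsum_cong_neutral) auto
      then show "conv ?a (\<lambda>j. norm (delta0 j)) k = ?a k" by simp
    qed
    let ?z0 = "zop b ?a" and ?z1 = "zop b ?c1"
    have z: "wl2_le (Suc P) (8 * 2 ^ P * R * R) ?z0" "wl2_le (Suc P) (8 * 2 ^ P * ?X1 * R) ?z1"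
      by (rule wl2_zop; use ab c1 in simp)+
    have z_0: "0 \<le> ?z0 j" "0 \<le> ?z1 j" for j by (rule zop_nonneg; use c1_0 in simp)+
    have dz: "wgt n * norm (?d k) \<le> ?z0 k + ?z1 k" for k
    proof -
      have ed: "E = (\<lambda>j. delta0 j + ?d j)" by auto
      have bd: "norm (?d j) \<le> 2 * hconst P R / wgt n" for j by (rule wl2_le_bounded[OF Ed])
      have e1: "hop n A a E = (\<lambda>j. hop n A a delta0 j + hop n A a ?d j)"
        by (subst ed) (rule ext, rule hop_add[OF a1 norm_delta0_le bd])
      have "?d k = hop n B b (hop n A a E) k" using E[of k] by simp
      also have "\<dots> = hop n B b (hop n A a delta0) k + hop n B b (hop n A a ?d) k"
        unfolding e1 by (rule hop_add[OF b1 hop_bounded(2)[OF ab(3) a1 norm_delta0_le] hop_bounded(2)[OF ab(3) a1 bd]])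
      finally have "wgt n * norm (?d k) \<le> wgt n * norm (hop n B b (hop n A a delta0) k) + wgt n * norm (hop n B b (hop n A a ?d) k)"
        using norm_triangle_ineq by (metis distrib_left mult_left_mono wgt_nonneg)
      also have "\<dots> \<le> zop b (conv ?a (\<lambda>j. norm (delta0 j))) k + ?z1 k"
        by (rule add_mono[OF norm_hop_hop_le[OF ab wl2_delta0] norm_hop_hop_le[OF ab Ed]])
      finally show ?thesis by (simp add: cd)
    qed
    have "conv a E n - a n = conv a ?d n"
    proof -
      have "conv a E n = conv a (\<lambda>j. delta0 j + ?d j) n" by simp
      also have "\<dots> = conv a delta0 n + conv a ?d n"
        by (rule conv_add_right[OF a1 norm_delta0_le wl2_le_bounded[OF Ed]])
      finally show ?thesis by simp
    qed
    then have "wgt n * norm (conv a E n - a n) \<le> wgt n * conv ?a (\<lambda>j. norm (?d j)) n"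
      using norm_conv_le(1)[OF a1 wl2_le_bounded[OF Ed]] by (intro mult_left_mono) auto
    also have "\<dots> = conv ?a (\<lambda>j. wgt n * norm (?d j)) n"
      by (simp add: conv_cmult_right)
    also have "\<dots> \<le> conv ?a (\<lambda>j. ?z0 j + ?z1 j) n"
    proof (rule conv_mono_right)
      show "l1_le (2 * R) ?a" using a1 by simp
      show "?z0 j + ?z1 j \<le> (8 * 2 ^ P * R * R) + (8 * 2 ^ P * ?X1 * R)" for j
        using wl2_le_bounded[OF z(1), of j] wl2_le_bounded[OF z(2), of j] by simp
    qed (use dz in auto)
    also have "\<dots> = zmaj a b n + conv ?a ?z1 n"
      unfolding zmaj_def
      by (rule conv_add_right[OF _ wl2_le_bounded[OF z(1)] wl2_le_bounded[OF z(2)]]) (use a1 in simp)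
    also have "conv ?a ?z1 n \<le> (8 * 2 ^ P * R) ^ 3 * (2 * hconst P R) / wgt n ^ (Suc (Suc P))"
    proof -
      have "wl2_le (Suc P) (8 * 2 ^ P * R * (8 * 2 ^ P * ?X1 * R)) (conv ?a ?z1)"
        by (rule wl2_conv[OF _ z(2)]) (use ab in auto)
      have "wgt n ^ Suc P * conv ?a ?z1 n \<le> wgt n ^ Suc P * norm (conv ?a ?z1 n)"
        by (intro mult_left_mono) auto
      also have "\<dots> \<le> 8 * 2 ^ P * R * (8 * 2 ^ P * ?X1 * R)"
        by (rule wl2_le_pointwise) fact
      also have "\<dots> = (8 * 2 ^ P * R) ^ 3 * (2 * hconst P R) / wgt n"
        by (simp add: power3_eq_cube)
      finally show ?thesis by (simp add: field_simps)
    qed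
    finally show "wgt n * norm (conv a E n - a n) \<le> zmaj a b n + (8 * 2 ^ P * R) ^ 3 * (2 * hconst P R) / wgt n ^ (Suc (Suc P))"
      by simp
  qed
qed

text \<open>
  The equations for the Fourier coefficients of the two periodic factors of a Floquet solution, where
  \<open>w\<close> is indexed in reverse. With this convention both right-hand sides are given by the Hankel
  matrices \<open>a (n - k - j)\<close> and \<open>b (n - k - j)\<close>.
\<close>
definition hankel_system :: "int \<Rightarrow> complex \<Rightarrow> complex \<Rightarrow> (int \<Rightarrow> complex) \<Rightarrow> (int \<Rightarrow> complex)
    \<Rightarrow> (int \<Rightarrow> complex) \<Rightarrow> (int \<Rightarrow> complex) \<Rightarrow> bool" where
  "hankel_system n A B a b u w \<longleftrightarrow>
     (\<forall>k. (A + 2 * of_real pi * of_int k) * u k = conv a w (n - k)) \<and>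
     (\<forall>k. (B + 2 * of_real pi * of_int k) * w k = conv b u (n - k))"

text \<open>
  A solution is determined by its two zero modes: the difference of the two sides solves the
  homogeneous fixed point equation.
\<close>
lemma hankel_system_decompose:
  assumes ab: "wl2_le (Suc P) R a" "wl2_le (Suc P) R b" "\<bar>Re A\<bar> \<le> pi" "\<bar>Re B\<bar> \<le> pi"
    and n: "2 * hconst P R \<le> wgt n"
    and sys: "hankel_system n A B a b u w" and bu: "\<And>k. norm (u k) \<le> U" and bw: "\<And>k. norm (w k) \<le> U"
    and E: "\<And>k. E k = delta0 k + hop n B b O1 k" "\<And>k. O1 k = hop n A a E k" "l1_le C E" "l1_le C O1"
    and E': "\<And>k. E' k = delta0 k + hop n A a O1' k" "\<And>k. O1' k = hop n B b E' k" "l1_le C E'" "l1_le C O1'"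
  shows "u k = u 0 * E' k + w 0 * O1 k" "w k = w 0 * E k + u 0 * O1' k"
proof -
  note a1 = wl2_le_imp_l1_le_0[OF ab(1)] and b1 = wl2_le_imp_l1_le_0[OF ab(2)]
  have nz: "A + 2 * of_real pi * of_int k \<noteq> 0" "B + 2 * of_real pi * of_int k \<noteq> 0" if "k \<noteq> 0" for k
    using wgt_le_symbol[OF ab(3) that] wgt_le_symbol[OF ab(4) that] wgt_pos[of k] by force+
  have C: "0 \<le> C" using E(3) l1_le_nonneg by blast
  define D where "D = U + (U * C + U * C)"
  have U: "0 \<le> U" using bu[of 0] norm_ge_zero order_trans by blast
  have u: "u k = u 0 * delta0 k + hop n A a w k" for k
    using sys nz[of k] by (cases "k = 0") (auto simp: hankel_system_def hop_def field_simps)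
  have w: "w k = w 0 * delta0 k + hop n B b u k" for k
    using sys nz[of k] by (cases "k = 0") (auto simp: hankel_system_def hop_def field_simps)
  define d where "d k = u k + ((- u 0) * E' k + (- w 0) * O1 k)" for k
  define e where "e k = w k + ((- u 0) * O1' k + (- w 0) * E k)" for k
  have bE: "norm (- c * E k) \<le> U * C" "norm (- c * E' k) \<le> U * C" "norm (- c * O1 k) \<le> U * C" "norm (- c * O1' k) \<le> U * C"
    if "norm c \<le> U" for c k
    using that U l1_le_bounded[OF E(3)] l1_le_bounded[OF E(4)] l1_le_bounded[OF E'(3)] l1_le_bounded[OF E'(4)]
    by (auto simp: norm_mult intro!: mult_mono)
  have bs: "norm ((- u 0) * O1' j + (- w 0) * E j) \<le> U * C + U * C"
      "norm ((- u 0) * E' j + (- w 0) * O1 j) \<le> U * C + U * C" for j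
    by (rule order_trans[OF norm_triangle_ineq] add_mono bE bu bw)+
  have de: "d k = hop n A a e k" for k
  proof -
    have "hop n A a e k = hop n A a w k + ((- u 0) * hop n A a O1' k + (- w 0) * hop n A a E k)"
      unfolding e_def
      by (subst hop_add[OF a1 bw bs(1)], subst hop_add[OF a1 bE(4)[OF bu] bE(1)[OF bw]]) (simp only: hop_cmult)
    then show ?thesis using u[of k] E(2)[of k] E'(1)[of k] by (simp add: d_def algebra_simps)
  qed
  have ed: "e k = hop n B b d k" for k
  proof -
    have "hop n B b d k = hop n B b u k + ((- u 0) * hop n B b E' k + (- w 0) * hop n B b O1 k)"
      unfolding d_def
      by (subst hop_add[OF b1 bu bs(2)], subst hop_add[OF b1 bE(2)[OF bu] bE(3)[OF bw]]) (simp only: hop_cmult)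
    then show ?thesis using w[of k] E(1)[of k] E'(2)[of k] by (simp add: e_def algebra_simps)
  qed
  have bd: "norm (d k) \<le> D" "norm (e k) \<le> D" for k
    unfolding d_def e_def D_def by (rule order_trans[OF norm_triangle_ineq] add_mono bs bu bw)+
  have "d = hop n A a e" "e = hop n B b d" using de ed by auto
  then have dd: "d k = hop n A a (hop n B b d) k" and ee: "e k = hop n B b (hop n A a e) k" for k by simp_all
  have "d k = 0" "e k = 0"
    by (rule fixed_point_unique[OF ab(2,1,4,3) n bd(1) dd], rule fixed_point_unique[OF ab n bd(2) ee])
  then show "u k = u 0 * E' k + w 0 * O1 k" "w k = w 0 * E k + u 0 * O1' k"
    by (auto simp: d_def e_def algebra_simps)
qed

section \<open>Asymptotics of the Hankel system\<close>

text \<open>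
  Bound for \<open>wgt n\<close> times the \<open>l\<^sup>1\<close> norms of \<open>E - delta0\<close> and \<open>O1\<close> in \<open>even_odd_solution\<close>.
\<close>
definition hbase :: "nat \<Rightarrow> real \<Rightarrow> real" where
  "hbase P R = 4 * hconst P R + 64 * 2 ^ P * R"

text \<open>
  A common bound for all quantities in \<open>hankel_system_asymptotics\<close>. Its value is
  generous; what matters is that it depends on \<open>P\<close> and \<open>R\<close> alone.
\<close>
definition hbound :: "nat \<Rightarrow> real \<Rightarrow> real" where
  "hbound P R = 100 * (1 + R) * (1 + hbase P R + (8 * 2 ^ P * R) ^ 3 * (2 * hconst P R))"

text \<open>
  The square summable part of the final error, before division by \<open>wgt n\<close>.
\<close>
definition gmaj :: "(int \<Rightarrow> complex) \<Rightarrow> (int \<Rightarrow> complex) \<Rightarrow> int \<Rightarrow> real" where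
  "gmaj a b k = norm (a k) + norm (b k) + zmaj a b k + zmaj b a k"

lemma gmaj_nonneg: "0 \<le> gmaj a b k"
  unfolding gmaj_def by (intro add_nonneg_nonneg zmaj_nonneg) auto

lemma wl2_gmaj:
  assumes "wl2_le (Suc P) R a" "wl2_le (Suc P) R b"
  shows "wl2_le (Suc P) (2 * R + 2 * (8 * 2 ^ P * R * (8 * 2 ^ P * R * R))) (gmaj a b)"
proof -
  let ?Z = "8 * 2 ^ P * R * (8 * 2 ^ P * R * R)"
  have "wl2_le (Suc P) (R + R + ?Z + ?Z) (\<lambda>k. norm (a k) + norm (b k) + zmaj a b k + zmaj b a k)"
    by (intro wl2_le_add wl2_zmaj assms) (use assms in auto)
  then show ?thesis by (simp add: gmaj_def[abs_def] algebra_simps)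
qed

lemma l1_le_delta0: "l1_le 1 delta0"
proof (rule l1_leI)
  fix F :: "int set" assume F: "finite F"
  have "(\<Sum>k\<in>F. norm (delta0 k)) \<le> (\<Sum>k\<in>insert 0 F. norm (delta0 k))"
    using F by (intro sum_mono2) auto
  also have "\<dots> = (\<Sum>k\<in>{0}. norm (delta0 k))"
    using F by (intro sum.mono_neutral_right) auto
  finally show "(\<Sum>k\<in>F. norm (delta0 k)) \<le> 1" by simp
qed

lemma hankel_system_l1:
  assumes ab: "wl2_le (Suc P) R a" "wl2_le (Suc P) R b" "\<bar>Re A\<bar> \<le> pi" "\<bar>Re B\<bar> \<le> pi"
    and n: "2 * hconst P R \<le> wgt n"
    and sys: "hankel_system n A B a b u w" and bu: "\<And>k. norm (u k) \<le> U" and bw: "\<And>k. norm (w k) \<le> U"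
  obtains E O1 E' O1' \<epsilon> where "\<epsilon> = hbase P R / wgt n"
    "\<And>k. E k = delta0 k + hop n B b O1 k" "\<And>k. O1 k = hop n A a E k"
    "\<And>k. E' k = delta0 k + hop n A a O1' k" "\<And>k. O1' k = hop n B b E' k"
    "l1_le \<epsilon> (\<lambda>k. E k - delta0 k)" "l1_le \<epsilon> O1" "l1_le \<epsilon> (\<lambda>k. E' k - delta0 k)" "l1_le \<epsilon> O1'"
    "\<And>k. u k = u 0 * E' k + w 0 * O1 k" "\<And>k. w k = w 0 * E k + u 0 * O1' k"
    "wgt n * norm (conv a E n - a n) \<le> zmaj a b n + (8 * 2 ^ P * R) ^ 3 * (2 * hconst P R) / wgt n ^ (Suc (Suc P))"
    "wgt n * norm (conv b E' n - b n) \<le> zmaj b a n + (8 * 2 ^ P * R) ^ 3 * (2 * hconst P R) / wgt n ^ (Suc (Suc P))"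
proof -
  define \<epsilon> where "\<epsilon> = hbase P R / wgt n"
  obtain E O1 where E: "\<And>k. E k = delta0 k + hop n B b O1 k" "\<And>k. O1 k = hop n A a E k"
    "l1_le \<epsilon> (\<lambda>k. E k - delta0 k)" "l1_le \<epsilon> O1"
    "wgt n * norm (conv a E n - a n) \<le> zmaj a b n + (8 * 2 ^ P * R) ^ 3 * (2 * hconst P R) / wgt n ^ (Suc (Suc P))"
    using even_odd_solution[OF ab n] unfolding hbase_def \<epsilon>_def by blast
  obtain E' O1' where E': "\<And>k. E' k = delta0 k + hop n A a O1' k" "\<And>k. O1' k = hop n B b E' k"
    "l1_le \<epsilon> (\<lambda>k. E' k - delta0 k)" "l1_le \<epsilon> O1'"
    "wgt n * norm (conv b E' n - b n) \<le> zmaj b a n + (8 * 2 ^ P * R) ^ 3 * (2 * hconst P R) / wgt n ^ (Suc (Suc P))"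
    using even_odd_solution[OF ab(2,1,4,3) n] unfolding hbase_def \<epsilon>_def by blast
  have lE: "l1_le (1 + \<epsilon>) E" "l1_le (1 + \<epsilon>) E'" "l1_le (1 + \<epsilon>) O1" "l1_le (1 + \<epsilon>) O1'"
    using l1_le_add[OF l1_le_delta0 E(3)] l1_le_add[OF l1_le_delta0 E'(3)] l1_le_mono[OF E(4), of O1 "1 + \<epsilon>"] l1_le_mono[OF E'(4), of O1' "1 + \<epsilon>"] by auto
  note dec = hankel_system_decompose[OF ab n sys bu bw E(1,2) lE(1,3) E'(1,2) lE(2,4)]
  show ?thesis
    by (rule that[OF \<epsilon>_def E(1,2) E'(1,2) E(3,4) E'(3,4) dec E(5) E'(5)])
qed

text \<open>
  Here \<open>s\<close> is close to 1 up to \<open>O(\<epsilon>)\<close>, so the right-hand side of the equation is \<open>a - b\<close> up to the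
  errors of \<open>\<beta>1\<close> and \<open>\<beta>2\<close> and up to \<open>O(\<epsilon>)\<close> times the sizes of \<open>a\<close> and \<open>b\<close> themselves.
\<close>
lemma split_difference_estimate:
  fixes A B a b s \<gamma> \<beta>1 \<beta>2 :: complex
  assumes s: "norm (s - 1) \<le> 5 * \<epsilon>" and e: "0 \<le> \<epsilon>" "\<epsilon> \<le> 1/100" and g: "norm \<gamma> \<le> 2 * \<epsilon>\<^sup>2"
    and eq: "(A - B) * (1 + \<gamma>) = s * \<beta>1 - \<beta>2 / s"
  shows "norm (A - B - (a - b)) \<le> 4 * (norm (\<beta>1 - a) + norm (\<beta>2 - b)) + 24 * \<epsilon> * (norm a + norm b)"
proof -
  have s1: "norm s \<le> 11/10" "19/20 \<le> norm s"
    using norm_triangle_ineq[of "s - 1" 1] norm_triangle_ineq2[of 1 "1 - s"] s e by (auto simp: norm_minus_commute)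
  then have s0: "s \<noteq> 0" by auto
  have si: "norm (1 / s) \<le> 11/10"
    using s1 by (simp add: norm_divide divide_le_eq)
  have "1 / s - 1 = (1 - s) * (1 / s)" using s0 by (simp add: field_simps)
  then have "norm (1 / s - 1) \<le> (5 * \<epsilon>) * (11/10)"
    using s si e by (simp only: norm_mult) (intro mult_mono, auto simp: norm_minus_commute)
  then have si1: "norm (1 / s - 1) \<le> 11/2 * \<epsilon>" by simp
  have g1: "norm \<gamma> \<le> \<epsilon> / 50"
    using g mult_right_mono[OF e(2) e(1)] by (simp add: power2_eq_square)
  let ?X = "A - B - (a - b)"
  define t where "t = 1 / s"
  have "(A - B) * (1 + \<gamma>) = s * \<beta>1 - t * \<beta>2"
    using eq by (simp add: t_def)
  then have "?X * (1 + \<gamma>) = s * (\<beta>1 - a) + (s - 1) * a - t * (\<beta>2 - b) - (t - 1) * b - \<gamma> * (a - b)"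
    by (simp add: algebra_simps)
  then have "?X * (1 + \<gamma>) = s * (\<beta>1 - a) + (s - 1) * a - (1 / s) * (\<beta>2 - b) - (1 / s - 1) * b - \<gamma> * (a - b)"
    unfolding t_def .
  also have "norm \<dots> \<le> norm s * norm (\<beta>1 - a) + norm (s - 1) * norm a + norm (1 / s) * norm (\<beta>2 - b)
      + norm (1 / s - 1) * norm b + norm \<gamma> * norm (a - b)"
    unfolding norm_mult[symmetric]
    by (intro order_trans[OF norm_triangle_ineq4] order_trans[OF norm_triangle_ineq] add_mono order_refl)
  also have "\<dots> \<le> 11/10 * norm (\<beta>1 - a) + 5 * \<epsilon> * norm a + 11/10 * norm (\<beta>2 - b)
      + 11/2 * \<epsilon> * norm b + \<epsilon> / 50 * (norm a + norm b)"
    using e by (intro add_mono mult_mono s1 si s si1 g1 norm_triangle_ineq4 order_refl) auto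
  also have "\<dots> \<le> 11/10 * (norm (\<beta>1 - a) + norm (\<beta>2 - b)) + 6 * \<epsilon> * (norm a + norm b)"
    using mult_nonneg_nonneg[OF e(1) norm_ge_zero[of a]] mult_nonneg_nonneg[OF e(1) norm_ge_zero[of b]]
    unfolding mult.assoc distrib_left times_divide_eq_left by linarith
  finally have *: "norm ?X * norm (1 + \<gamma>) \<le> 11/10 * (norm (\<beta>1 - a) + norm (\<beta>2 - b)) + 6 * \<epsilon> * (norm a + norm b)"
    by (simp add: norm_mult)
  have "1/2 \<le> norm (1 + \<gamma>)"
    using norm_triangle_ineq2[of 1 "- \<gamma>"] g1 e by simp
  then have "norm ?X * (1/2) \<le> norm ?X * norm (1 + \<gamma>)" by (intro mult_left_mono) auto
  moreover define r where "r = \<epsilon> * (norm a + norm b)"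
  moreover have "norm ?X * norm (1 + \<gamma>) \<le> 11/10 * (norm (\<beta>1 - a) + norm (\<beta>2 - b)) + 6 * r"
    using * by (simp only: r_def mult.assoc)
  ultimately have "norm ?X * (1/2) \<le> 11/10 * (norm (\<beta>1 - a) + norm (\<beta>2 - b)) + 6 * r"
    by linarith
  moreover have "0 \<le> r" using e by (simp add: r_def)
  ultimately have "norm ?X \<le> 4 * (norm (\<beta>1 - a) + norm (\<beta>2 - b)) + 24 * r"
    using norm_ge_zero[of "\<beta>1 - a"] norm_ge_zero[of "\<beta>2 - b"] by argo
  then show ?thesis by (simp add: r_def mult.assoc)
qed

text \<open>
  Equality of the two sums is the Dirichlet condition \<open>u(0) = v(0)\<close>. Together with the decomposition
  into even and odd parts it forces \<open>w 0 / u 0\<close> to be close to 1; otherwise the ratio of the zero modes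
  would be arbitrary, and \<open>A - B\<close> would not be determined by \<open>a n - b n\<close>.
\<close>
lemma hankel_system_asymptotics:
  assumes ab: "wl2_le (Suc P) R a" "wl2_le (Suc P) R b" "\<bar>Re A\<bar> \<le> pi" "\<bar>Re B\<bar> \<le> pi"
    and n: "hbound P R \<le> wgt n"
    and sys: "hankel_system n A B a b u w" and bu: "\<And>k. norm (u k) \<le> U" and bw: "\<And>k. norm (w k) \<le> U"
  shows "\<exists>C. l1_le C u \<and> l1_le C w"
    and "infsum u UNIV = infsum w UNIV \<Longrightarrow> u k0 \<noteq> 0 \<or> w k0 \<noteq> 0 \<Longrightarrow>
      u 0 \<noteq> 0 \<and> norm (w 0 - u 0) \<le> hbound P R / wgt n * norm (u 0) \<and>
      l1_le (hbound P R / wgt n * norm (u 0)) (\<lambda>k. if k = 0 then 0 else u k) \<and>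
      l1_le (hbound P R / wgt n * norm (u 0)) (\<lambda>k. if k = 0 then 0 else w k) \<and>
      norm A \<le> hbound P R / wgt n \<and> norm B \<le> hbound P R / wgt n \<and>
      norm (A - B - (a n - b n)) \<le> hbound P R * (gmaj a b n + 1 / wgt n ^ Suc (Suc P)) / wgt n"
proof -
  have R: "0 \<le> R" using ab wl2_le_nonneg by blast
  have h0: "0 \<le> hconst P R" by (simp add: hconst_def)
  have hb: "4 * hconst P R \<le> hbase P R" "0 \<le> hbase P R" using R h0 by (simp_all add: hbase_def)
  define K3 where "K3 = (8 * 2 ^ P * R) ^ 3 * (2 * hconst P R)"
  have K3: "0 \<le> K3" using R h0 by (simp add: K3_def)
  have H: "hbound P R = 100 + 100 * hbase P R + 100 * K3 + 100 * R + 100 * (R * hbase P R) + 100 * (R * K3)"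
    by (simp add: hbound_def K3_def algebra_simps)
  have RK: "0 \<le> R * hbase P R" "0 \<le> R * K3" using R hb K3 by auto
  have n2: "2 * hconst P R \<le> wgt n" using n[unfolded H] hb h0 K3 R RK by linarith
  obtain E O1 E' O1' \<epsilon> where e_def: "\<epsilon> = hbase P R / wgt n"
    and E: "\<And>k. E k = delta0 k + hop n B b O1 k" "\<And>k. O1 k = hop n A a E k"
    and E': "\<And>k. E' k = delta0 k + hop n A a O1' k" "\<And>k. O1' k = hop n B b E' k"
    and l: "l1_le \<epsilon> (\<lambda>k. E k - delta0 k)" "l1_le \<epsilon> O1" "l1_le \<epsilon> (\<lambda>k. E' k - delta0 k)" "l1_le \<epsilon> O1'"
    and uw: "\<And>k. u k = u 0 * E' k + w 0 * O1 k" "\<And>k. w k = w 0 * E k + u 0 * O1' k"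
    and beta: "wgt n * norm (conv a E n - a n) \<le> zmaj a b n + K3 / wgt n ^ (Suc (Suc P))"
    "wgt n * norm (conv b E' n - b n) \<le> zmaj b a n + K3 / wgt n ^ (Suc (Suc P))"
    by (rule hankel_system_l1[OF ab n2 sys bu bw, folded K3_def]) (rule that, assumption+)
  have e0: "0 \<le> \<epsilon>" and e1: "\<epsilon> \<le> 1/100"
  proof -
    show "0 \<le> \<epsilon>" using hb by (simp add: e_def)
    have "100 * hbase P R \<le> wgt n" using n[unfolded H] hb K3 R RK by linarith
    then show "\<epsilon> \<le> 1/100" by (simp add: e_def divide_le_eq)
  qed
  have d: "(delta0 has_sum 1) UNIV"
    by (rule has_sum_finite_neutralI[of "{0}"]) auto
  have sE: "(E has_sum (1 + infsum (\<lambda>k. E k - delta0 k) UNIV)) UNIV"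
    using has_sum_add[OF d has_sum_infsum[OF l1_le_summable(2)[OF l(1)]]] by simp
  have sE': "(E' has_sum (1 + infsum (\<lambda>k. E' k - delta0 k) UNIV)) UNIV"
    using has_sum_add[OF d has_sum_infsum[OF l1_le_summable(2)[OF l(3)]]] by simp
  note sO = has_sum_infsum[OF l1_le_summable(2)[OF l(2)]] has_sum_infsum[OF l1_le_summable(2)[OF l(4)]]
  have split: "u k = u 0 * delta0 k + (u 0 * (E' k - delta0 k) + w 0 * O1 k)"
    "w k = w 0 * delta0 k + (w 0 * (E k - delta0 k) + u 0 * O1' k)" for k
    using uw(1)[of k] uw(2)[of k] by (simp_all add: algebra_simps)
  have cm: "l1_le (norm c * X) (\<lambda>k. c * x k)" if "l1_le X x" for c :: complex and X x
  proof (rule l1_leI)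
    fix F :: "int set" assume "finite F"
    then show "(\<Sum>k\<in>F. norm (c * x k)) \<le> norm c * X"
      using l1_leD[OF that] unfolding norm_mult sum_distrib_left[symmetric] by (intro mult_left_mono) auto
  qed
  have tail: "l1_le (norm (u 0) * \<epsilon> + norm (w 0) * \<epsilon>) (\<lambda>k. u 0 * (E' k - delta0 k) + w 0 * O1 k)"
    "l1_le (norm (w 0) * \<epsilon> + norm (u 0) * \<epsilon>) (\<lambda>k. w 0 * (E k - delta0 k) + u 0 * O1' k)"
    by (intro l1_le_add cm l)+
  have t0: "E 0 = 1" "E' 0 = 1" "O1 0 = 0" "O1' 0 = 0"
    using E[of 0] E'[of 0] by simp_all
  have l1uw: "l1_le (norm (u 0) * 1 + (norm (u 0) * \<epsilon> + norm (w 0) * \<epsilon>)) u"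
    "l1_le (norm (w 0) * 1 + (norm (w 0) * \<epsilon> + norm (u 0) * \<epsilon>)) w"
    using l1_le_add[OF cm[OF l1_le_delta0] tail(1), of "u 0"] l1_le_add[OF cm[OF l1_le_delta0] tail(2), of "w 0"]
    unfolding split[symmetric] by auto
  let ?C = "norm (u 0) + norm (w 0) + (norm (w 0) * \<epsilon> + norm (u 0) * \<epsilon>)"
  have "l1_le ?C u \<and> l1_le ?C w"
    by (intro conjI l1_le_mono[OF l1uw(1)] l1_le_mono[OF l1uw(2)]) auto
  then show "\<exists>C. l1_le C u \<and> l1_le C w" by blast
  assume sums: "infsum u UNIV = infsum w UNIV" and nonzero: "u k0 \<noteq> 0 \<or> w k0 \<noteq> 0"
  define x where "x = infsum (\<lambda>k. E k - delta0 k) UNIV"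
  define x' where "x' = infsum (\<lambda>k. E' k - delta0 k) UNIV"
  define y where "y = infsum O1 UNIV"
  define y' where "y' = infsum O1' UNIV"
  have xy: "norm x \<le> \<epsilon>" "norm x' \<le> \<epsilon>" "norm y \<le> \<epsilon>" "norm y' \<le> \<epsilon>"
    unfolding x_def x'_def y_def y'_def by (intro norm_infsum_le_l1 l)+
  have "(u has_sum (u 0 * (1 + x') + w 0 * y)) UNIV"
    using has_sum_add[OF has_sum_cmult_right[OF sE'] has_sum_cmult_right[OF sO(1)], of "u 0" "w 0"]
    by (simp add: uw(1)[symmetric] x'_def y_def)
  moreover have "(w has_sum (w 0 * (1 + x) + u 0 * y')) UNIV"
    using has_sum_add[OF has_sum_cmult_right[OF sE] has_sum_cmult_right[OF sO(2)], of "w 0" "u 0"]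
    by (simp add: uw(2)[symmetric] x_def y'_def)
  ultimately have "u 0 * (1 + x') + w 0 * y = w 0 * (1 + x) + u 0 * y'"
    using sums by (metis infsumI)
  \<comment> \<open>The boundary condition in terms of the zero modes; \<open>x\<close>, \<open>x'\<close>, \<open>y\<close>, \<open>y'\<close> are at most \<open>\<epsilon>\<close>.\<close>
  then have bal: "(w 0 - u 0) * (1 + (x - y)) = u 0 * ((x' - y') - (x - y))"
    by (simp add: algebra_simps)
  have "norm (x - y) \<le> 2 * \<epsilon>" "norm (x' - y') \<le> 2 * \<epsilon>"
    using norm_triangle_ineq4[of x y] norm_triangle_ineq4[of x' y'] xy by linarith+
  moreover have "norm ((x' - y') - (x - y)) \<le> norm (x' - y') + norm (x - y)"
    by (rule norm_triangle_ineq4)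
  moreover have "1 - norm (x - y) \<le> norm (1 + (x - y))"
    using norm_triangle_ineq2[of 1 "- (x - y)"] by (simp only: norm_minus_cancel diff_minus_eq_add norm_one)
  ultimately have q: "norm ((x' - y') - (x - y)) \<le> 4 * \<epsilon>" "9/10 \<le> norm (1 + (x - y))"
    using e1 by auto
  have "norm (w 0 - u 0) * (9/10) \<le> norm (w 0 - u 0) * norm (1 + (x - y))"
    using q by (intro mult_left_mono) auto
  also have "\<dots> = norm (u 0) * norm ((x' - y') - (x - y))"
    using bal by (simp only: norm_mult[symmetric])
  also have "\<dots> \<le> norm (u 0) * (4 * \<epsilon>)"
    using q by (intro mult_left_mono) auto
  finally have w0: "norm (w 0 - u 0) \<le> 5 * \<epsilon> * norm (u 0)"
  proof -
    define z where "z = \<epsilon> * norm (u 0)"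
    assume "norm (w 0 - u 0) * (9/10) \<le> norm (u 0) * (4 * \<epsilon>)"
    then have "norm (w 0 - u 0) * (9/10) \<le> 4 * z" by (simp add: z_def mult_ac)
    moreover have "0 \<le> z" using e0 by (simp add: z_def)
    ultimately have "norm (w 0 - u 0) \<le> 5 * z" by linarith
    then show ?thesis by (simp add: z_def mult_ac)
  qed
  have u0: "u 0 \<noteq> 0"
  proof
    assume "u 0 = 0"
    with w0 have "w 0 = 0" by simp
    with \<open>u 0 = 0\<close> uw[of k0] nonzero show False by simp
  qed
  have w0': "norm (w 0) \<le> 2 * norm (u 0)"
  proof -
    have "5 * \<epsilon> * norm (u 0) \<le> 1 * norm (u 0)" using e1 by (intro mult_right_mono) auto
    then show ?thesis using w0 norm_triangle_ineq[of "w 0 - u 0" "u 0"] by simp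
  qed
  have eH: "5 * \<epsilon> \<le> hbound P R / wgt n"
  proof -
    have "5 * hbase P R \<le> hbound P R" unfolding H using R K3 RK hb by linarith
    from divide_right_mono[OF this, of "wgt n"] show ?thesis by (simp add: e_def)
  qed
  have tl: "norm (u 0) * \<epsilon> + norm (w 0) * \<epsilon> \<le> hbound P R / wgt n * norm (u 0)"
  proof -
    have "norm (u 0) * \<epsilon> + norm (w 0) * \<epsilon> \<le> norm (u 0) * \<epsilon> + 2 * norm (u 0) * \<epsilon>"
      using w0' e0 by (intro add_mono mult_right_mono) auto
    also have "\<dots> \<le> 5 * \<epsilon> * norm (u 0)" using e0 by simp
    also have "\<dots> \<le> hbound P R / wgt n * norm (u 0)" by (intro mult_right_mono eH) auto
    finally show ?thesis .
  qed
  have c1: "norm (w 0 - u 0) \<le> hbound P R / wgt n * norm (u 0)"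
    by (rule order_trans[OF w0]) (intro mult_right_mono eH norm_ge_zero)
  have tk: "(if k = 0 then 0 else u k) = u 0 * (E' k - delta0 k) + w 0 * O1 k"
    "(if k = 0 then 0 else w k) = w 0 * (E k - delta0 k) + u 0 * O1' k" for k
    using split(1)[of k] split(2)[of k] t0 by (cases "k = 0"; simp)+
  have c2: "l1_le (hbound P R / wgt n * norm (u 0)) (\<lambda>k. if k = 0 then 0 else u k)"
    unfolding tk by (rule l1_le_mono[OF tail(1)]) (use tl in auto)
  have c3: "l1_le (hbound P R / wgt n * norm (u 0)) (\<lambda>k. if k = 0 then 0 else w k)"
    unfolding tk by (rule l1_le_mono[OF tail(2)]) (use tl in auto)
  \<comment> \<open>The equations with \<open>k = 0\<close> now determine \<open>A\<close> and \<open>B\<close>.\<close>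
  note a1 = wl2_le_imp_l1_le_0[OF ab(1)] and b1 = wl2_le_imp_l1_le_0[OF ab(2)]
  define s where "s = w 0 / u 0"
  have s: "norm (s - 1) \<le> 5 * \<epsilon>"
  proof -
    have "s - 1 = (w 0 - u 0) / u 0" using u0 by (simp add: s_def field_simps)
    then show ?thesis using w0 u0 by (simp add: norm_divide divide_le_eq)
  qed
  have s2: "norm s \<le> 2" using w0' u0 by (simp add: s_def norm_divide divide_le_eq)
  have s0: "s \<noteq> 0" using s e1 by auto
  have si2: "norm (1 / s) \<le> 2"
  proof -
    have "1/2 \<le> norm s" using norm_triangle_ineq2[of 1 "1 - s"] s e1 by (simp add: norm_minus_commute)
    then show ?thesis by (simp add: norm_divide divide_le_eq)
  qed
  have bE: "norm (E k) \<le> 1 + \<epsilon>" "norm (E' k) \<le> 1 + \<epsilon>" for k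
    using l1_le_bounded[OF l1_le_add[OF l1_le_delta0 l(1)], of k] l1_le_bounded[OF l1_le_add[OF l1_le_delta0 l(3)], of k] by auto
  have bc: "norm (c * x k) \<le> norm c * X" if "\<And>k. norm (x k) \<le> X" for c :: complex and X and x :: "int \<Rightarrow> complex" and k
    using that by (simp add: norm_mult mult_left_mono)
  have "A * u 0 = conv a (\<lambda>k. w 0 * E k + u 0 * O1' k) n"
    using sys unfolding uw(2)[symmetric] hankel_system_def by (auto dest: spec[of _ 0])
  also have "\<dots> = w 0 * conv a E n + u 0 * conv a O1' n"
    by (subst conv_add_right[OF a1 bc[OF bE(1)] bc[OF l1_le_bounded[OF l(4)]]]) (simp add: conv_cmult_right)
  finally have A: "A = s * conv a E n + conv a O1' n"
    using u0 by (simp add: s_def field_simps)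
  have "B * w 0 = conv b (\<lambda>k. u 0 * E' k + w 0 * O1 k) n"
    using sys unfolding uw(1)[symmetric] hankel_system_def by (auto dest: spec[of _ 0])
  also have "\<dots> = u 0 * conv b E' n + w 0 * conv b O1 n"
    by (subst conv_add_right[OF b1 bc[OF bE(2)] bc[OF l1_le_bounded[OF l(2)]]]) (simp add: conv_cmult_right)
  finally have B: "B = conv b E' n / s + conv b O1 n"
    using u0 s0 by (simp add: s_def field_simps)
  define \<gamma> where "\<gamma> = (\<Sum>\<^sub>\<infinity>k. if k = 0 then 0 else E k * E' k - O1 k * O1' k)"
  have lE: "l1_le (1 + \<epsilon>) E" "l1_le (1 + \<epsilon>) E'" "l1_le (1 + \<epsilon>) O1" "l1_le (1 + \<epsilon>) O1'"
    using l1_le_add[OF l1_le_delta0 l(1)] l1_le_add[OF l1_le_delta0 l(3)] l1_le_mono[OF l(2), of O1 "1 + \<epsilon>"] l1_le_mono[OF l(4), of O1' "1 + \<epsilon>"] by auto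
  \<comment> \<open>Each of the two diagonal terms is only \<open>O(1/n)\<close>; the symmetry removes their difference.\<close>
  have "conv a O1' n - conv b O1 n + (A - B) * \<gamma> = 0"
    unfolding \<gamma>_def
    by (rule diagonal_difference[OF wl2_le_bounded[OF ab(1)] wl2_le_bounded[OF ab(2)] lE ab(3,4) E E'])
  then have eq: "(A - B) * (1 + \<gamma>) = s * conv a E n - conv b E' n / s"
    using A B by (simp add: algebra_simps add_divide_distrib)
  have g: "norm \<gamma> \<le> 2 * \<epsilon>\<^sup>2"
    unfolding \<gamma>_def
  proof (rule norm_infsum_le_l1, rule l1_leI)
    fix F :: "int set" assume F: "finite F"
    have "(\<Sum>k\<in>F. norm (if k = 0 then 0 else E k * E' k - O1 k * O1' k))
        \<le> (\<Sum>k\<in>F. norm (E k - delta0 k) * \<epsilon> + norm (O1 k) * \<epsilon>)"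
    proof (rule sum_mono)
      fix k
      have "norm ((E k - delta0 k) * (E' k - delta0 k) - O1 k * O1' k)
          \<le> norm (E k - delta0 k) * norm (E' k - delta0 k) + norm (O1 k) * norm (O1' k)"
        by (rule order_trans[OF norm_triangle_ineq4]) (simp add: norm_mult)
      also have "\<dots> \<le> norm (E k - delta0 k) * \<epsilon> + norm (O1 k) * \<epsilon>"
        using l1_le_bounded[OF l(3)] l1_le_bounded[OF l(4)] by (intro add_mono mult_left_mono) auto
      finally show "norm (if k = 0 then 0 else E k * E' k - O1 k * O1' k) \<le> norm (E k - delta0 k) * \<epsilon> + norm (O1 k) * \<epsilon>"
        using e0 by auto
    qed
    also have "\<dots> = (\<Sum>k\<in>F. norm (E k - delta0 k)) * \<epsilon> + (\<Sum>k\<in>F. norm (O1 k)) * \<epsilon>"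
      by (simp add: sum.distrib sum_distrib_right)
    also have "\<dots> \<le> \<epsilon> * \<epsilon> + \<epsilon> * \<epsilon>"
      using l1_leD[OF l(1) F] l1_leD[OF l(2) F] e0 by (intro add_mono mult_right_mono)
    finally show "(\<Sum>k\<in>F. norm (if k = 0 then 0 else E k * E' k - O1 k * O1' k)) \<le> 2 * \<epsilon>\<^sup>2"
      by (simp add: power2_eq_square)
  qed
  have an: "norm (a n) \<le> R / wgt n" "norm (b n) \<le> R / wgt n"
    using wl2_le_pointwise[OF wl2_le_power_mono[OF ab(1), of 1], of n]
      wl2_le_pointwise[OF wl2_le_power_mono[OF ab(2), of 1], of n] by (simp_all add: field_simps)
  have cvd: "norm (conv a E n) \<le> R / wgt n + \<epsilon> * R" "norm (conv b E' n) \<le> R / wgt n + \<epsilon> * R"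
  proof -
    have 1: "norm (conv c (\<lambda>k. x k - delta0 k) n) \<le> \<epsilon> * R" if "wl2_le (Suc P) R c" "l1_le \<epsilon> (\<lambda>k. x k - delta0 k)"
      for c x :: "int \<Rightarrow> complex"
      using norm_conv_le(2)[OF that(2) wl2_le_bounded[OF that(1)]] by (subst conv_commute) (simp add: mult.commute)
    have 2: "conv c x n = c n + conv c (\<lambda>k. x k - delta0 k) n" if "wl2_le (Suc P) R c" "l1_le \<epsilon> (\<lambda>k. x k - delta0 k)"
      for c x :: "int \<Rightarrow> complex"
    proof -
      have "conv c (\<lambda>k. delta0 k + (x k - delta0 k)) n = conv c delta0 n + conv c (\<lambda>k. x k - delta0 k) n"
        by (rule conv_add_right[OF wl2_le_imp_l1_le_0[OF that(1)] norm_delta0_le l1_le_bounded[OF that(2)]])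
      then show ?thesis by simp
    qed
    show "norm (conv a E n) \<le> R / wgt n + \<epsilon> * R" "norm (conv b E' n) \<le> R / wgt n + \<epsilon> * R"
      unfolding 2[OF ab(1) l(1)] 2[OF ab(2) l(3)]
      by (intro order_trans[OF norm_triangle_ineq] add_mono an 1 ab l)+
  qed
  have cvo: "norm (conv a O1' n) \<le> \<epsilon> * R" "norm (conv b O1 n) \<le> \<epsilon> * R"
    using norm_conv_le(2)[OF l(4) wl2_le_bounded[OF ab(1)]] norm_conv_le(2)[OF l(2) wl2_le_bounded[OF ab(2)]]
    by (subst conv_commute, simp add: mult.commute)+
  have fin: "2 * (R / wgt n + \<epsilon> * R) + \<epsilon> * R \<le> hbound P R / wgt n"
  proof -
    have "2 * R + 3 * (R * hbase P R) \<le> hbound P R" unfolding H using R K3 RK hb by linarith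
    from divide_right_mono[OF this, of "wgt n"] show ?thesis by (simp add: e_def add_divide_distrib algebra_simps)
  qed
  have nA: "norm A \<le> hbound P R / wgt n"
  proof -
    have "norm A \<le> norm s * norm (conv a E n) + norm (conv a O1' n)"
      unfolding A by (rule order_trans[OF norm_triangle_ineq]) (simp add: norm_mult)
    also have "\<dots> \<le> 2 * (R / wgt n + \<epsilon> * R) + \<epsilon> * R"
      by (intro add_mono mult_mono s2 cvd cvo) auto
    finally show ?thesis using fin by linarith
  qed
  have nB: "norm B \<le> hbound P R / wgt n"
  proof -
    have "norm B \<le> norm (1 / s) * norm (conv b E' n) + norm (conv b O1 n)"
      unfolding B by (rule order_trans[OF norm_triangle_ineq]) (simp add: norm_mult norm_divide)
    also have "\<dots> \<le> 2 * (R / wgt n + \<epsilon> * R) + \<epsilon> * R"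
      by (intro add_mono mult_mono si2 cvd cvo) auto
    finally show ?thesis using fin by linarith
  qed
  let ?W = "1 / wgt n ^ Suc (Suc P)"
  have W: "0 \<le> ?W" by simp
  have "norm (A - B - (a n - b n)) \<le> 4 * (norm (conv a E n - a n) + norm (conv b E' n - b n)) + 24 * \<epsilon> * (norm (a n) + norm (b n))"
    by (rule split_difference_estimate[OF s e0 e1 g eq])
  then have "wgt n * norm (A - B - (a n - b n))
      \<le> wgt n * (4 * (norm (conv a E n - a n) + norm (conv b E' n - b n)) + 24 * \<epsilon> * (norm (a n) + norm (b n)))"
    by (intro mult_left_mono) auto
  also have "\<dots> = 4 * (wgt n * norm (conv a E n - a n)) + 4 * (wgt n * norm (conv b E' n - b n))
      + 24 * hbase P R * (norm (a n) + norm (b n))"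
  proof -
    have "wgt n * \<epsilon> = hbase P R" by (simp add: e_def)
    then have "wgt n * (24 * \<epsilon> * (norm (a n) + norm (b n))) = 24 * hbase P R * (norm (a n) + norm (b n))"
      by (metis mult.assoc mult.left_commute)
    then show ?thesis by (simp add: distrib_left mult.left_commute)
  qed
  also have "\<dots> \<le> 4 * (zmaj a b n + K3 * ?W) + 4 * (zmaj b a n + K3 * ?W) + 24 * hbase P R * (norm (a n) + norm (b n))"
    using beta by simp
  also have "\<dots> = 4 * (zmaj a b n + zmaj b a n) + (8 * K3) * ?W + 24 * hbase P R * (norm (a n) + norm (b n))"
    by (simp add: algebra_simps)
  also have "\<dots> \<le> hbound P R * (zmaj a b n + zmaj b a n) + hbound P R * ?W + hbound P R * (norm (a n) + norm (b n))"
    by (intro add_mono mult_right_mono W add_nonneg_nonneg zmaj_nonneg norm_ge_zero)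
      (use K3 R RK hb in \<open>simp_all add: H\<close>)
  also have "\<dots> = hbound P R * (gmaj a b n + ?W)"
    by (simp add: gmaj_def algebra_simps)
  finally have "norm (A - B - (a n - b n)) \<le> hbound P R * (gmaj a b n + ?W) / wgt n"
    by (simp add: field_simps)
  with u0 c1 c2 c3 nA nB show "u 0 \<noteq> 0 \<and> norm (w 0 - u 0) \<le> hbound P R / wgt n * norm (u 0) \<and>
      l1_le (hbound P R / wgt n * norm (u 0)) (\<lambda>k. if k = 0 then 0 else u k) \<and>
      l1_le (hbound P R / wgt n * norm (u 0)) (\<lambda>k. if k = 0 then 0 else w k) \<and>
      norm A \<le> hbound P R / wgt n \<and> norm B \<le> hbound P R / wgt n \<and>
      norm (A - B - (a n - b n)) \<le> hbound P R * (gmaj a b n + ?W) / wgt n"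
    by blast
qed

section \<open>Completeness of the exponentials\<close>

abbreviation M01 :: "real measure" where "M01 \<equiv> lebesgue_on {0..1}"

definition ee :: "int \<Rightarrow> real \<Rightarrow> complex" where
  "ee k x = exp (2 * of_real pi * \<i> * of_int k * of_real x)"

lemma norm_ee [simp]: "norm (ee k x) = 1"
proof -
  have "ee k x = cis (2 * pi * of_int k * x)"
    by (simp add: ee_def cis_conv_exp mult_ac)
  then show ?thesis by simp
qed

lemma ee_0 [simp]: "ee 0 x = 1" "ee k 0 = 1"
  by (simp_all add: ee_def)

lemma ee_1 [simp]: "ee k 1 = 1"
  unfolding ee_def exp_eq_1 by (auto intro!: exI[of _ k])

lemma ee_add: "ee (j + k) x = ee j x * ee k x"
  by (simp add: ee_def exp_add[symmetric] algebra_simps)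

lemma ee_uminus: "ee (- k) x = cnj (ee k x)"
  by (simp add: ee_def exp_cnj)

lemma has_vector_derivative_ee [derivative_intros]:
  "(ee k has_vector_derivative (2 * of_real pi * \<i> * of_int k) * ee k x) (at x within S)"
  unfolding ee_def
  by (rule derivative_eq_intros has_vector_derivative_real_field refl | simp)+

lemma continuous_on_ee [continuous_intros]: "continuous_on S (ee k)"
  unfolding ee_def by (intro continuous_intros)

lemma fourier_eq: "fourier u n = (\<integral>x. u x * ee (- n) x \<partial>M01)"
  by (simp add: fourier_def ee_def mult_ac)

lemma integrable_mult_ee:
  assumes "integrable M01 f" shows "integrable M01 (\<lambda>x. f x * ee k x)"
proof (rule Bochner_Integration.integrable_bound[OF assms])
  have "ee k \<in> borel_measurable M01"
    by (intro borel_measurable_integrable continuous_imp_integrable_real continuous_on_ee)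
  then show "(\<lambda>x. f x * ee k x) \<in> borel_measurable M01"
    using borel_measurable_integrable[OF assms] by measurable
qed (auto simp: norm_mult)

lemma fourier_continuous:
  assumes "continuous_on {0..1} f"
  shows "fourier f n = integral {0..1} (\<lambda>x. f x * ee (- n) x)"
  unfolding fourier_eq
  by (intro lebesgue_integral_eq_integral continuous_imp_integrable_real continuous_intros assms) auto

lemma norm_fourier_le:
  assumes "continuous_on {0..1} f" "\<And>x. x \<in> {0..1} \<Longrightarrow> norm (f x) \<le> C"
  shows "norm (fourier f n) \<le> C"
proof -
  have "norm (integral {0..1} (\<lambda>x. f x * ee (- n) x)) \<le> C * (1 - 0)"
    using assms by (intro integral_bound continuous_intros) (auto simp: norm_mult)
  then show ?thesis by (simp add: fourier_continuous assms)
qed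

lemma fourier_diff:
  assumes "integrable M01 f" "integrable M01 g"
  shows "fourier (\<lambda>x. f x - g x) n = fourier f n - fourier g n"
  unfolding fourier_eq left_diff_distrib
  by (rule Bochner_Integration.integral_diff[OF integrable_mult_ee[OF assms(1)] integrable_mult_ee[OF assms(2)]])

lemma fourier_one: "fourier (\<lambda>x. 1) n = delta0 n"
proof (cases "n = 0")
  case False
  let ?c = "2 * of_real pi * \<i> * of_int (- n) :: complex"
  have c: "?c \<noteq> 0" using False by simp
  have "((\<lambda>x. ?c * ee (- n) x) has_integral (ee (- n) 1 - ee (- n) 0)) {0..1}"
    by (rule fundamental_theorem_of_calculus[OF _ has_vector_derivative_ee]) simp
  then have "((\<lambda>x. ?c * ee (- n) x) has_integral 0) {0..1}" by simp
  then have "integral {0..1} (\<lambda>x. ?c * ee (- n) x) = 0" by (rule integral_unique)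
  then have "integral {0..1} (ee (- n)) = 0" using c by simp
  then show ?thesis using False by (simp add: fourier_continuous)
qed (simp add: fourier_continuous)

text \<open>
  Orthogonality to all characters. The aim is that such a function vanishes almost everywhere; the
  property is preserved by multiplication with a character, hence by multiplication with trigonometric
  polynomials.
\<close>
definition annihilating :: "(real \<Rightarrow> complex) \<Rightarrow> bool" where
  "annihilating f \<longleftrightarrow> integrable M01 f \<and> (\<forall>k. (\<integral>x. f x * ee k x \<partial>M01) = 0)"

lemma annihilating_mult_ee: "annihilating f \<Longrightarrow> annihilating (\<lambda>x. f x * ee j x)"
  unfolding annihilating_def by (auto simp: integrable_mult_ee mult.assoc ee_add[symmetric])

lemma annihilating_add: "annihilating f \<Longrightarrow> annihilating g \<Longrightarrow> annihilating (\<lambda>x. f x + g x)"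
  unfolding annihilating_def distrib_right
  by (auto simp: integrable_mult_ee Bochner_Integration.integral_add)

lemma annihilating_cmult: "annihilating f \<Longrightarrow> annihilating (\<lambda>x. f x * c)"
  unfolding annihilating_def by (auto simp: mult.assoc mult.left_commute[of _ c] mult.commute[of _ c])

text \<open>
  The real and imaginary part of a point on the circle are linear combinations of the characters
  \<open>ee 1\<close> and \<open>ee (- 1)\<close>, so polynomials on the circle are trigonometric polynomials.
\<close>
lemma annihilating_polynomial:
  fixes p :: "complex \<Rightarrow> real"
  assumes "real_polynomial_function p" "annihilating f"
  shows "annihilating (\<lambda>x. f x * of_real (p (ee 1 x)))"
  using assms
proof (induction arbitrary: f)
  case (linear p)
  interpret bounded_linear p by fact
  have p: "p z = Re z * p 1 + Im z * p \<i>" for z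
  proof -
    have "z = Re z *\<^sub>R 1 + Im z *\<^sub>R \<i>" by (simp add: complex_eq_iff)
    then have "p z = p (Re z *\<^sub>R 1 + Im z *\<^sub>R \<i>)" by simp
    then show ?thesis by (simp add: add scaleR)
  qed
  \<comment> \<open>A real linear form on the complex plane in terms of \<open>z\<close> and its conjugate.\<close>
  have pz: "of_real (p z) = z * ((p 1 - \<i> * p \<i>) / 2) + cnj z * ((p 1 + \<i> * p \<i>) / 2)" for z
    by (subst p) (simp add: complex_eq_iff field_simps)
  have eq: "(\<lambda>x. f x * of_real (p (ee 1 x)))
      = (\<lambda>x. f x * ee 1 x * ((p 1 - \<i> * p \<i>) / 2) + f x * ee (- 1) x * ((p 1 + \<i> * p \<i>) / 2))"
    unfolding ee_uminus by (rule ext, subst pz) (simp only: distrib_left mult.assoc)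
  show ?case
    unfolding eq by (intro annihilating_add annihilating_cmult annihilating_mult_ee linear.prems)
next
  case (const c)
  then show ?case by (rule annihilating_cmult)
next
  case (add p q)
  then show ?case by (simp add: distrib_left annihilating_add)
next
  case (mult p q)
  have "annihilating (\<lambda>x. f x * of_real (p (ee 1 x)) * of_real (q (ee 1 x)))"
    by (intro mult)
  then show ?case by (simp add: mult.assoc)
qed

text \<open>
  A continuous function with equal values at 0 and 1 is a continuous function on the circle, because
  \<open>ee 1\<close> is a quotient map from the interval onto the circle. There it is a uniform limit of
  polynomials by the Stone--Weierstrass theorem.
\<close>
lemma annihilating_integral_continuous:
  assumes f: "annihilating f" and c: "continuous_on {0..1} c" "c 0 = c 1"
  shows "integrable M01 (\<lambda>x. f x * c x)" "(\<integral>x. f x * c x \<partial>M01) = 0"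
proof -
  have fi: "integrable M01 f" using f by (simp add: annihilating_def)
  have int: "integrable M01 (\<lambda>x. f x * d x)" if "continuous_on {0..1} d" for d :: "real \<Rightarrow> complex"
  proof -
    have "compact (d ` {0..1})" by (intro compact_continuous_image that) simp
    then obtain C where C: "\<And>x. x \<in> {0..1} \<Longrightarrow> norm (d x) \<le> C"
      by (meson bounded_iff compact_imp_bounded imageI)
    have "integrable M01 (\<lambda>x. C * norm (f x))" using fi by simp
    then show ?thesis
    proof (rule Bochner_Integration.integrable_bound)
      show "(\<lambda>x. f x * d x) \<in> borel_measurable M01"
        using borel_measurable_integrable[OF fi]
          borel_measurable_integrable[OF continuous_imp_integrable_real[OF that]] by measurable
      show "AE x in M01. norm (f x * d x) \<le> norm (C * norm (f x))"
      proof (rule AE_I2)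
        fix x assume "x \<in> space M01"
        then have "norm (f x) * norm (d x) \<le> norm (f x) * C" by (intro mult_left_mono C) auto
        then show "norm (f x * d x) \<le> norm (C * norm (f x))" by (simp add: norm_mult mult.commute abs_le_iff)
      qed
    qed
  qed
  show "integrable M01 (\<lambda>x. f x * c x)" by (rule int[OF c(1)])
  let ?S = "sphere (0::complex) 1"
  have img: "ee 1 ` {0..1} = ?S"
  proof
    show "ee 1 ` {0..1} \<subseteq> ?S" by auto
    show "?S \<subseteq> ee 1 ` {0..1}"
    proof
      fix z assume "z \<in> ?S"
      then have z: "norm z = 1" by simp
      have "z = ee 1 (Arg2pi z / (2 * pi))"
        using Arg2pi_eq[of z] z by (simp add: ee_def mult_ac)
      moreover have "Arg2pi z / (2 * pi) \<in> {0..1}"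
        using Arg2pi_ge_0[of z] Arg2pi_lt_2pi[of z] by (simp add: field_simps)
      ultimately show "z \<in> ee 1 ` {0..1}" by blast
    qed
  qed
  have inj: "x = y \<or> (x = 0 \<and> y = 1) \<or> (x = 1 \<and> y = 0)"
    if x: "x \<in> {0..1}" and y: "y \<in> {0..1}" and exy: "ee 1 x = ee 1 y" for x y
  proof -
    obtain m :: int where "2 * of_real pi * \<i> * of_real x = 2 * of_real pi * \<i> * of_real y + (2 * of_int m * of_real pi) * \<i>"
      using exy unfolding ee_def exp_eq by auto
    then have "Im (2 * of_real pi * \<i> * of_real x) = Im (2 * of_real pi * \<i> * of_real y + (2 * of_int m * of_real pi) * \<i>)"
      by simp
    then have "(2 * pi) * x = (2 * pi) * (y + of_int m)" by (simp add: algebra_simps)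
    then have "x = y + of_int m" by simp
    moreover have "m = 0 \<or> m = 1 \<or> m = - 1"
    proof -
      have "real_of_int m \<le> 1" "- 1 \<le> real_of_int m" using x y calculation by auto
      then show ?thesis by linarith
    qed
    ultimately show ?thesis using x y by auto
  qed
  have q: "quotient_map (top_of_set {0..1}) (top_of_set ?S) (ee 1)"
    by (rule continuous_imp_quotient_map)
      (auto simp: compact_space_subtopology Hausdorff_space_subtopology img continuous_on_ee[of "{0..1}" 1])
  obtain C where C: "continuous_map (top_of_set ?S) euclidean C" "\<And>x. x \<in> {0..1} \<Longrightarrow> C (ee 1 x) = c x"
  proof (rule quotient_map_lift_exists[OF q, of euclidean c])
    show "continuous_map (top_of_set {0..1}) euclidean c" using c by simp
    show "c x = c y" if "x \<in> topspace (top_of_set {0..1})" "y \<in> topspace (top_of_set {0..1})" "ee 1 x = ee 1 y" for x y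
      using inj[of x y] that c(2) by auto
  qed auto
  then have Cc: "continuous_on ?S C" by simp
  have small: "norm (\<integral>x. f x * c x \<partial>M01) \<le> \<epsilon> * (\<integral>x. norm (f x) \<partial>M01)" if "0 < \<epsilon>" for \<epsilon>
  proof -
    obtain g where g: "polynomial_function g" "\<And>z. z \<in> ?S \<Longrightarrow> norm (C z - g z) < \<epsilon>"
      using Stone_Weierstrass_polynomial_function[OF compact_sphere Cc \<open>0 < \<epsilon>\<close>] by blast
    have re: "real_polynomial_function (\<lambda>z. Re (g z))" "real_polynomial_function (\<lambda>z. Im (g z))"
      using g(1) bounded_linear_Re bounded_linear_Im unfolding polynomial_function_def
      by (auto simp: o_def)
    have "annihilating (\<lambda>x. f x * of_real (Re (g (ee 1 x))) + f x * of_real (Im (g (ee 1 x))) * \<i>)"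
      by (intro annihilating_add annihilating_cmult annihilating_polynomial[OF re(1) f] annihilating_polynomial[OF re(2) f])
    moreover have "(\<lambda>x. f x * of_real (Re (g (ee 1 x))) + f x * of_real (Im (g (ee 1 x))) * \<i>) = (\<lambda>x. f x * g (ee 1 x))"
    proof
      fix x
      show "f x * of_real (Re (g (ee 1 x))) + f x * of_real (Im (g (ee 1 x))) * \<i> = f x * g (ee 1 x)"
        by (subst (3) complex_eq) (simp add: algebra_simps)
    qed
    ultimately have ann: "annihilating (\<lambda>x. f x * g (ee 1 x))" by simp
    then have gi: "integrable M01 (\<lambda>x. f x * g (ee 1 x))" by (simp add: annihilating_def)
    have "(\<integral>x. f x * g (ee 1 x) * ee 0 x \<partial>M01) = 0"
      using ann unfolding annihilating_def by blast
    then have "(\<integral>x. f x * c x \<partial>M01) = (\<integral>x. f x * c x - f x * g (ee 1 x) \<partial>M01)"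
      using int[OF c(1)] gi by simp
    also have "norm \<dots> \<le> (\<integral>x. norm (f x * c x - f x * g (ee 1 x)) \<partial>M01)"
      by (rule integral_norm_bound)
    also have "\<dots> \<le> (\<integral>x. \<epsilon> * norm (f x) \<partial>M01)"
    proof (rule integral_mono)
      show "integrable M01 (\<lambda>x. norm (f x * c x - f x * g (ee 1 x)))" using int[OF c(1)] gi by simp
      show "integrable M01 (\<lambda>x. \<epsilon> * norm (f x))" using fi by simp
      fix x assume "x \<in> space M01"
      then have "norm (c x - g (ee 1 x)) \<le> \<epsilon>" using g(2)[of "ee 1 x"] C(2)[of x] by simp
      then have "norm (f x) * norm (c x - g (ee 1 x)) \<le> norm (f x) * \<epsilon>"
        by (intro mult_left_mono) auto
      then show "norm (f x * c x - f x * g (ee 1 x)) \<le> \<epsilon> * norm (f x)"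
        unfolding right_diff_distrib[symmetric] norm_mult by (simp add: mult.commute)
    qed
    finally show ?thesis by simp
  qed
  have "norm (\<integral>x. f x * c x \<partial>M01) \<le> 0"
  proof (rule field_le_epsilon)
    fix e :: real assume e: "0 < e"
    let ?I = "\<integral>x. norm (f x) \<partial>M01"
    have I: "0 \<le> ?I" by simp
    have "norm (\<integral>x. f x * c x \<partial>M01) \<le> e / (1 + ?I) * ?I" using e I by (intro small divide_pos_pos add_pos_nonneg) auto
    also have "\<dots> \<le> e"
    proof -
      have "0 < 1 + ?I" using I by linarith
      moreover have "e * ?I \<le> e * (1 + ?I)" using e by simp
      ultimately show ?thesis by (simp only: times_divide_eq_left pos_divide_le_eq)
    qed
    finally show "norm (\<integral>x. f x * c x \<partial>M01) \<le> 0 + e" by simp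
  qed
  then show "(\<integral>x. f x * c x \<partial>M01) = 0" by simp
qed

text \<open>
  Test \<open>f\<close> against the bounded function \<open>s = cnj f / (1 + |f|)\<close>, for which \<open>f s \<ge> 0\<close> vanishes only where
  \<open>f\<close> does. As \<open>s\<close> is measurable, it is the limit almost everywhere of continuous functions, which
  can be truncated to be bounded by 1 and multiplied by cutoff functions to vanish at both ends.
  Dominated convergence applies.
\<close>
lemma annihilating_imp_AE_zero:
  assumes f: "annihilating f"
  shows "AE x in M01. f x = 0"
proof -
  have fi: "integrable M01 f" using f by (simp add: annihilating_def)
  then have [measurable]: "f \<in> borel_measurable M01" by (rule borel_measurable_integrable)
  define s where "s x = cnj (f x) / of_real (1 + norm (f x))" for x
  have sm: "s \<in> borel_measurable M01"
    unfolding s_def by (intro borel_measurable_divide) (auto intro: measurable_compose[OF _ borel_measurable_continuous_onI] continuous_intros)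
  have ns: "norm (s x) \<le> 1" for x
  proof -
    have "0 < 1 + norm (f x)" by (simp add: add_pos_nonneg)
    then show ?thesis by (simp add: s_def norm_divide divide_le_eq del: of_real_add)
  qed
  have "s measurable_on {0..1}"
    using sm by (simp add: measurable_on_iff_borel_measurable)
  then obtain N g where N: "negligible N" and g: "\<And>n. continuous_on UNIV (g n)"
    and lim: "\<And>x. x \<notin> N \<Longrightarrow> (\<lambda>n. g n x) \<longlonglongrightarrow> (if x \<in> {0..1} then s x else 0)"
    unfolding measurable_on_def by blast
  \<comment> \<open>The cutoff: zero at both ends of the interval, and eventually 1 at each interior point.\<close>
  define ct where "ct n x = min 1 (real n * x) * min 1 (real n * (1 - x))" for n :: nat and x :: real
  define h where "h n x = g n x / of_real (max 1 (norm (g n x))) * of_real (ct n x)" for n x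
  have hc: "continuous_on {0..1} (h n)" for n
    unfolding h_def ct_def
    by (intro continuous_intros continuous_on_subset[OF g]) (auto simp: max_def)
  have h01: "h n 0 = h n 1" for n by (simp add: h_def ct_def)
  have ct1: "\<bar>ct n x\<bar> \<le> 1" if "x \<in> {0..1}" for n x
  proof -
    have "0 \<le> min 1 (real n * x)" "min 1 (real n * x) \<le> 1" "0 \<le> min 1 (real n * (1 - x))" "min 1 (real n * (1 - x)) \<le> 1"
      using that by auto
    then have "0 \<le> ct n x" "ct n x \<le> 1 * 1" unfolding ct_def by (intro mult_nonneg_nonneg mult_mono; simp)+
    then show ?thesis by simp
  qed
  have hn: "norm (h n x) \<le> 1" if "x \<in> {0..1}" for n x
  proof -
    have "norm (g n x) / max 1 (norm (g n x)) * \<bar>ct n x\<bar> \<le> 1 * 1"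
      using ct1[OF that] by (intro mult_mono) (auto simp: divide_le_eq)
    then show ?thesis by (simp add: h_def norm_mult norm_divide)
  qed
  have hlim: "(\<lambda>n. h n x) \<longlonglongrightarrow> s x" if x: "x \<notin> N" "0 < x" "x < 1" for x
  proof -
    have gl: "(\<lambda>n. g n x) \<longlonglongrightarrow> s x" using lim[OF x(1)] x by simp
    have big: "\<forall>\<^sub>F n in sequentially. 1 \<le> real n * y" if "0 < y" for y :: real
      using that by real_asymp
    have "\<forall>\<^sub>F n in sequentially. ct n x = 1"
      using big[of x] big[of "1 - x"] x by (auto elim: eventually_elim2 simp: ct_def)
    then have ctl: "(\<lambda>n. ct n x) \<longlonglongrightarrow> 1" by (rule tendsto_eventually)
    have "(\<lambda>n. h n x) \<longlonglongrightarrow> s x / of_real (max 1 (norm (s x))) * of_real 1"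
      unfolding h_def by (intro tendsto_intros gl ctl) (auto simp: max_def)
    moreover have "max 1 (norm (s x)) = 1" using ns[of x] by simp
    ultimately show ?thesis by simp
  qed
  have AEh: "AE x in M01. (\<lambda>n. f x * h n x) \<longlonglongrightarrow> f x * s x"
  proof -
    have "negligible (N \<union> {0, 1})" using N by (simp add: negligible_Un)
    then have "N \<union> {0, 1} \<in> null_sets lebesgue" by (simp add: negligible_iff_null_sets)
    then have "AE x in lebesgue. x \<notin> N \<union> {0, 1}" by (rule AE_not_in)
    then have "AE x in lebesgue. x \<in> {0..1} \<longrightarrow> (\<lambda>n. f x * h n x) \<longlonglongrightarrow> f x * s x"
    proof (rule eventually_mono)
      fix x assume "x \<notin> N \<union> {0, 1}"
      then show "x \<in> {0..1} \<longrightarrow> (\<lambda>n. f x * h n x) \<longlonglongrightarrow> f x * s x"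
        by (intro impI tendsto_mult tendsto_const hlim) (auto simp: less_le)
    qed
    then show ?thesis
      by (subst AE_restrict_space_iff) auto
  qed
  have "(\<lambda>n. \<integral>x. f x * h n x \<partial>M01) \<longlonglongrightarrow> (\<integral>x. f x * s x \<partial>M01)"
  proof (rule integral_dominated_convergence[where w = "\<lambda>x. norm (f x)"])
    show "(\<lambda>x. f x * s x) \<in> borel_measurable M01" using sm by measurable
    show "(\<lambda>x. f x * h n x) \<in> borel_measurable M01" for n
      by (rule borel_measurable_integrable[OF annihilating_integral_continuous(1)[OF f hc h01]])
    show "integrable M01 (\<lambda>x. norm (f x))" using fi by simp
    show "AE x in M01. norm (f x * h n x) \<le> norm (f x)" for n
      using hn by (intro AE_I2) (auto simp: norm_mult mult_left_le)
  qed (rule AEh)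
  moreover have "(\<integral>x. f x * h n x \<partial>M01) = 0" for n
    by (rule annihilating_integral_continuous(2)[OF f hc h01])
  ultimately have "(\<lambda>n. 0) \<longlonglongrightarrow> (\<integral>x. f x * s x \<partial>M01)" by simp
  then have z: "(\<integral>x. f x * s x \<partial>M01) = 0"
    by (simp add: LIMSEQ_const_iff)
  have fs: "f x * s x = of_real ((norm (f x))\<^sup>2 / (1 + norm (f x)))" for x
    using complex_norm_square[of "f x"] by (simp add: s_def)
  have i2: "integrable M01 (\<lambda>x. (norm (f x))\<^sup>2 / (1 + norm (f x)))"
  proof (rule Bochner_Integration.integrable_bound[OF fi])
    show "(\<lambda>x. (norm (f x))\<^sup>2 / (1 + norm (f x))) \<in> borel_measurable M01" by measurable
    show "AE x in M01. norm ((norm (f x))\<^sup>2 / (1 + norm (f x))) \<le> norm (f x)"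
    proof (rule AE_I2)
      fix x
      have "(norm (f x))\<^sup>2 \<le> norm (f x) * (1 + norm (f x))"
        by (simp add: power2_eq_square distrib_left)
      moreover have "0 < 1 + norm (f x)" by (simp add: add_pos_nonneg)
      ultimately show "norm ((norm (f x))\<^sup>2 / (1 + norm (f x))) \<le> norm (f x)"
        by (simp add: pos_divide_le_eq)
    qed
  qed
  have "(\<integral>x. (norm (f x))\<^sup>2 / (1 + norm (f x)) \<partial>M01) = 0"
    using z unfolding fs by (simp only: integral_complex_of_real of_real_eq_0_iff)
  then have "AE x in M01. (norm (f x))\<^sup>2 / (1 + norm (f x)) = 0"
    by (subst (asm) integral_nonneg_eq_0_iff_AE[OF i2]) auto
  then show ?thesis
  proof (rule eventually_mono)
    fix x assume "(norm (f x))\<^sup>2 / (1 + norm (f x)) = 0"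
    moreover have "1 + norm (f x) \<noteq> 0" using norm_ge_zero[of "f x"] by linarith
    ultimately show "f x = 0" by simp
  qed
qed

definition fseries :: "(int \<Rightarrow> complex) \<Rightarrow> real \<Rightarrow> complex" where
  "fseries x t = (\<Sum>\<^sub>\<infinity>k. x k * ee k t)"

lemma uniform_limit_fseries:
  assumes "l1_le C x"
  shows "uniform_limit S (\<lambda>F t. \<Sum>k\<in>F. x k * ee k t) (fseries x) (finite_subsets_at_top UNIV)"
  unfolding fseries_def[abs_def]
  by (rule Weierstrass_m_test_general[OF _ l1_le_summable(1)[OF assms]]) (simp add: norm_mult)

lemma continuous_on_fseries:
  assumes "l1_le C x" shows "continuous_on S (fseries x)"
  by (rule uniform_limit_theorem[OF _ uniform_limit_fseries[OF assms]])
    (auto intro!: always_eventually continuous_intros)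

lemma norm_fseries_le:
  assumes "l1_le C x" shows "norm (fseries x t) \<le> C"
  unfolding fseries_def
  by (rule norm_infsum_le_l1) (use assms in \<open>simp add: l1_le_def norm_mult\<close>)

lemma fourier_fseries_mult:
  assumes x: "l1_le C x" and h: "continuous_on {0..1} h"
  shows "fourier (\<lambda>t. fseries x t * h t) n = conv x (fourier h) n"
proof -
  have "compact (h ` {0..1})" by (intro compact_continuous_image h) simp
  then obtain D where D: "\<And>t. t \<in> {0..1} \<Longrightarrow> norm (h t) \<le> D"
    by (meson bounded_iff compact_imp_bounded imageI)
  have hs: "fseries x t * h t * ee (- n) t = (\<Sum>\<^sub>\<infinity>k. x k * (ee k t * h t * ee (- n) t))" for t
    unfolding fseries_def infsum_cmult_left'[symmetric] by (simp add: mult_ac)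
  have ul: "uniform_limit {0..1} (\<lambda>F t. \<Sum>k\<in>F. x k * (ee k t * h t * ee (- n) t))
      (\<lambda>t. fseries x t * h t * ee (- n) t) (finite_subsets_at_top UNIV)"
    unfolding hs
  proof (rule Weierstrass_m_test_general)
    show "(\<lambda>k. norm (x k) * D) summable_on UNIV"
      by (intro summable_on_cmult_left l1_le_summable(1)[OF x])
  qed (auto simp: norm_mult intro!: mult_left_mono D)
  have ic: "continuous_on {0..1} (\<lambda>t. x k * (ee k t * h t * ee (- n) t))" for k
    by (intro continuous_intros h)
  have "((\<lambda>F. integral {0..1} (\<lambda>t. \<Sum>k\<in>F. x k * (ee k t * h t * ee (- n) t)))
      \<longlongrightarrow> integral {0..1} (\<lambda>t. fseries x t * h t * ee (- n) t)) (finite_subsets_at_top UNIV)"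
  proof -
    obtain I J where I: "\<And>F. ((\<lambda>t. \<Sum>k\<in>F. x k * (ee k t * h t * ee (- n) t)) has_integral I F) {0..1}"
      and J: "((\<lambda>t. fseries x t * h t * ee (- n) t) has_integral J) {0..1}"
      and lim: "(I \<longlongrightarrow> J) (finite_subsets_at_top UNIV)"
    proof (rule uniform_limit_integral[OF ul])
      show "continuous_on {0..1} (\<lambda>t. \<Sum>k\<in>F. x k * (ee k t * h t * ee (- n) t))" for F
        by (intro continuous_on_sum ic)
    qed auto
    then show ?thesis
      using integral_unique[OF I] integral_unique[OF J] by simp
  qed
  also have "(\<lambda>F. integral {0..1} (\<lambda>t. \<Sum>k\<in>F. x k * (ee k t * h t * ee (- n) t)))
      = (\<lambda>F. \<Sum>k\<in>F. x k * fourier h (n - k))"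
  proof
    fix F :: "int set"
    show "integral {0..1} (\<lambda>t. \<Sum>k\<in>F. x k * (ee k t * h t * ee (- n) t)) = (\<Sum>k\<in>F. x k * fourier h (n - k))"
    proof (cases "finite F")
      case True
      have each: "integral {0..1} (\<lambda>t. x k * (ee k t * h t * ee (- n) t)) = x k * fourier h (n - k)" for k
      proof -
        have "ee (- (n - k)) t = ee k t * ee (- n) t" for t
          using ee_add[of k "- n" t] by simp
        then have "(\<lambda>t. x k * (ee k t * h t * ee (- n) t)) = (\<lambda>t. x k * (h t * ee (- (n - k)) t))"
          by (simp add: fun_eq_iff mult_ac)
        then show ?thesis by (simp add: fourier_continuous[OF h])
      qed
      have "integral {0..1} (\<lambda>t. \<Sum>k\<in>F. x k * (ee k t * h t * ee (- n) t))
          = (\<Sum>k\<in>F. integral {0..1} (\<lambda>t. x k * (ee k t * h t * ee (- n) t)))"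
        by (rule integral_sum[OF True]) (intro integrable_continuous_real ic)
      then show ?thesis by (simp only: each)
    qed simp
  qed
  finally have "((\<lambda>F. \<Sum>k\<in>F. x k * fourier h (n - k)) \<longlongrightarrow> fourier (\<lambda>t. fseries x t * h t) n) (finite_subsets_at_top UNIV)"
    by (subst fourier_continuous) (auto intro!: continuous_intros continuous_on_fseries[OF x] h)
  then have "((\<lambda>k. x k * fourier h (n - k)) has_sum fourier (\<lambda>t. fseries x t * h t) n) UNIV"
    by (simp add: has_sum_def)
  then have "fourier (\<lambda>t. fseries x t * h t) n = conv (fourier h) x n"
    unfolding conv_def by (simp add: infsumI mult.commute)
  then show ?thesis by (subst conv_commute)
qed

lemma fourier_fseries:
  assumes "l1_le C x" shows "fourier (fseries x) n = x n"
proof -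
  have "fourier (fseries x) n = conv x (fourier (\<lambda>t. 1)) n"
    using fourier_fseries_mult[OF assms continuous_on_const[of _ 1], of n] by simp
  also have "fourier (\<lambda>t. 1) = delta0" by (rule ext) (rule fourier_one)
  finally show ?thesis by simp
qed

text \<open>
  All Fourier coefficients of the difference vanish. For \<open>N \<ge> 1\<close> this makes every potential equal,
  almost everywhere, to a continuous function, and the operator may be treated classically.
\<close>
lemma AE_eq_fseries:
  assumes f: "integrable M01 f" and l: "l1_le C (fourier f)"
  shows "AE x in M01. f x = fseries (fourier f) x"
proof -
  let ?g = "fseries (fourier f)"
  have g: "integrable M01 ?g"
    by (intro continuous_imp_integrable_real continuous_on_fseries[OF l])
  have "annihilating (\<lambda>x. f x - ?g x)"
    unfolding annihilating_def
  proof (intro conjI allI)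
    show "integrable M01 (\<lambda>x. f x - ?g x)" using f g by simp
    fix k
    have "fourier (\<lambda>x. f x - ?g x) (- k) = 0"
      by (simp add: fourier_diff[OF f g] fourier_fseries[OF l])
    then show "(\<integral>x. (f x - ?g x) * ee k x \<partial>M01) = 0" by (simp add: fourier_eq)
  qed
  then have "AE x in M01. f x - ?g x = 0" by (rule annihilating_imp_AE_zero)
  then show ?thesis by simp
qed

lemma continuous_eq_fseries:
  assumes f: "continuous_on {0..1} f" and l: "l1_le C (fourier f)" and x: "x \<in> {0..1}"
  shows "f x = fseries (fourier f) x"
proof -
  let ?d = "\<lambda>x. norm (f x - fseries (fourier f) x)"
  have c: "continuous_on {0..1} ?d"
    by (intro continuous_intros f continuous_on_fseries[OF l])
  have "AE x in M01. ?d x = 0"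
    using AE_eq_fseries[OF continuous_imp_integrable_real[OF f] l] by simp
  then have "(\<integral>x. ?d x \<partial>M01) = 0"
    by (rule integral_eq_zero_AE)
  then have "integral {0..1} ?d = 0"
    using lebesgue_integral_eq_integral[OF continuous_imp_integrable_real[OF c]] by simp
  then have "?d x = 0"
    using integral_eq_0_iff[OF c] x by simp
  then show ?thesis by simp
qed

section \<open>Classical solutions of the Zakharov--Shabat system\<close>

text \<open>
  Classical solutions of \<open>(L(\<phi>) - z) f = g\<close> on the unit interval, solved for the derivatives, for
  continuous coefficients \<open>p\<close> and \<open>q\<close>. The inhomogeneity \<open>g\<close> is needed for generalized
  eigenfunctions.
\<close>
definition csol :: "(real \<Rightarrow> complex) \<Rightarrow> (real \<Rightarrow> complex) \<Rightarrow> complex \<Rightarrow> (real \<Rightarrow> complex) \<Rightarrow> (real \<Rightarrow> complex)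
    \<Rightarrow> (real \<Rightarrow> complex) \<Rightarrow> (real \<Rightarrow> complex) \<Rightarrow> bool" where
  "csol p q z g1 g2 f1 f2 \<longleftrightarrow> (\<forall>x\<in>{0..1}.
     (f1 has_vector_derivative - \<i> * (z * f1 x + g1 x - p x * f2 x)) (at x within {0..1}) \<and>
     (f2 has_vector_derivative \<i> * (z * f2 x + g2 x - q x * f1 x)) (at x within {0..1}))"

lemma csol_continuous:
  assumes "csol p q z g1 g2 f1 f2"
  shows "continuous_on {0..1} f1" "continuous_on {0..1} f2"
  unfolding continuous_on_eq_continuous_within
  using assms unfolding csol_def by (auto intro: has_vector_derivative_continuous)

definition vec2 :: "complex \<Rightarrow> complex \<Rightarrow> complex^2" where
  "vec2 a b = (\<chi> i. if i = 1 then a else b)"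

lemma vec2_nth [simp]: "vec2 a b $ 1 = a" "vec2 a b $ 2 = b"
  by (simp_all add: vec2_def)

lemma vec2_eq_iff: "(v::complex^2) = w \<longleftrightarrow> v $ 1 = w $ 1 \<and> v $ 2 = w $ 2"
  by (auto simp: vec_eq_iff forall_2)

lemma bounded_linear_vec2: "bounded_linear (\<lambda>p. vec2 (fst p) (snd p))"
  unfolding linear_conv_bounded_linear[symmetric]
  by (intro linearI) (auto simp: vec2_eq_iff)

lemma has_vector_derivative_vec2:
  assumes "(f has_vector_derivative f') (at x within S)" "(g has_vector_derivative g') (at x within S)"
  shows "((\<lambda>x. vec2 (f x) (g x)) has_vector_derivative vec2 f' g') (at x within S)"
  using bounded_linear.has_vector_derivative[OF bounded_linear_vec2 has_vector_derivative_Pair[OF assms]]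
  by simp

lemma continuous_on_vec2:
  assumes "continuous_on S f" "continuous_on S g"
  shows "continuous_on S (\<lambda>x. vec2 (f x) (g x))"
  using bounded_linear.continuous_on[OF bounded_linear_vec2 continuous_on_Pair[OF assms]] by simp

lemma L2_01_integrable:
  fixes f :: "real \<Rightarrow> 'a::euclidean_space"
  assumes "f \<in> L2_01" shows "integrable M01 f"
proof -
  have f: "f \<in> borel_measurable M01" and i: "integrable M01 (\<lambda>x. (norm (f x))\<^sup>2)"
    using assms by (auto simp: L2_01_def)
  have "integrable M01 (\<lambda>x. 1 + (norm (f x))\<^sup>2)"
    using i continuous_imp_integrable_real[of 0 1 "\<lambda>x. 1 :: real"]
    by (intro Bochner_Integration.integrable_add) auto
  then show ?thesis
  proof (rule Bochner_Integration.integrable_bound[OF _ f])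
    show "AE x in M01. norm (f x) \<le> norm (1 + (norm (f x))\<^sup>2)"
    proof (rule AE_I2)
      fix x
      have "0 \<le> (norm (f x) - 1)\<^sup>2 + norm (f x)" by simp
      then have "norm (f x) \<le> 1 + (norm (f x))\<^sup>2" by (simp add: power2_eq_square algebra_simps)
      then show "norm (f x) \<le> norm (1 + (norm (f x))\<^sup>2)" by simp
    qed
  qed
qed

lemma continuous_L2_01:
  fixes f :: "real \<Rightarrow> 'a::euclidean_space"
  assumes "continuous_on {0..1} f" shows "f \<in> L2_01"
  unfolding L2_01_def
  using borel_measurable_integrable[OF continuous_imp_integrable_real[OF assms]]
  by (auto intro!: continuous_imp_integrable_real continuous_intros assms)

lemma zs_components:
  "zs_principal *v D + zs_potential \<phi> x *v F = G \<longleftrightarrow>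
     D $ 1 = - \<i> * (G $ 1 - fst \<phi> x * F $ 2) \<and> D $ 2 = \<i> * (G $ 2 - snd \<phi> x * F $ 1)"
proof -
  have "zs_principal *v D + zs_potential \<phi> x *v F = G \<longleftrightarrow>
     \<i> * D $ 1 + fst \<phi> x * F $ 2 = G $ 1 \<and> - \<i> * D $ 2 + snd \<phi> x * F $ 1 = G $ 2"
    by (simp add: vec2_eq_iff matrix_vector_mult_def sum_2 zs_principal_def zs_potential_def vector_2)
  also have "\<i> * D $ 1 + fst \<phi> x * F $ 2 = G $ 1 \<longleftrightarrow> D $ 1 = - \<i> * (G $ 1 - fst \<phi> x * F $ 2)"
    by (auto simp: complex_eq_iff)
  also have "- \<i> * D $ 2 + snd \<phi> x * F $ 1 = G $ 2 \<longleftrightarrow> D $ 2 = \<i> * (G $ 2 - snd \<phi> x * F $ 1)"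
    by (auto simp: complex_eq_iff)
  finally show ?thesis .
qed

lemma AE_M01_integral_cong:
  fixes f g :: "real \<Rightarrow> 'a::euclidean_space"
  assumes "AE x in M01. f x = g x" "x \<in> {0..1}"
  shows "integral {0..x} f = integral {0..x} g"
proof -
  have "AE y in lebesgue. y \<in> {0..1} \<longrightarrow> f y = g y"
    using assms(1) by (subst (asm) AE_restrict_space_iff) auto
  then obtain N where N: "N \<in> null_sets lebesgue" "{y. \<not> (y \<in> {0..1} \<longrightarrow> f y = g y)} \<subseteq> N"
    by (auto elim!: AE_E2 simp: null_sets_def eventually_ae_filter)
  show ?thesis
    by (rule integral_spike[of N]) (use N assms(2) in \<open>auto simp: negligible_iff_null_sets\<close>)
qed

text \<open>
  Changing the potential on a null set does not change the integral equation for \<open>F\<close>. With continuous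
  coefficients its right-hand side is continuously differentiable.
\<close>
lemma zs_imp_csol:
  assumes zs: "zs \<phi> F (\<lambda>x. z *s F x + G x)"
    and G: "continuous_on {0..1} (\<lambda>x. G x $ 1)" "continuous_on {0..1} (\<lambda>x. G x $ 2)"
    and pq: "continuous_on {0..1} p" "continuous_on {0..1} q"
    and AEp: "AE x in M01. fst \<phi> x = p x" and AEq: "AE x in M01. snd \<phi> x = q x"
  shows "csol p q z (\<lambda>x. G x $ 1) (\<lambda>x. G x $ 2) (\<lambda>x. F x $ 1) (\<lambda>x. F x $ 2)"
proof -
  obtain D where D: "D \<in> L2_01" and F: "\<And>x. x \<in> {0..1} \<Longrightarrow> F x = F 0 + integral {0..x} D"
    and eq: "AE x in M01. zs_principal *v D x + zs_potential \<phi> x *v F x = z *s F x + G x"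
    using zs unfolding zs_def has_H1_deriv_def by blast
  have "D integrable_on {0..1}"
    by (rule integrable_on_lebesgue_on[OF L2_01_integrable[OF D]]) simp
  then have "continuous_on {0..1} (\<lambda>x. F 0 + integral {0..x} D)"
    by (intro continuous_intros indefinite_integral_continuous_1)
  then have Fc: "continuous_on {0..1} F"
    by (rule continuous_on_eq) (rule F[symmetric])
  have Fi: "continuous_on {0..1} (\<lambda>x. F x $ i)" for i
    by (intro continuous_intros Fc)
  define E where "E x = vec2 (- \<i> * (z * F x $ 1 + G x $ 1 - p x * F x $ 2)) (\<i> * (z * F x $ 2 + G x $ 2 - q x * F x $ 1))" for x
  have Ec: "continuous_on {0..1} E"
    unfolding E_def by (intro continuous_on_vec2 continuous_intros Fi G pq)
  have DE: "AE x in M01. D x = E x"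
    using eq AEp AEq
    by eventually_elim (drule zs_components[THEN iffD1], simp add: E_def vec2_eq_iff)
  have FE: "F x = F 0 + integral {0..x} E" if "x \<in> {0..1}" for x
    using F[OF that] AE_M01_integral_cong[OF DE that] by simp
  have der: "(F has_vector_derivative E x) (at x within {0..1})" if "x \<in> {0..1}" for x
  proof -
    have "((\<lambda>x. F 0 + integral {0..x} E) has_vector_derivative 0 + E x) (at x within {0..1})"
      by (intro has_vector_derivative_add has_vector_derivative_const integral_has_vector_derivative Ec that)
    then have "((\<lambda>x. F 0 + integral {0..x} E) has_vector_derivative E x) (at x within {0..1})"
      by simp
    then show ?thesis
      by (rule has_vector_derivative_transform[OF that, rotated]) (rule FE)
  qed
  show ?thesis
    unfolding csol_def
  proof (intro ballI conjI)
    fix x :: real assume x: "x \<in> {0..1}"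
    show "((\<lambda>x. F x $ 1) has_vector_derivative - \<i> * (z * F x $ 1 + G x $ 1 - p x * F x $ 2)) (at x within {0..1})"
      using bounded_linear.has_vector_derivative[OF bounded_linear_vec_nth der[OF x], of 1] by (simp add: E_def)
    show "((\<lambda>x. F x $ 2) has_vector_derivative \<i> * (z * F x $ 2 + G x $ 2 - q x * F x $ 1)) (at x within {0..1})"
      using bounded_linear.has_vector_derivative[OF bounded_linear_vec_nth der[OF x], of 2] by (simp add: E_def)
  qed
qed

lemma csol_imp_zs:
  assumes c: "csol p q z g1 g2 f1 f2"
    and g: "continuous_on {0..1} g1" "continuous_on {0..1} g2"
    and pq: "continuous_on {0..1} p" "continuous_on {0..1} q"
    and AEp: "AE x in M01. fst \<phi> x = p x" and AEq: "AE x in M01. snd \<phi> x = q x"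
    and F: "\<And>x. x \<in> {0..1} \<Longrightarrow> F x = vec2 (f1 x) (f2 x)"
    and G: "\<And>x. x \<in> {0..1} \<Longrightarrow> G x = z *s F x + vec2 (g1 x) (g2 x)"
  shows "zs \<phi> F G" "\<exists>D. has_H1_deriv F D"
proof -
  define E where "E x = vec2 (- \<i> * (z * f1 x + g1 x - p x * f2 x)) (\<i> * (z * f2 x + g2 x - q x * f1 x))" for x
  have Ec: "continuous_on {0..1} E"
    unfolding E_def by (intro continuous_on_vec2 continuous_intros csol_continuous[OF c] g pq)
  have der: "((\<lambda>x. vec2 (f1 x) (f2 x)) has_vector_derivative E x) (at x within {0..1})" if "x \<in> {0..1}" for x
    unfolding E_def using c that unfolding csol_def by (intro has_vector_derivative_vec2) auto
  have H1: "has_H1_deriv F E"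
    unfolding has_H1_deriv_def
  proof (intro conjI ballI)
    show "E \<in> L2_01" by (rule continuous_L2_01[OF Ec])
    fix x :: real assume x: "x \<in> {0..1}"
    have "(E has_integral (vec2 (f1 x) (f2 x) - vec2 (f1 0) (f2 0))) {0..x}"
    proof (rule fundamental_theorem_of_calculus)
      show "0 \<le> x" using x by simp
      show "((\<lambda>x. vec2 (f1 x) (f2 x)) has_vector_derivative E y) (at y within {0..x})" if "y \<in> {0..x}" for y
        using der[of y] that x by (auto intro: has_vector_derivative_within_subset)
    qed
    then have "integral {0..x} E = F x - F 0"
      using x by (simp add: F integral_unique)
    then show "F x = F 0 + integral {0..x} E" by simp
  qed
  have "AE x in M01. x \<in> {0..1}" by (rule AE_I2) simp
  with AEp AEq have "AE x in M01. zs_principal *v E x + zs_potential \<phi> x *v F x = G x"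
    by eventually_elim (rule zs_components[THEN iffD2], simp add: E_def F G)
  then show "zs \<phi> F G" "\<exists>D. has_H1_deriv F D"
    using H1 unfolding zs_def by blast+
qed

text \<open>
  Gronwall's argument: \<open>exp (c x) |f(x)|\<^sup>2\<close> decreases for \<open>c = - 2K\<close> and increases for \<open>c = 2K\<close>. The first
  choice is for a zero at the left end, the second one for a zero at the right end.
\<close>
lemma linear_ode_zero:
  fixes f :: "real \<Rightarrow> 'a::real_inner"
  assumes der: "\<And>x. x \<in> {0..1} \<Longrightarrow> (f has_vector_derivative f' x) (at x within {0..1})"
    and K: "\<And>x. x \<in> {0..1} \<Longrightarrow> norm (f' x) \<le> K * norm (f x)"
    and z: "f 0 = 0 \<or> f 1 = 0" and x: "x \<in> {0..1}"
  shows "f x = 0"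
proof -
  define h where "h c x = exp (c * x) * (f x \<bullet> f x)" for c x
  have dh: "(h c has_vector_derivative exp (c * y) * (c * (f y \<bullet> f y) + 2 * (f y \<bullet> f' y))) (at y within {0..1})"
    if "y \<in> {0..1}" for c y
  proof -
    have "(f has_derivative (\<lambda>t. t *\<^sub>R f' y)) (at y within {0..1})"
      using der[OF that] by (simp add: has_vector_derivative_def)
    then show ?thesis
      unfolding h_def has_vector_derivative_def
      by (auto intro!: derivative_eq_intros simp: algebra_simps inner_commute)
  qed
  have bd: "\<bar>2 * (f y \<bullet> f' y)\<bar> \<le> 2 * K * (f y \<bullet> f y)" if "y \<in> {0..1}" for y
  proof -
    have "\<bar>f y \<bullet> f' y\<bar> \<le> norm (f y) * norm (f' y)" by (rule Cauchy_Schwarz_ineq2)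
    also have "\<dots> \<le> norm (f y) * (K * norm (f y))" by (intro mult_left_mono K that) simp
    also have "\<dots> = K * (f y \<bullet> f y)" by (simp add: dot_square_norm power2_eq_square)
    finally show ?thesis by simp
  qed
  have "h c x = 0" if c: "f 0 = 0 \<and> c = - 2 * K \<or> f 1 = 0 \<and> c = 2 * K" for c
    using c
  proof
    assume c: "f 0 = 0 \<and> c = - 2 * K"
    have "((\<lambda>y. exp (c * y) * (c * (f y \<bullet> f y) + 2 * (f y \<bullet> f' y))) has_integral (h c x - h c 0)) {0..x}"
      using x by (intro fundamental_theorem_of_calculus) (auto intro!: has_vector_derivative_within_subset[OF dh])
    then have "h c x - h c 0 \<le> 0"
    proof (rule has_integral_le[OF _ has_integral_0])
      fix y assume "y \<in> {0..x}"
      then have "c * (f y \<bullet> f y) + 2 * (f y \<bullet> f' y) \<le> 0"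
        using bd[of y] x c by (simp add: abs_le_iff)
      then show "exp (c * y) * (c * (f y \<bullet> f y) + 2 * (f y \<bullet> f' y)) \<le> 0"
        by (simp add: mult_le_0_iff)
    qed
    moreover have "h c 0 = 0" using c by (simp add: h_def)
    moreover have "0 \<le> h c x" by (simp add: h_def)
    ultimately show ?thesis by simp
  next
    assume c: "f 1 = 0 \<and> c = 2 * K"
    have "((\<lambda>y. exp (c * y) * (c * (f y \<bullet> f y) + 2 * (f y \<bullet> f' y))) has_integral (h c 1 - h c x)) {x..1}"
      using x by (intro fundamental_theorem_of_calculus) (auto intro!: has_vector_derivative_within_subset[OF dh])
    then have "0 \<le> h c 1 - h c x"
    proof (rule has_integral_nonneg)
      fix y assume "y \<in> {x..1}"
      then have "0 \<le> c * (f y \<bullet> f y) + 2 * (f y \<bullet> f' y)"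
        using bd[of y] x c by (simp add: abs_le_iff)
      then show "0 \<le> exp (c * y) * (c * (f y \<bullet> f y) + 2 * (f y \<bullet> f' y))"
        by simp
    qed
    moreover have "h c 1 = 0" using c by (simp add: h_def)
    moreover have "0 \<le> h c x" by (simp add: h_def)
    ultimately show ?thesis by simp
  qed
  then have "\<exists>c. h c x = 0" using z by blast
  then show ?thesis by (auto simp: h_def)
qed

lemma csol_unique:
  assumes c: "csol p q z (\<lambda>x. 0) (\<lambda>x. 0) f1 f2"
    and p: "\<And>x. x \<in> {0..1} \<Longrightarrow> norm (p x) \<le> C" and q: "\<And>x. x \<in> {0..1} \<Longrightarrow> norm (q x) \<le> C"
    and z: "f1 0 = 0 \<and> f2 0 = 0 \<or> f1 1 = 0 \<and> f2 1 = 0" and x: "x \<in> {0..1}"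
  shows "f1 x = 0 \<and> f2 x = 0"
proof -
  let ?f = "\<lambda>x. (f1 x, f2 x)"
  let ?f' = "\<lambda>x. (- \<i> * (z * f1 x + 0 - p x * f2 x), \<i> * (z * f2 x + 0 - q x * f1 x))"
  have "?f x = 0"
  proof (rule linear_ode_zero[where f = ?f and x = x and f' = ?f' and K = "2 * (norm z + C)"])
    show "(?f has_vector_derivative ?f' y) (at y within {0..1})" if "y \<in> {0..1}" for y
      using c that unfolding csol_def by (intro has_vector_derivative_Pair) auto
    fix y :: real assume y: "y \<in> {0..1}"
    have 1: "norm (f1 y) \<le> norm (?f y)" "norm (f2 y) \<le> norm (?f y)"
      using norm_fst_le[of "f1 y" "f2 y"] norm_snd_le[of "f2 y" "f1 y"] by auto
    have t: "norm (z * a - r * b) \<le> (norm z + C) * norm (?f y)"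
      if "norm a \<le> norm (?f y)" "norm b \<le> norm (?f y)" "norm r \<le> C" for a b r
    proof -
      have "norm (z * a - r * b) \<le> norm z * norm a + norm r * norm b"
        by (rule order_trans[OF norm_triangle_ineq4]) (simp add: norm_mult)
      also have "\<dots> \<le> norm z * norm (?f y) + C * norm (?f y)"
        using that norm_ge_zero[of r] by (intro add_mono mult_mono) (auto intro: order_trans[OF norm_ge_zero])
      finally show ?thesis by (simp add: algebra_simps)
    qed
    have "norm (?f' y) \<le> norm (- \<i> * (z * f1 y + 0 - p y * f2 y)) + norm (\<i> * (z * f2 y + 0 - q y * f1 y))"
      by (rule norm_Pair_le)
    also have "\<dots> = norm (z * f1 y - p y * f2 y) + norm (z * f2 y - q y * f1 y)"
      by (simp add: norm_mult)
    also have "\<dots> \<le> (norm z + C) * norm (?f y) + (norm z + C) * norm (?f y)"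
      by (intro add_mono t 1 p q y)
    finally show "norm (?f' y) \<le> 2 * (norm z + C) * norm (?f y)" by (simp add: algebra_simps)
  next
    show "?f 0 = 0 \<or> ?f 1 = 0" using z by (auto simp: zero_prod_def)
  qed (rule x)
  then show ?thesis by (simp add: zero_prod_def)
qed

text \<open>
  \<open>L(\<phi>)\<close> is symmetric for the bilinear pairing \<open>\<integral> F\<^sub>1H\<^sub>2 + F\<^sub>2H\<^sub>1\<close>. The integrand is the derivative of
  the Wronskian up to a factor, and the boundary conditions make the Wronskian vanish at both ends. No complex
  conjugation is involved, so this is true for complex potentials as well.
\<close>
lemma csol_pairing:
  assumes f: "csol p q z g1 g2 f1 f2" and h: "csol p q y (\<lambda>x. 0) (\<lambda>x. 0) h1 h2"
    and bc: "f1 0 = f2 0" "f1 1 = f2 1" "h1 0 = h2 0" "h1 1 = h2 1"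
  shows "((\<lambda>x. (y - z) * (f1 x * h2 x + f2 x * h1 x) - (g1 x * h2 x + g2 x * h1 x)) has_integral 0) {0..1}"
proof -
  let ?W = "\<lambda>x. - \<i> * (f1 x * h2 x - f2 x * h1 x)"
  have "((\<lambda>x. (y - z) * (f1 x * h2 x + f2 x * h1 x) - (g1 x * h2 x + g2 x * h1 x)) has_integral (?W 1 - ?W 0)) {0..1}"
  proof (rule fundamental_theorem_of_calculus)
    fix x :: real assume x: "x \<in> {0..1}"
    have d: "(f1 has_vector_derivative - \<i> * (z * f1 x + g1 x - p x * f2 x)) (at x within {0..1})"
      "(f2 has_vector_derivative \<i> * (z * f2 x + g2 x - q x * f1 x)) (at x within {0..1})"
      "(h1 has_vector_derivative - \<i> * (y * h1 x + 0 - p x * h2 x)) (at x within {0..1})"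
      "(h2 has_vector_derivative \<i> * (y * h2 x + 0 - q x * h1 x)) (at x within {0..1})"
      using f h x unfolding csol_def by auto
    have "(?W has_vector_derivative - \<i> * ((f1 x * (\<i> * (y * h2 x + 0 - q x * h1 x)) + - \<i> * (z * f1 x + g1 x - p x * f2 x) * h2 x)
       - (f2 x * (- \<i> * (y * h1 x + 0 - p x * h2 x)) + \<i> * (z * f2 x + g2 x - q x * f1 x) * h1 x))) (at x within {0..1})"
      by (intro has_vector_derivative_mult_right has_vector_derivative_diff has_vector_derivative_mult d)
    moreover have "- \<i> * ((f1 x * (\<i> * (y * h2 x + 0 - q x * h1 x)) + - \<i> * (z * f1 x + g1 x - p x * f2 x) * h2 x)
       - (f2 x * (- \<i> * (y * h1 x + 0 - p x * h2 x)) + \<i> * (z * f2 x + g2 x - q x * f1 x) * h1 x))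
       = (y - z) * (f1 x * h2 x + f2 x * h1 x) - (g1 x * h2 x + g2 x * h1 x)"
      by (simp add: algebra_simps)
    ultimately show "(?W has_vector_derivative (y - z) * (f1 x * h2 x + f2 x * h1 x) - (g1 x * h2 x + g2 x * h1 x)) (at x within {0..1})"
      by simp
  qed simp
  then show ?thesis using bc by simp
qed

section \<open>Dirichlet eigenfunctions as Floquet solutions\<close>

lemma exp_pi_i_int: "exp (\<i> * of_real pi * of_int m) = (-1) powi m"
proof -
  have "exp (\<i> * of_real pi * of_int m) = exp (\<i> * of_real pi) powi m"
    unfolding exp_power_int by (simp add: mult_ac)
  then show ?thesis by simp
qed

lemma continuous_01_bounded:
  fixes f :: "real \<Rightarrow> complex"
  assumes "continuous_on {0..1} f"
  obtains C where "\<And>x. x \<in> {0..1} \<Longrightarrow> norm (f x) \<le> C"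
proof -
  have "compact (f ` {0..1})" by (rule compact_continuous_image[OF assms]) simp
  then show ?thesis using that by (meson bounded_iff compact_imp_bounded imageI)
qed

lemma fourier_derivative:
  assumes der: "\<And>x. x \<in> {0..1} \<Longrightarrow> (f has_vector_derivative f' x) (at x within {0..1})"
    and f': "continuous_on {0..1} f'" and per: "f 0 = f 1"
  shows "fourier f' k = 2 * of_real pi * \<i> * of_int k * fourier f k"
proof -
  have f: "continuous_on {0..1} f"
    unfolding continuous_on_eq_continuous_within by (meson der has_vector_derivative_continuous)
  let ?c = "2 * of_real pi * \<i> * of_int (- k) :: complex"
  have "((\<lambda>x. f x * (?c * ee (- k) x) + f' x * ee (- k) x) has_integral (f 1 * ee (- k) 1 - f 0 * ee (- k) 0)) {0..1}"
    by (intro fundamental_theorem_of_calculus has_vector_derivative_mult der has_vector_derivative_ee) auto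
  then have "((\<lambda>x. ?c * (f x * ee (- k) x) + f' x * ee (- k) x) has_integral 0) {0..1}"
    using per by (simp add: mult_ac)
  then have "integral {0..1} (\<lambda>x. ?c * (f x * ee (- k) x) + f' x * ee (- k) x) = 0"
    by (rule integral_unique)
  also have "integral {0..1} (\<lambda>x. ?c * (f x * ee (- k) x) + f' x * ee (- k) x)
      = integral {0..1} (\<lambda>x. ?c * (f x * ee (- k) x)) + integral {0..1} (\<lambda>x. f' x * ee (- k) x)"
    by (intro integral_add integrable_continuous_real continuous_intros f f')
  finally show ?thesis
    by (simp add: fourier_continuous f f')
qed

lemma fourier_linear:
  assumes "continuous_on {0..1} f" "continuous_on {0..1} g"
  shows "fourier (\<lambda>x. c * f x + d * g x) k = c * fourier f k + d * fourier g k"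
proof -
  have "integral {0..1} (\<lambda>x. (c * f x + d * g x) * ee (- k) x)
      = integral {0..1} (\<lambda>x. c * (f x * ee (- k) x) + d * (g x * ee (- k) x))"
    by (simp add: algebra_simps)
  also have "\<dots> = integral {0..1} (\<lambda>x. c * (f x * ee (- k) x)) + integral {0..1} (\<lambda>x. d * (g x * ee (- k) x))"
    by (intro integral_add integrable_continuous_real continuous_intros assms)
  finally show ?thesis
    using assms by (simp add: fourier_continuous continuous_intros)
qed

lemma fourier_shift:
  assumes "continuous_on {0..1} f"
  shows "fourier (\<lambda>x. ee n x * f x) k = fourier f (k - n)"
proof -
  have "(\<lambda>x. ee n x * f x * ee (- k) x) = (\<lambda>x. f x * ee (- (k - n)) x)"
    using ee_add[of n "- k"] by (auto simp: fun_eq_iff)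
  moreover have "continuous_on {0..1} (\<lambda>x. ee n x * f x)"
    by (intro continuous_intros assms)
  ultimately show ?thesis
    using assms by (simp only: fourier_continuous)
qed

text \<open>
  The exponential factors turn a solution with the boundary values \<open>(c, c)\<close> and \<open>(c', c')\<close> into
  periodic functions \<open>u\<close> and \<open>v\<close>: \<open>exp \<tau>\<close> is the multiplier \<open>c'/c\<close> up to the sign that the factors
  \<open>exp (\<plusminus> \<i>\<pi>n)\<close> contribute at \<open>x = 1\<close>. The differences of the two exponents shift frequencies by \<open>n\<close>, and
  after reversing the index of the second component both convolutions are evaluated at \<open>n - k\<close>.
\<close>
lemma floquet_hankel_system:
  fixes p q :: "int \<Rightarrow> complex" and n :: int and \<tau> z c c' :: complex
  defines "u \<equiv> \<lambda>f1 x. exp ((\<i> * of_real pi * of_int n - \<tau>) * of_real x) * f1 x"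
    and "v \<equiv> \<lambda>f2 x. exp ((- \<i> * of_real pi * of_int n - \<tau>) * of_real x) * f2 x"
  assumes p: "l1_le C p" and q: "l1_le C q"
    and sol: "csol (fseries p) (fseries q) z (\<lambda>x. 0) (\<lambda>x. 0) f1 f2"
    and bc: "f1 0 = c" "f2 0 = c" "f1 1 = c'" "f2 1 = c'"
    and \<tau>: "exp \<tau> * c = (-1) powi n * c'"
  shows "u f1 0 = c" "v f2 0 = c" "continuous_on {0..1} (u f1)" "continuous_on {0..1} (v f2)"
    "hankel_system n (z - of_real pi * of_int n - \<i> * \<tau>) (z - of_real pi * of_int n + \<i> * \<tau>)
       (\<lambda>m. p (- m)) q (fourier (u f1)) (\<lambda>k. fourier (v f2) (- k))"
proof -
  let ?a = "\<i> * of_real pi * of_int n - \<tau>" and ?b = "- \<i> * of_real pi * of_int n - \<tau>"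
  let ?u = "u f1" and ?v = "v f2"
  have fc: "continuous_on {0..1} f1" "continuous_on {0..1} f2" by (rule csol_continuous[OF sol])+
  show u0: "?u 0 = c" and v0: "?v 0 = c" using bc by (simp_all add: u_def v_def)
  show uc: "continuous_on {0..1} ?u" and vc: "continuous_on {0..1} ?v"
    unfolding u_def v_def by (intro continuous_intros fc)+
  have pm: "(-1::complex) powi n * (-1) powi n = 1"
    by (simp add: power_int_mult_distrib[symmetric])
  have e1: "exp ?a * c' = c"
  proof -
    have "exp ?a * c' = exp (- \<tau>) * ((-1) powi n * c')"
      unfolding exp_pi_i_int[symmetric] by (simp add: exp_diff exp_minus field_simps)
    also have "\<dots> = exp (- \<tau>) * exp \<tau> * c" by (simp only: \<tau>[symmetric] mult.assoc)
    finally show ?thesis by (simp add: exp_add[symmetric])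
  qed
  have e2: "exp ?b * c' = c"
  proof -
    have "exp ?b = exp ?a * exp (\<i> * of_real pi * of_int (- 2 * n))"
      unfolding mult_exp_exp by (rule arg_cong[where f = exp]) (simp add: algebra_simps)
    also have "exp (\<i> * of_real pi * of_int (- 2 * n)) = 1"
      unfolding exp_pi_i_int by (simp add: power_int_mult)
    finally show ?thesis using e1 by simp
  qed
  have uper: "?u 0 = ?u 1" and vper: "?v 0 = ?v 1"
    using u0 v0 e1 e2 bc by (simp_all add: u_def v_def)
  have ea: "((\<lambda>x. exp (a * of_real x)) has_vector_derivative a * exp (a * of_real x)) (at x within S)" for a :: complex and x S
    by (rule has_vector_derivative_real_field) (auto intro!: derivative_eq_intros)
  have ex: "exp (?a * of_real x) = ee n x * exp (?b * of_real x)" for x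
    unfolding ee_def mult_exp_exp by (rule arg_cong[where f = exp]) (simp add: algebra_simps)
  have ex': "exp (?b * of_real x) = ee (- n) x * exp (?a * of_real x)" for x
    unfolding ee_def mult_exp_exp by (rule arg_cong[where f = exp]) (simp add: algebra_simps)
  define U where "U x = fseries p x * (ee n x * ?v x)" for x
  define V where "V x = fseries q x * (ee (- n) x * ?u x)" for x
  have Uc: "continuous_on {0..1} U" and Vc: "continuous_on {0..1} V"
    unfolding U_def V_def by (intro continuous_intros continuous_on_fseries[OF p] continuous_on_fseries[OF q] uc vc)+
  have du: "(?u has_vector_derivative (?a - \<i> * z) * ?u x + \<i> * U x) (at x within {0..1})" if x: "x \<in> {0..1}" for x
  proof -
    have f: "(f1 has_vector_derivative - \<i> * (z * f1 x + 0 - fseries p x * f2 x)) (at x within {0..1})"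
      using sol x unfolding csol_def by auto
    have "(?u has_vector_derivative exp (?a * of_real x) * (- \<i> * (z * f1 x + 0 - fseries p x * f2 x)) + ?a * exp (?a * of_real x) * f1 x) (at x within {0..1})"
      unfolding u_def by (intro has_vector_derivative_mult f ea)
    moreover have "exp (?a * of_real x) * (\<i> * (fseries p x * f2 x)) = \<i> * U x"
      by (subst ex) (simp add: U_def v_def mult_ac)
    then have "exp (?a * of_real x) * (- \<i> * (z * f1 x + 0 - fseries p x * f2 x)) + ?a * exp (?a * of_real x) * f1 x = (?a - \<i> * z) * ?u x + \<i> * U x"
      unfolding u_def by (simp add: algebra_simps)
    ultimately show ?thesis by (simp only:)
  qed
  have dv: "(?v has_vector_derivative (?b + \<i> * z) * ?v x + (- \<i>) * V x) (at x within {0..1})" if x: "x \<in> {0..1}" for x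
  proof -
    have f: "(f2 has_vector_derivative \<i> * (z * f2 x + 0 - fseries q x * f1 x)) (at x within {0..1})"
      using sol x unfolding csol_def by auto
    have "(?v has_vector_derivative exp (?b * of_real x) * (\<i> * (z * f2 x + 0 - fseries q x * f1 x)) + ?b * exp (?b * of_real x) * f2 x) (at x within {0..1})"
      unfolding v_def by (intro has_vector_derivative_mult f ea)
    moreover have "exp (?b * of_real x) * (\<i> * (fseries q x * f1 x)) = \<i> * V x"
      by (subst ex') (simp add: V_def u_def mult_ac)
    then have "exp (?b * of_real x) * (\<i> * (z * f2 x + 0 - fseries q x * f1 x)) + ?b * exp (?b * of_real x) * f2 x = (?b + \<i> * z) * ?v x + (- \<i>) * V x"
      unfolding v_def by (simp add: algebra_simps)
    ultimately show ?thesis by (simp only:)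
  qed
  have Uk: "fourier U k = conv (\<lambda>m. p (- m)) (\<lambda>k. fourier ?v (- k)) (n - k)" for k
  proof -
    have "fourier U k = conv p (fourier (\<lambda>x. ee n x * ?v x)) k"
      unfolding U_def by (rule fourier_fseries_mult[OF p]) (intro continuous_intros vc)
    also have "fourier (\<lambda>x. ee n x * ?v x) = (\<lambda>j. fourier ?v (j - n))"
      by (rule ext) (rule fourier_shift[OF vc])
    also have "conv p (\<lambda>j. fourier ?v (j - n)) k = conv (\<lambda>m. p (- m)) (\<lambda>k. fourier ?v (- k)) (n - k)"
      unfolding conv_def
      by (rule infsum_reindex_bij_witness[of _ "\<lambda>j. n - j" "\<lambda>j. n - j"]) (auto simp: algebra_simps)
    finally show ?thesis .
  qed
  have Vk: "fourier V (- k) = conv q (fourier ?u) (n - k)" for k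
  proof -
    have "fourier V (- k) = conv q (fourier (\<lambda>x. ee (- n) x * ?u x)) (- k)"
      unfolding V_def by (rule fourier_fseries_mult[OF q]) (intro continuous_intros uc)
    also have "fourier (\<lambda>x. ee (- n) x * ?u x) = (\<lambda>j. fourier ?u (j - (- n)))"
      by (rule ext) (rule fourier_shift[OF uc])
    also have "conv q (\<lambda>j. fourier ?u (j - (- n))) (- k) = conv q (fourier ?u) (n - k)"
      unfolding conv_def
    proof (rule infsum_reindex_bij_witness[of _ "\<lambda>j. j - n" "\<lambda>j. j + n"])
      fix j
      have "n - k - (j + n) = - k - j" "j - - n = j + n" by simp_all
      then show "q (n - k - (j + n)) * fourier ?u (j + n) = q (- k - j) * fourier ?u (j - - n)"
        by (simp only:)
    qed auto
    finally show ?thesis .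
  qed
  show "hankel_system n (z - of_real pi * of_int n - \<i> * \<tau>) (z - of_real pi * of_int n + \<i> * \<tau>)
       (\<lambda>m. p (- m)) q (fourier ?u) (\<lambda>k. fourier ?v (- k))"
    unfolding hankel_system_def
  proof (intro conjI allI)
    fix k
    have "2 * of_real pi * \<i> * of_int k * fourier ?u k = fourier (\<lambda>x. (?a - \<i> * z) * ?u x + \<i> * U x) k"
      by (rule fourier_derivative[symmetric, OF du]) (auto intro!: continuous_intros uc Uc uper)
    also have "\<dots> = (?a - \<i> * z) * fourier ?u k + \<i> * fourier U k"
      by (rule fourier_linear[OF uc Uc])
    finally have "\<i> * fourier U k = \<i> * ((z - of_real pi * of_int n - \<i> * \<tau> + 2 * of_real pi * of_int k) * fourier ?u k)"
      by (simp add: algebra_simps)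
    then show "(z - of_real pi * of_int n - \<i> * \<tau> + 2 * of_real pi * of_int k) * fourier ?u k
        = conv (\<lambda>m. p (- m)) (\<lambda>k. fourier ?v (- k)) (n - k)"
      by (simp add: Uk)
    have "2 * of_real pi * \<i> * of_int (- k) * fourier ?v (- k) = fourier (\<lambda>x. (?b + \<i> * z) * ?v x + (- \<i>) * V x) (- k)"
      by (rule fourier_derivative[symmetric, OF dv]) (auto intro!: continuous_intros vc Vc vper)
    also have "\<dots> = (?b + \<i> * z) * fourier ?v (- k) + (- \<i>) * fourier V (- k)"
      by (rule fourier_linear[OF vc Vc])
    finally have "\<i> * fourier V (- k) = \<i> * ((z - of_real pi * of_int n + \<i> * \<tau> + 2 * of_real pi * of_int k) * fourier ?v (- k))"
      by (simp add: algebra_simps)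
    then show "(z - of_real pi * of_int n + \<i> * \<tau> + 2 * of_real pi * of_int k) * fourier ?v (- k) = conv q (fourier ?u) (n - k)"
      by (simp add: Vk)
  qed
qed

text \<open>
  The value at \<open>x = 0\<close> of an absolutely convergent Fourier series is the sum of its coefficients, so
  \<open>u(0) = v(0) = c\<close> is the condition on the sums in \<open>hankel_system_asymptotics\<close>. The last conclusion
  says that the eigenfunction is a plane wave up to \<open>O(1/n)\<close>: all modes but the zero mode are small.
\<close>
lemma dirichlet_solution_asymptotics:
  fixes p q :: "int \<Rightarrow> complex" and n :: int and \<tau> z c c' :: complex
  defines "A \<equiv> z - of_real pi * of_int n - \<i> * \<tau>" and "B \<equiv> z - of_real pi * of_int n + \<i> * \<tau>"
  assumes p: "wl2_le (Suc P) R p" and q: "wl2_le (Suc P) R q"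
    and sol: "csol (fseries p) (fseries q) z (\<lambda>x. 0) (\<lambda>x. 0) f1 f2"
    and bc: "f1 0 = c" "f2 0 = c" "f1 1 = c'" "f2 1 = c'" and c: "c \<noteq> 0"
    and \<tau>: "exp \<tau> * c = (-1) powi n * c'"
    and AB: "\<bar>Re A\<bar> \<le> pi" "\<bar>Re B\<bar> \<le> pi" and n: "hbound P R \<le> wgt n"
  shows "norm A \<le> hbound P R / wgt n" "norm B \<le> hbound P R / wgt n"
    "norm (A - B - (p (- n) - q n)) \<le> hbound P R * (gmaj (\<lambda>m. p (- m)) q n + 1 / wgt n ^ Suc (Suc P)) / wgt n"
    "\<exists>d. d \<noteq> 0 \<and> (\<forall>x\<in>{0..1}.
       norm (exp ((\<i> * of_real pi * of_int n - \<tau>) * of_real x) * f1 x - d) \<le> 2 * hbound P R / wgt n * norm d \<and>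
       norm (exp ((- \<i> * of_real pi * of_int n - \<tau>) * of_real x) * f2 x - d) \<le> 2 * hbound P R / wgt n * norm d)"
proof -
  define u where "u x = exp ((\<i> * of_real pi * of_int n - \<tau>) * of_real x) * f1 x" for x
  define v where "v x = exp ((- \<i> * of_real pi * of_int n - \<tau>) * of_real x) * f2 x" for x
  define uh where "uh = fourier u"
  define wh where "wh k = fourier v (- k)" for k
  note p1 = wl2_le_imp_l1_le_0[OF p] and q1 = wl2_le_imp_l1_le_0[OF q]
  note fl = floquet_hankel_system[OF p1 q1 sol bc \<tau>, folded u_def[abs_def] v_def[abs_def] A_def B_def]
  have sys: "hankel_system n A B (\<lambda>m. p (- m)) q uh wh"
    using fl(5) by (simp add: uh_def wh_def[abs_def])
  obtain D1 where D1: "\<And>x. x \<in> {0..1} \<Longrightarrow> norm (u x) \<le> D1"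
    using continuous_01_bounded[OF fl(3)] by blast
  obtain D2 where D2: "\<And>x. x \<in> {0..1} \<Longrightarrow> norm (v x) \<le> D2"
    using continuous_01_bounded[OF fl(4)] by blast
  have bu: "norm (uh k) \<le> max D1 D2" for k
    unfolding uh_def using norm_fourier_le[OF fl(3) D1, of k] by simp
  have bw: "norm (wh k) \<le> max D1 D2" for k
    unfolding wh_def using norm_fourier_le[OF fl(4) D2, of "- k"] by simp
  note est = hankel_system_asymptotics[OF wl2_le_reflect[OF p] q AB n sys bu bw]
  obtain C where C: "l1_le C uh" "l1_le C wh" using est(1) by blast
  have vh: "fourier v = (\<lambda>k. wh (- k))" by (simp add: wh_def)
  have C2: "l1_le C (fourier v)" unfolding vh by (rule l1_le_reindex[OF C(2) inj_uminus_int])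
  have u_eq: "u x = fseries uh x" if "x \<in> {0..1}" for x
    using continuous_eq_fseries[OF fl(3) _ that] C(1) unfolding uh_def by blast
  have v_eq: "v x = fseries (fourier v) x" if "x \<in> {0..1}" for x
    by (rule continuous_eq_fseries[OF fl(4) C2 that])
  have su: "c = infsum uh UNIV"
    using u_eq[of 0] by (simp add: fseries_def u_def bc)
  have sv: "c = infsum wh UNIV"
  proof -
    have "c = (\<Sum>\<^sub>\<infinity>k. wh (- k))" using v_eq[of 0] by (simp add: fseries_def vh v_def bc)
    also have "\<dots> = infsum wh UNIV"
      by (rule infsum_reindex_bij_witness[of _ uminus uminus]) auto
    finally show ?thesis .
  qed
  have sums: "infsum uh UNIV = infsum wh UNIV" using su sv by simp
  have "\<exists>k. uh k \<noteq> 0"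
  proof (rule ccontr)
    assume "\<not> (\<exists>k. uh k \<noteq> 0)"
    then have "uh = (\<lambda>_. 0)" by auto
    with su c show False by simp
  qed
  then obtain k0 where "uh k0 \<noteq> 0 \<or> wh k0 \<noteq> 0" by blast
  note est2 = est(2)[OF sums this]
  show "norm A \<le> hbound P R / wgt n" "norm B \<le> hbound P R / wgt n"
    "norm (A - B - (p (- n) - q n)) \<le> hbound P R * (gmaj (\<lambda>m. p (- m)) q n + 1 / wgt n ^ Suc (Suc P)) / wgt n"
    using est2 by auto
  let ?e = "hbound P R / wgt n * norm (uh 0)"
  have e0: "0 \<le> ?e" using est2 l1_le_nonneg by blast
  have near: "norm (fseries x t - x 0) \<le> ?e" if l: "l1_le ?e (\<lambda>k. if k = 0 then 0 else x k)" for x t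
  proof -
    let ?x = "\<lambda>k. if k = 0 then 0 else x k"
    have "l1_le ?e (\<lambda>k. ?x k * ee k t)" using l by (simp add: l1_le_def norm_mult)
    note s = has_sum_infsum[OF l1_le_summable(2)[OF this]] and nb = norm_infsum_le_l1(1)[OF this, of UNIV]
    have "((\<lambda>k. x 0 * delta0 k) has_sum x 0) UNIV"
      by (rule has_sum_finite_neutralI[of "{0}"]) auto
    from has_sum_add[OF this s] have "((\<lambda>k. x k * ee k t) has_sum (x 0 + (\<Sum>\<^sub>\<infinity>k. ?x k * ee k t))) UNIV"
      by (rule has_sum_cong[THEN iffD1, rotated]) auto
    then have "fseries x t - x 0 = (\<Sum>\<^sub>\<infinity>k. ?x k * ee k t)"
      unfolding fseries_def by (simp add: infsumI)
    then show ?thesis using nb by simp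
  qed
  have lv: "l1_le ?e (\<lambda>k. if k = 0 then 0 else fourier v k)"
  proof -
    have "l1_le ?e (\<lambda>k. if k = 0 then 0 else wh k)" using est2 by blast
    from l1_le_reindex[OF this inj_uminus_int] show ?thesis by (simp add: wh_def cong: if_cong)
  qed
  have "norm (u x - uh 0) \<le> 2 * hbound P R / wgt n * norm (uh 0) \<and> norm (v x - uh 0) \<le> 2 * hbound P R / wgt n * norm (uh 0)"
    if x: "x \<in> {0..1}" for x
  proof
    show "norm (u x - uh 0) \<le> 2 * hbound P R / wgt n * norm (uh 0)"
      using near[of uh x] est2 u_eq[OF x] e0 by simp
    have "norm (v x - uh 0) \<le> norm (v x - wh 0) + norm (wh 0 - uh 0)"
      using norm_triangle_ineq[of "v x - wh 0" "wh 0 - uh 0"] by simp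
    also have "norm (v x - wh 0) \<le> ?e"
      using near[OF lv, of x] v_eq[OF x] by (simp add: vh)
    also have "norm (wh 0 - uh 0) \<le> ?e" using est2 by blast
    finally show "norm (v x - uh 0) \<le> 2 * hbound P R / wgt n * norm (uh 0)" by (simp add: mult_ac)
  qed
  then show "\<exists>d. d \<noteq> 0 \<and> (\<forall>x\<in>{0..1}.
       norm (exp ((\<i> * of_real pi * of_int n - \<tau>) * of_real x) * f1 x - d) \<le> 2 * hbound P R / wgt n * norm d \<and>
       norm (exp ((- \<i> * of_real pi * of_int n - \<tau>) * of_real x) * f2 x - d) \<le> 2 * hbound P R / wgt n * norm d)"
    using est2 unfolding u_def v_def by blast
qed

text \<open>
  Adding \<open>2\<pi>\<i>\<close> to \<open>\<tau>\<close> and adding 1 to \<open>n\<close> together with \<open>\<pi>\<i>\<close> to \<open>\<tau>\<close> keep the relation with the multiplier.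
  Such changes shift \<open>z - \<pi>n - \<i>\<tau>\<close> and \<open>z - \<pi>n + \<i>\<tau>\<close> by independent multiples of \<open>2\<pi>\<close>, so both real
  parts can be brought to \<open>[-\<pi>, \<pi>]\<close>, no matter how large the imaginary part of \<open>z\<close> is.
\<close>
lemma floquet_exponent_exists:
  fixes z \<rho> :: complex
  assumes "\<rho> \<noteq> 0"
  obtains n :: int and \<tau> where "exp \<tau> = (-1) powi n * \<rho>"
    "\<bar>Re (z - of_real pi * of_int n - \<i> * \<tau>)\<bar> \<le> pi" "\<bar>Re (z - of_real pi * of_int n + \<i> * \<tau>)\<bar> \<le> pi"
proof -
  have ex: "\<exists>j::int. \<bar>x - 2 * pi * of_int j\<bar> \<le> pi" for x :: real
  proof -
    define j where "j = round (x / (2 * pi))"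
    have "\<bar>of_int j - x / (2 * pi)\<bar> \<le> 1 / 2" unfolding j_def by (rule of_int_round_abs_le)
    then have "\<bar>2 * pi * (of_int j - x / (2 * pi))\<bar> \<le> 2 * pi * (1 / 2)"
      by (simp only: abs_mult) (intro mult_mono, auto)
    then show ?thesis by (intro exI[of _ j]) (simp add: algebra_simps abs_minus_commute)
  qed
  define \<tau>0 where "\<tau>0 = Ln \<rho>"
  obtain j l :: int where j: "\<bar>Re (z - \<i> * \<tau>0) - 2 * pi * of_int j\<bar> \<le> pi" and l: "\<bar>Re (z + \<i> * \<tau>0) - 2 * pi * of_int l\<bar> \<le> pi"
    using ex by blast
  define \<tau> where "\<tau> = \<tau>0 + \<i> * of_real pi * of_int (l - j)"
  show ?thesis
  proof (rule that[of \<tau> "j + l"])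
    have "exp \<tau> = (-1) powi (l - j) * \<rho>"
      using assms by (simp add: \<tau>_def exp_add \<tau>0_def exp_pi_i_int[symmetric] del: of_int_diff)
    also have "(-1::complex) powi (l - j) = (-1) powi (j + l)"
      by (auto simp: power_int_minus_left)
    finally show "exp \<tau> = (-1) powi (j + l) * \<rho>" .
    show "\<bar>Re (z - of_real pi * of_int (j + l) - \<i> * \<tau>)\<bar> \<le> pi"
      using j by (simp add: \<tau>_def algebra_simps)
    show "\<bar>Re (z - of_real pi * of_int (j + l) + \<i> * \<tau>)\<bar> \<le> pi"
      using l by (simp add: \<tau>_def algebra_simps)
  qed
qed

section \<open>Existence of an eigenvalue near each multiple of \<pi>\<close>

text \<open>
  The substitution \<open>s = x t\<close> makes the interval of integration independent of the parameter.
\<close>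
lemma continuous_on_volterra:
  fixes g :: "real \<times> 'b::topological_space \<Rightarrow> complex"
  assumes g: "continuous_on ({0..1} \<times> L) g"
  shows "continuous_on ({0..1} \<times> L) (\<lambda>p. integral {0..fst p} (\<lambda>s. g (s, snd p)))"
proof -
  have scale: "integral {0..fst p} (\<lambda>s. g (s, snd p)) = of_real (fst p) * integral (cbox 0 1) (\<lambda>t. g (fst p * t, snd p))"
    if p: "p \<in> {0..1} \<times> L" for p
  proof (cases "fst p = 0")
    case False
    then have m: "0 < fst p" "fst p \<le> 1" "snd p \<in> L" using p by (auto simp: less_le mem_Times_iff)
    have "continuous_on {0..fst p} (\<lambda>s. g (s, snd p))"
      using m by (intro continuous_on_compose2[OF g] continuous_intros) auto
    then have "((\<lambda>s. g (s, snd p)) has_integral integral {0..fst p} (\<lambda>s. g (s, snd p))) {0..fst p}"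
      by (intro integrable_integral integrable_continuous_real)
    from has_integral_stretch_real[OF this, of "fst p"] m
    have *: "((\<lambda>t. g (fst p * t, snd p)) has_integral (1 / fst p) *\<^sub>R integral {0..fst p} (\<lambda>s. g (s, snd p))) ((\<lambda>x. x / fst p) ` {0..fst p})"
      by simp
    have "(\<lambda>x. x / fst p) ` {0..fst p} = cbox 0 1"
    proof
      show "cbox 0 1 \<subseteq> (\<lambda>x. x / fst p) ` {0..fst p}"
      proof
        fix t :: real assume "t \<in> cbox 0 1"
        then have "t = (fst p * t) / fst p" "fst p * t \<in> {0..fst p}" using m by (auto simp: mult_left_le)
        then show "t \<in> (\<lambda>x. x / fst p) ` {0..fst p}" by blast
      qed
    qed (use m in auto)
    with * have "integral (cbox 0 1) (\<lambda>t. g (fst p * t, snd p)) = (1 / fst p) *\<^sub>R integral {0..fst p} (\<lambda>s. g (s, snd p))"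
      by (simp add: integral_unique)
    then show ?thesis using m by (simp add: scaleR_conv_of_real)
  qed simp
  have "continuous_on ({0..1} \<times> L) (\<lambda>p. of_real (fst p) * integral (cbox 0 1) (\<lambda>t. g (fst p * t, snd p)))"
  proof (intro continuous_intros integral_continuous_on_param)
    show "continuous_on (({0..1} \<times> L) \<times> cbox 0 1) (\<lambda>(p, t). g (fst p * t, snd p))"
      unfolding case_prod_unfold
      by (intro continuous_on_compose2[OF g] continuous_intros) (auto simp: mult_le_one)
  qed
  then show ?thesis
    by (rule continuous_on_eq) (simp add: scale)
qed

text \<open>
  The terms of the Picard series of \<open>U\<^sub>b(x) = 1 + \<integral> k\<^sub>b U\<^sub>\<not>\<^sub>b\<close>, where the integral is over \<open>[0, x]\<close>. The Boolean
  index numbers the two components, and the second coordinate of \<open>p\<close> is a parameter.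
\<close>
primrec volterra_term :: "(bool \<Rightarrow> real \<times> complex \<Rightarrow> complex) \<Rightarrow> nat \<Rightarrow> bool \<Rightarrow> real \<times> complex \<Rightarrow> complex" where
  "volterra_term k 0 b p = 1"
| "volterra_term k (Suc m) b p = integral {0..fst p} (\<lambda>s. k b (s, snd p) * volterra_term k m (\<not> b) (s, snd p))"

text \<open>
  The bound \<open>(K x)\<^sup>m / m!\<close> for the terms makes the series converge uniformly in \<open>x\<close> and in the parameter,
  so its sum is jointly continuous.
\<close>
lemma volterra_solution:
  fixes k :: "bool \<Rightarrow> real \<times> complex \<Rightarrow> complex"
  assumes k: "\<And>b. continuous_on ({0..1} \<times> L) (k b)"
    and K: "\<And>b p. p \<in> {0..1} \<times> L \<Longrightarrow> norm (k b p) \<le> K"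
  obtains U where "\<And>b. continuous_on ({0..1} \<times> L) (U b)"
    "\<And>b x l. x \<in> {0..1} \<Longrightarrow> l \<in> L \<Longrightarrow> U b (x, l) = 1 + integral {0..x} (\<lambda>s. k b (s, l) * U (\<not> b) (s, l))"
    "\<And>b p. p \<in> {0..1} \<times> L \<Longrightarrow> norm (U b p) \<le> exp K"
proof (cases "L = {}")
  case True
  then show ?thesis using that[of "\<lambda>b p. 0"] by simp
next
  case False
  let ?X = "{0..1} \<times> L" and ?T = "volterra_term k"
  have K0: "0 \<le> K" using K[of "(0, _)"] False norm_ge_zero order_trans by (metis SigmaI all_not_in_conv atLeastAtMost_iff order_refl zero_le_one)
  have Tc: "continuous_on ?X (?T m b)" for m b
  proof (induction m arbitrary: b)
    case (Suc m)
    show ?case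
      unfolding volterra_term.simps
      by (rule continuous_on_volterra[where g = "\<lambda>p. k b p * ?T m (\<not> b) p"]) (intro continuous_intros k Suc)
  qed simp
  have Tb: "norm (?T m b p) \<le> (K * fst p) ^ m / fact m" if "p \<in> ?X" for m b p
    using that
  proof (induction m arbitrary: b p)
    case (Suc m)
    obtain x l where p: "p = (x, l)" and x: "0 \<le> x" "x \<le> 1" and l: "l \<in> L" using Suc.prems by auto
    have der: "((\<lambda>s. (K * s) ^ Suc m / fact (Suc m)) has_vector_derivative K * ((K * s) ^ m / fact m)) (at s within S)" for s S
    proof -
      have "((\<lambda>s. K * s) has_real_derivative K) (at s within S)"
        by (auto intro!: derivative_eq_intros)
      from DERIV_cdivide[OF DERIV_power_Suc[OF this, of m], of "fact (Suc m)"]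
      have "((\<lambda>s. (K * s) ^ Suc m / fact (Suc m)) has_real_derivative (1 + real m) * (K * (K * s) ^ m) / fact (Suc m)) (at s within S)" .
      moreover have "(1 + real m) * (K * (K * s) ^ m) / fact (Suc m) = K * ((K * s) ^ m / fact m)"
      proof -
        have "fact (Suc m) = (1 + real m) * fact m" by (simp add: algebra_simps)
        moreover have "1 + real m \<noteq> 0" by linarith
        ultimately show ?thesis by simp
      qed
      ultimately show ?thesis
        unfolding has_real_derivative_iff_has_vector_derivative[symmetric] by (simp only:)
    qed
    have int: "((\<lambda>s. K * ((K * s) ^ m / fact m)) has_integral ((K * x) ^ Suc m / fact (Suc m) - (K * 0) ^ Suc m / fact (Suc m))) {0..x}"
      by (rule fundamental_theorem_of_calculus[OF x(1) der])
    have "norm (?T (Suc m) b p) \<le> integral {0..x} (\<lambda>s. K * ((K * s) ^ m / fact m))"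
      unfolding volterra_term.simps p fst_conv snd_conv
    proof (rule integral_norm_bound_integral)
      show "(\<lambda>s. k b (s, l) * ?T m (\<not> b) (s, l)) integrable_on {0..x}"
        using x l by (intro integrable_continuous_real continuous_intros continuous_on_compose2[OF k] continuous_on_compose2[OF Tc]) auto
      show "(\<lambda>s. K * ((K * s) ^ m / fact m)) integrable_on {0..x}" using int by blast
      fix s assume s: "s \<in> {0..x}"
      have "norm (k b (s, l)) * norm (?T m (\<not> b) (s, l)) \<le> K * ((K * s) ^ m / fact m)"
        using K[of "(s, l)" b] Suc.IH[of "(s, l)" "\<not> b"] s x l K0 by (intro mult_mono) auto
      then show "norm (k b (s, l) * ?T m (\<not> b) (s, l)) \<le> K * ((K * s) ^ m / fact m)"
        by (simp add: norm_mult)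
    qed
    also have "\<dots> = (K * fst p) ^ Suc m / fact (Suc m)"
      unfolding integral_unique[OF int] by (simp add: p)
    finally show ?case .
  qed simp
  have Tb1: "norm (?T m b p) \<le> K ^ m / fact m" if "p \<in> ?X" for m b p
  proof -
    have "K * fst p \<le> K" "0 \<le> fst p" using that K0 by (auto simp: mult_left_le)
    then have "(K * fst p) ^ m / fact m \<le> K ^ m / fact m"
      using K0 by (intro divide_right_mono power_mono) auto
    then show ?thesis using Tb[OF that, of m b] by linarith
  qed
  have se: "summable (\<lambda>m. K ^ m / fact m)"
    using summable_exp[of K] by (simp add: divide_inverse mult.commute)
  have sume: "(\<Sum>m. K ^ m / fact m) = exp K"
    unfolding exp_def by (simp add: divide_inverse mult.commute)
  define U where "U b p = (\<Sum>m. ?T m b p)" for b p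
  have Tsum: "summable (\<lambda>m. norm (?T m b p))" if "p \<in> ?X" for b p
    by (rule summable_comparison_test'[OF se]) (use Tb1[OF that] in auto)
  have ul: "uniform_limit ?X (\<lambda>N p. \<Sum>m<N. ?T m b p) (U b) sequentially" for b
    unfolding U_def[abs_def] by (rule Weierstrass_m_test[OF _ se]) (rule Tb1)
  show ?thesis
  proof (rule that[of U])
    show "continuous_on ?X (U b)" for b
      by (rule uniform_limit_theorem[OF _ ul]) (auto intro!: always_eventually continuous_on_sum Tc)
    show "norm (U b p) \<le> exp K" if "p \<in> ?X" for b p
    proof -
      have "norm (U b p) \<le> (\<Sum>m. norm (?T m b p))"
        unfolding U_def by (rule summable_norm[OF Tsum[OF that]])
      also have "\<dots> \<le> (\<Sum>m. K ^ m / fact m)"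
        by (rule suminf_le[OF Tb1[OF that] Tsum[OF that] se])
      finally show ?thesis by (simp add: sume)
    qed
    fix b x l assume x: "x \<in> {0..1::real}" and l: "l \<in> L"
    let ?g = "\<lambda>m s. k b (s, l) * ?T m (\<not> b) (s, l)"
    have sub: "(s, l) \<in> ?X" if "s \<in> {0..x}" for s using that x l by auto
    have lim_sum: "uniform_limit {0..x} (\<lambda>N s. \<Sum>m<N. ?g m s) (\<lambda>s. \<Sum>m. ?g m s) sequentially"
    proof (rule Weierstrass_m_test)
      show "norm (?g m s) \<le> K * (K ^ m / fact m)" if "s \<in> {0..x}" for m s
        unfolding norm_mult using K[OF sub[OF that], of b] Tb1[OF sub[OF that], of m "\<not> b"] K0 by (intro mult_mono) auto
      show "summable (\<lambda>m. K * (K ^ m / fact m))" by (rule summable_mult[OF se])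
    qed
    have sum_g: "(\<Sum>m. ?g m s) = k b (s, l) * U (\<not> b) (s, l)" if "s \<in> {0..x}" for s
      unfolding U_def by (rule suminf_mult[OF summable_norm_cancel[OF Tsum[OF sub[OF that]]]])
    have ulg: "uniform_limit {0..x} (\<lambda>N s. \<Sum>m<N. ?g m s) (\<lambda>s. k b (s, l) * U (\<not> b) (s, l)) sequentially"
      by (rule iffD1[OF uniform_limit_cong' lim_sum]) (simp_all only: sum_g)
    have gc: "continuous_on {0..x} (?g m)" for m
      using x l by (intro continuous_intros continuous_on_compose2[OF k] continuous_on_compose2[OF Tc]) auto
    obtain I J where I: "\<And>N. ((\<lambda>s. \<Sum>m<N. ?g m s) has_integral I N) {0..x}"
      and J: "((\<lambda>s. k b (s, l) * U (\<not> b) (s, l)) has_integral J) {0..x}" and IJ: "I \<longlonglongrightarrow> J"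
    proof (rule uniform_limit_integral[OF ulg])
      show "continuous_on {0..x} (\<lambda>s. \<Sum>m<N. ?g m s)" for N
        by (intro continuous_on_sum gc)
    qed auto
    have IN: "I N = (\<Sum>m<N. ?T (Suc m) b (x, l))" for N
    proof -
      have "I N = integral {0..x} (\<lambda>s. \<Sum>m<N. ?g m s)" by (rule integral_unique[OF I, symmetric])
      also have "\<dots> = (\<Sum>m<N. integral {0..x} (?g m))"
        by (rule integral_sum) (auto intro: integrable_continuous_real gc)
      finally show ?thesis by simp
    qed
    have "(\<lambda>N. \<Sum>m<N. ?T (Suc m) b (x, l)) \<longlonglongrightarrow> J"
      using IJ unfolding IN[abs_def] .
    then have "(\<lambda>m. ?T (Suc m) b (x, l)) sums J" by (simp only: sums_def)
    then have "(\<lambda>m. ?T m b (x, l)) sums (J + ?T 0 b (x, l))" by (subst (asm) sums_Suc_iff) simp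
    then have "U b (x, l) = J + 1" unfolding U_def by (simp add: sums_iff)
    then show "U b (x, l) = 1 + integral {0..x} (\<lambda>s. k b (s, l) * U (\<not> b) (s, l))"
      unfolding integral_unique[OF J] by simp
  qed
qed

text \<open>
  Integration by parts without the assumption of periodicity: the boundary terms are of the same order
  as the coefficient of the derivative.
\<close>
lemma norm_fourier_C1_le:
  assumes der: "\<And>x. x \<in> {0..1} \<Longrightarrow> (f has_vector_derivative f' x) (at x within {0..1})"
    and f': "continuous_on {0..1} f'"
    and C: "\<And>x. x \<in> {0..1} \<Longrightarrow> norm (f x) \<le> C" and D: "\<And>x. x \<in> {0..1} \<Longrightarrow> norm (f' x) \<le> D"
  shows "norm (fourier f k) \<le> (2 * C + D) / wgt k"
proof -
  have f: "continuous_on {0..1} f"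
    unfolding continuous_on_eq_continuous_within by (meson der has_vector_derivative_continuous)
  have CD: "0 \<le> C" "0 \<le> D" using C[of 0] D[of 0] by (auto intro: order_trans[OF norm_ge_zero])
  show ?thesis
  proof (cases "k = 0")
    case True
    then show ?thesis using norm_fourier_le[OF f C, of 0] CD by simp
  next
    case False
    let ?c = "2 * of_real pi * \<i> * of_int (- k) :: complex"
    have "((\<lambda>x. f x * (?c * ee (- k) x) + f' x * ee (- k) x) has_integral (f 1 * ee (- k) 1 - f 0 * ee (- k) 0)) {0..1}"
      by (intro fundamental_theorem_of_calculus has_vector_derivative_mult der has_vector_derivative_ee) auto
    then have "integral {0..1} (\<lambda>x. f x * (?c * ee (- k) x) + f' x * ee (- k) x) = f 1 - f 0"
      by (simp add: integral_unique)
    also have "(\<lambda>x. f x * (?c * ee (- k) x) + f' x * ee (- k) x) = (\<lambda>x. ?c * (f x * ee (- k) x) + f' x * ee (- k) x)"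
      by (auto simp: mult_ac)
    also have "integral {0..1} \<dots> = integral {0..1} (\<lambda>x. ?c * (f x * ee (- k) x)) + integral {0..1} (\<lambda>x. f' x * ee (- k) x)"
      by (intro integral_add integrable_continuous_real continuous_intros f f')
    also have "\<dots> = ?c * fourier f k + fourier f' k" by (simp add: fourier_continuous f f')
    finally have "?c * fourier f k = f 1 - f 0 - fourier f' k" by (simp add: algebra_simps)
    then have "norm (?c * fourier f k) = norm (f 1 - f 0 - fourier f' k)" by (simp only:)
    also have "\<dots> \<le> norm (f 1) + norm (f 0) + norm (fourier f' k)"
      by (rule order_trans[OF norm_triangle_ineq4 add_right_mono[OF norm_triangle_ineq4]])
    also have "\<dots> \<le> C + C + D"
      by (intro add_mono C norm_fourier_le[OF f' D]) auto
    finally have *: "norm ?c * norm (fourier f k) \<le> 2 * C + D" by (simp add: norm_mult)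
    have "wgt k \<le> norm ?c"
    proof -
      have "1 \<le> \<bar>real_of_int k\<bar>" using False by linarith
      then have "wgt k \<le> 2 * \<bar>real_of_int k\<bar>" by (simp add: wgt_def)
      also have "\<dots> \<le> (2 * pi) * \<bar>real_of_int k\<bar>" using pi_ge_two by (intro mult_right_mono) auto
      finally show ?thesis by (simp add: norm_mult)
    qed
    then have "wgt k * norm (fourier f k) \<le> 2 * C + D"
      using mult_right_mono[OF _ norm_ge_zero[of "fourier f k"]] * by (meson order_trans)
    then show ?thesis by (simp add: field_simps)
  qed
qed

text \<open>
  The integral is the Fourier coefficient of a product, hence a convolution at \<open>- n\<close>, to which
  \<open>norm_conv_div_wgt_le\<close> applies.
\<close>
lemma oscillating_integral_le:
  assumes p: "wl2_le (Suc P) R p" and H: "\<And>k. norm (fourier H k) \<le> Y / wgt k" and Hc: "continuous_on {0..1} H"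
  shows "norm (integral {0..1} (\<lambda>x. fseries p x * (ee n x * H x))) \<le> 4 * R * Y / wgt n"
proof -
  note p1 = wl2_le_imp_l1_le_0[OF p]
  have "integral {0..1} (\<lambda>x. fseries p x * (ee n x * H x)) = fourier (\<lambda>x. fseries p x * (ee n x * H x)) 0"
    by (subst fourier_continuous) (auto intro!: continuous_intros continuous_on_fseries[OF p1] Hc)
  also have "\<dots> = conv p (fourier (\<lambda>x. ee n x * H x)) 0"
    by (rule fourier_fseries_mult[OF p1]) (intro continuous_intros Hc)
  also have "fourier (\<lambda>x. ee n x * H x) = (\<lambda>j. fourier H (j - n))"
    by (rule ext) (rule fourier_shift[OF Hc])
  also have "conv p (\<lambda>j. fourier H (j - n)) 0 = conv p (fourier H) (- n)"
    unfolding conv_def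
  proof (rule infsum_reindex_bij_witness[of _ "\<lambda>j. j + n" "\<lambda>j. j - n"])
    fix j
    have "- n - (j - n) = 0 - j" by simp
    then show "p (- n - (j - n)) * fourier H (j - n) = p (0 - j) * fourier H (j - n)" by (simp only:)
  qed auto
  finally show ?thesis
    using norm_conv_div_wgt_le[OF p H, of "- n"] by simp
qed

text \<open>
  The bound for \<open>wgt n\<close> times the oscillating integrals in \<open>dirichlet_eigenvalue_exists\<close>: there, the
  kernels are bounded by \<open>K = 2 R exp 2\<close> and the solutions by \<open>exp K\<close>.
\<close>
definition exconst :: "real \<Rightarrow> real" where
  "exconst R = 4 * R * (exp 2 * exp (2 * R * exp 2) * (4 + 2 * R * exp 2))"

text \<open>
  Write the solution with initial value \<open>(1, 1)\<close> at \<open>\<lambda>\<close> as \<open>f\<^sub>1 = exp(-\<i>\<lambda>x) U\<^sub>1\<close> and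
  \<open>f\<^sub>2 = exp(\<i>\<lambda>x) U\<^sub>2\<close>. The boundary condition at 1 is \<open>exp(2\<i>\<lambda>) = U\<^sub>1/U\<^sub>2\<close>, and near \<open>\<pi>n\<close> it is the fixed
  point equation \<open>\<lambda> = \<pi>n + Ln (U\<^sub>1/U\<^sub>2) / (2\<i>)\<close>. The functions \<open>U\<^sub>1\<close> and \<open>U\<^sub>2\<close> differ from 1 at \<open>x = 1\<close> by
  oscillating integrals, which are small, so the right-hand side is a continuous map of a disc into
  itself, and Brouwer's theorem gives a solution.
\<close>
lemma dirichlet_eigenvalue_exists:
  assumes p: "wl2_le (Suc P) R p" and q: "wl2_le (Suc P) R q" and n: "10 * exconst R \<le> wgt n"
  obtains z f1 f2 where "norm (z - of_real pi * of_int n) \<le> 1"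
    "csol (fseries p) (fseries q) z (\<lambda>x. 0) (\<lambda>x. 0) f1 f2" "f1 0 = 1" "f2 0 = 1" "f1 1 = f2 1"
proof -
  note p1 = wl2_le_imp_l1_le_0[OF p] and q1 = wl2_le_imp_l1_le_0[OF q]
  have R: "0 \<le> R" using p wl2_le_nonneg by blast
  let ?c = "of_real pi * of_int n :: complex"
  define L where "L = cball ?c 1"
  let ?X = "{0..1} \<times> L"
  define s where "s b = (if b then 1 else -1 :: complex)" for b
  define r where "r b = (if b then p else q)" for b
  have r: "wl2_le (Suc P) R (r b)" and r1: "l1_le (2 * R) (r b)" for b
    using p q p1 q1 by (auto simp: r_def)
  have s_simps: "s True = 1" "s False = -1" "s (\<not> b) = - s b" "norm (s b) = 1" for b by (auto simp: s_def)
  \<comment> \<open>The two components are \<open>b = True\<close> and \<open>b = False\<close>; the sign \<open>s b\<close> unifies their equations.\<close>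
  define k where "k b \<xi> = s b * \<i> * fseries (r b) (fst \<xi>) * exp (s b * (2 * \<i>) * snd \<xi> * of_real (fst \<xi>))" for b \<xi>
  define K where "K = 2 * R * exp 2"
  have K0: "0 \<le> K" using R by (simp add: K_def)
  have kc: "continuous_on ?X (k b)" for b
    unfolding k_def
    by (intro continuous_intros continuous_on_compose2[OF continuous_on_fseries[OF r1, of UNIV]]) auto
  have exb: "norm (exp (s b * (2 * \<i>) * \<nu> * of_real x)) \<le> exp 2" if "norm \<nu> \<le> 1 \<or> \<bar>Im \<nu>\<bar> \<le> 1" "x \<in> {0..1}" for b \<nu> x
  proof -
    have im: "\<bar>Im \<nu>\<bar> \<le> 1" using that abs_Im_le_cmod[of \<nu>] by auto
    have "Re (s b * (2 * \<i>) * \<nu> * of_real x) \<le> 2 * (\<bar>Im \<nu>\<bar> * x)"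
    proof -
      have "Im \<nu> * x \<le> \<bar>Im \<nu>\<bar> * x" "- Im \<nu> * x \<le> \<bar>Im \<nu>\<bar> * x"
        using that by (intro mult_right_mono; simp)+
      then show ?thesis by (cases b) (simp_all add: s_def mult.commute[of x])
    qed
    also have "\<dots> \<le> 2 * (1 * 1)" using im that by (intro mult_left_mono mult_mono) auto
    finally show ?thesis by (simp add: norm_exp_eq_Re)
  qed
  have Lim: "\<bar>Im l\<bar> \<le> 1" if "l \<in> L" for l
  proof -
    have "\<bar>Im (l - ?c)\<bar> \<le> norm (l - ?c)" by (rule abs_Im_le_cmod)
    then show ?thesis using that by (simp add: L_def dist_norm norm_minus_commute)
  qed
  have kK: "norm (k b \<xi>) \<le> K" if "\<xi> \<in> ?X" for b \<xi>
  proof -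
    have "norm (fseries (r b) (fst \<xi>)) * norm (exp (s b * (2 * \<i>) * snd \<xi> * of_real (fst \<xi>))) \<le> 2 * R * exp 2"
      using that R by (intro mult_mono norm_fseries_le[OF r1] exb) (auto intro: Lim)
    then show ?thesis by (simp add: k_def K_def norm_mult s_simps)
  qed
  obtain U where Uc: "\<And>b. continuous_on ?X (U b)"
    and Ueq: "\<And>b x l. x \<in> {0..1} \<Longrightarrow> l \<in> L \<Longrightarrow> U b (x, l) = 1 + integral {0..x} (\<lambda>t. k b (t, l) * U (\<not> b) (t, l))"
    and Ub: "\<And>b \<xi>. \<xi> \<in> ?X \<Longrightarrow> norm (U b \<xi>) \<le> exp K"
  proof (rule volterra_solution[OF kc kK])
    fix U assume "\<And>b. continuous_on ?X (U b)"
      "\<And>b x l. x \<in> {0..1} \<Longrightarrow> l \<in> L \<Longrightarrow> U b (x, l) = 1 + integral {0..x} (\<lambda>t. k b (t, l) * U (\<not> b) (t, l))"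
      "\<And>b \<xi>. \<xi> \<in> ?X \<Longrightarrow> norm (U b \<xi>) \<le> exp K"
    then show thesis by (rule that)
  qed
  have Ux: "continuous_on {0..1} (\<lambda>x. U b (x, l))" if "l \<in> L" for b l
    using that by (intro continuous_on_compose2[OF Uc] continuous_intros) auto
  have kx: "continuous_on {0..1} (\<lambda>x. k b (x, l))" if "l \<in> L" for b l
    using that by (intro continuous_on_compose2[OF kc] continuous_intros) auto
  have Ud: "((\<lambda>x. U b (x, l)) has_vector_derivative k b (x, l) * U (\<not> b) (x, l)) (at x within {0..1})"
    if "l \<in> L" "x \<in> {0..1}" for b l x
  proof -
    have "((\<lambda>x. 1 + integral {0..x} (\<lambda>t. k b (t, l) * U (\<not> b) (t, l))) has_vector_derivative 0 + k b (x, l) * U (\<not> b) (x, l)) (at x within {0..1})"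
      by (intro has_vector_derivative_add has_vector_derivative_const integral_has_vector_derivative continuous_intros kx Ux that)
    then have "((\<lambda>x. 1 + integral {0..x} (\<lambda>t. k b (t, l) * U (\<not> b) (t, l))) has_vector_derivative k b (x, l) * U (\<not> b) (x, l)) (at x within {0..1})"
      by simp
    then show ?thesis
      by (rule has_vector_derivative_transform[OF that(2), rotated]) (rule Ueq[OF _ that(1)])
  qed
  have ea: "((\<lambda>x. exp (a * of_real x)) has_vector_derivative a * exp (a * of_real x)) (at x within S)" for a :: complex and x S
    by (rule has_vector_derivative_real_field) (auto intro!: derivative_eq_intros)
  have U1: "norm (U b (1, l) - 1) \<le> 1/10" if l: "l \<in> L" for b l
  proof -
    define \<nu> where "\<nu> = l - ?c"
    have \<nu>: "norm \<nu> \<le> 1" using l by (simp add: \<nu>_def L_def dist_norm norm_minus_commute)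
    \<comment> \<open>The kernel oscillates like \<open>ee m\<close>; the rest \<open>H\<close> of the integrand has a bounded derivative.\<close>
    define m where "m = (if b then n else - n)"
    let ?a = "s b * (2 * \<i>) * \<nu>"
    define H where "H x = exp (?a * of_real x) * U (\<not> b) (x, l)" for x
    define H' where "H' x = exp (?a * of_real x) * (k (\<not> b) (x, l) * U b (x, l)) + ?a * exp (?a * of_real x) * U (\<not> b) (x, l)" for x
    have Hd: "(H has_vector_derivative H' x) (at x within {0..1})" if "x \<in> {0..1}" for x
      unfolding H_def H'_def using has_vector_derivative_mult[OF ea Ud[OF l that, of "\<not> b"]] by simp
    have H'c: "continuous_on {0..1} H'"
      unfolding H'_def by (intro continuous_intros Ux kx l)
    have Hc: "continuous_on {0..1} H"
      unfolding H_def by (intro continuous_intros Ux l)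
    have e2: "norm (exp (?a * of_real x)) \<le> exp 2" if "x \<in> {0..1}" for x
      using exb[of \<nu> x b] \<nu> that by (simp add: mult_ac)
    have Hb: "norm (H x) \<le> exp 2 * exp K" if "x \<in> {0..1}" for x
      unfolding H_def norm_mult using that l by (intro mult_mono e2 Ub) auto
    have H'b: "norm (H' x) \<le> exp 2 * (K * exp K) + 2 * exp 2 * exp K" if x: "x \<in> {0..1}" for x
    proof -
      have "norm (H' x) \<le> norm (exp (?a * of_real x)) * (norm (k (\<not> b) (x, l)) * norm (U b (x, l)))
          + norm ?a * norm (exp (?a * of_real x)) * norm (U (\<not> b) (x, l))"
        unfolding H'_def by (rule order_trans[OF norm_triangle_ineq]) (simp add: norm_mult)
      also have "\<dots> \<le> exp 2 * (K * exp K) + 2 * exp 2 * exp K"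
        using x l \<nu> K0 by (intro add_mono mult_mono e2 Ub kK mult_nonneg_nonneg) (auto simp: norm_mult s_simps)
      finally show ?thesis .
    qed
    let ?Y = "2 * (exp 2 * exp K) + (exp 2 * (K * exp K) + 2 * exp 2 * exp K)"
    have HY: "norm (fourier H j) \<le> ?Y / wgt j" for j
      by (rule norm_fourier_C1_le[OF Hd H'c Hb H'b])
    have kH: "k b (x, l) * U (\<not> b) (x, l) = s b * \<i> * (fseries (r b) x * (ee m x * H x))" for x
    proof -
      have "exp (s b * (2 * \<i>) * l * of_real x) = ee m x * exp (?a * of_real x)"
        unfolding ee_def mult_exp_exp
        by (rule arg_cong[where f = exp]) (cases b; simp add: m_def \<nu>_def s_def algebra_simps)
      then show ?thesis by (simp add: k_def H_def mult_ac)
    qed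
    have "U b (1, l) - 1 = integral {0..1} (\<lambda>x. s b * \<i> * (fseries (r b) x * (ee m x * H x)))"
      using Ueq[of 1 l b] l by (simp add: kH)
    then have "norm (U b (1, l) - 1) = norm (integral {0..1} (\<lambda>x. fseries (r b) x * (ee m x * H x)))"
      by (simp add: norm_mult s_simps)
    also have "\<dots> \<le> 4 * R * ?Y / wgt m"
      by (rule oscillating_integral_le[OF r HY Hc])
    also have "4 * R * ?Y = exconst R"
      by (simp add: exconst_def K_def algebra_simps)
    also have "wgt m = wgt n" by (simp add: m_def)
    also have "exconst R / wgt n \<le> 1/10" using n by (simp add: divide_le_eq)
    finally show ?thesis .
  qed
  define W where "W l = U True (1, l) / U False (1, l)" for l
  have W: "norm (W l - 1) \<le> 1/4" "U False (1, l) \<noteq> 0" "W l \<noteq> 0" if "l \<in> L" for l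
  proof -
    have d: "9/10 \<le> norm (U False (1, l))"
      using U1[OF that, of False] norm_triangle_ineq2[of 1 "1 - U False (1, l)"] by (simp add: norm_minus_commute)
    then show nz: "U False (1, l) \<noteq> 0" by auto
    have "W l - 1 = ((U True (1, l) - 1) - (U False (1, l) - 1)) / U False (1, l)"
      using nz by (simp add: W_def diff_divide_distrib)
    also have "norm \<dots> \<le> (1/10 + 1/10) / (9/10)"
      unfolding norm_divide
      using d norm_triangle_ineq4[of "U True (1, l) - 1" "U False (1, l) - 1"] U1[OF that, of True] U1[OF that, of False]
      by (intro frac_le) linarith+
    finally show W1: "norm (W l - 1) \<le> 1/4" by simp
    then show "W l \<noteq> 0" by auto
  qed
  define \<Psi> where "\<Psi> l = ?c + Ln (W l) / (2 * \<i>)" for l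
  have Ucl: "continuous_on L (\<lambda>l. U b (1, l))" for b
    by (intro continuous_on_compose2[OF Uc] continuous_intros) auto
  have "continuous_on L \<Psi>"
    unfolding \<Psi>_def
  proof (intro continuous_intros)
    show "continuous_on L W"
      unfolding W_def by (intro continuous_intros Ucl) (use W in auto)
    show "W l \<notin> \<real>\<^sub>\<le>\<^sub>0" if "l \<in> L" for l
    proof
      assume "W l \<in> \<real>\<^sub>\<le>\<^sub>0"
      then have "Re (W l) \<le> 0" by (auto simp: complex_nonpos_Reals_iff)
      moreover have "\<bar>Re (W l - 1)\<bar> \<le> 1/4" using W(1)[OF that] abs_Re_le_cmod[of "W l - 1"] by linarith
      ultimately show False by (simp add: abs_if split: if_splits)
    qed
  qed auto
  moreover have "\<Psi> \<in> L \<rightarrow> L"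
  proof
    fix l assume l: "l \<in> L"
    have "norm (Ln (1 + (W l - 1))) \<le> 2 * norm (W l - 1)"
      using W(1)[OF l] by (intro norm_Ln_le) simp
    then have "norm (Ln (W l)) \<le> 1" using W(1)[OF l] by simp
    then show "\<Psi> l \<in> L" by (simp add: \<Psi>_def L_def dist_norm norm_divide norm_mult)
  qed
  ultimately obtain z where z: "z \<in> L" "\<Psi> z = z"
    using brouwer_ball[of 1 ?c \<Psi>] unfolding L_def by auto
  define f1 where "f1 x = exp (- \<i> * z * of_real x) * U True (x, z)" for x
  define f2 where "f2 x = exp (\<i> * z * of_real x) * U False (x, z)" for x
  show ?thesis
  proof (rule that[of z f1 f2])
    show "norm (z - ?c) \<le> 1" using z by (simp add: L_def dist_norm norm_minus_commute)
    show "f1 0 = 1" "f2 0 = 1" using Ueq[of 0 z] z by (simp_all add: f1_def f2_def)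
    show "f1 1 = f2 1"
    proof -
      have "Ln (W z) = 2 * \<i> * (z - ?c)" using z(2) by (simp add: \<Psi>_def field_simps)
      then have "W z = exp (2 * \<i> * (z - ?c))" using W(3)[OF z(1)] by (metis exp_Ln)
      also have "\<dots> = exp (2 * \<i> * z) * ee (- n) 1"
        unfolding ee_def mult_exp_exp by (rule arg_cong[where f = exp]) (simp add: algebra_simps)
      finally have "U True (1, z) = exp (2 * \<i> * z) * U False (1, z)"
        using W(2)[OF z(1)] by (simp add: W_def field_simps)
      moreover have "exp (- \<i> * z) * exp (2 * \<i> * z) = exp (\<i> * z)"
        unfolding mult_exp_exp by (rule arg_cong[where f = exp]) simp
      ultimately show ?thesis by (simp add: f1_def f2_def mult.assoc[symmetric])
    qed
    show "csol (fseries p) (fseries q) z (\<lambda>x. 0) (\<lambda>x. 0) f1 f2"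
      unfolding csol_def
    proof (intro ballI conjI)
      fix x :: real assume x: "x \<in> {0..1}"
      have "(f1 has_vector_derivative exp (- \<i> * z * of_real x) * (k True (x, z) * U (\<not> True) (x, z)) + (- \<i> * z) * exp (- \<i> * z * of_real x) * U True (x, z)) (at x within {0..1})"
        unfolding f1_def by (intro has_vector_derivative_mult ea Ud z x)
      moreover have "exp (- \<i> * z * of_real x) * k True (x, z) = \<i> * fseries p x * exp (\<i> * z * of_real x)"
      proof -
        have "exp (- \<i> * z * of_real x) * exp (2 * \<i> * z * of_real x) = exp (\<i> * z * of_real x)"
          unfolding mult_exp_exp by (rule arg_cong[where f = exp]) (simp add: algebra_simps)
        then show ?thesis by (simp add: k_def s_simps r_def mult_ac)
      qed
      then have "exp (- \<i> * z * of_real x) * (k True (x, z) * U (\<not> True) (x, z)) + (- \<i> * z) * exp (- \<i> * z * of_real x) * U True (x, z)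
          = - \<i> * (z * f1 x + 0 - fseries p x * f2 x)"
        by (simp add: f1_def f2_def algebra_simps)
      ultimately show "(f1 has_vector_derivative - \<i> * (z * f1 x + 0 - fseries p x * f2 x)) (at x within {0..1})"
        by (simp only:)
      have "(f2 has_vector_derivative exp (\<i> * z * of_real x) * (k False (x, z) * U (\<not> False) (x, z)) + (\<i> * z) * exp (\<i> * z * of_real x) * U False (x, z)) (at x within {0..1})"
        unfolding f2_def by (intro has_vector_derivative_mult ea Ud z x)
      moreover have "exp (\<i> * z * of_real x) * k False (x, z) = - \<i> * fseries q x * exp (- \<i> * z * of_real x)"
      proof -
        have "exp (\<i> * z * of_real x) * exp (- (2 * \<i>) * z * of_real x) = exp (- \<i> * z * of_real x)"
          unfolding mult_exp_exp by (rule arg_cong[where f = exp]) (simp add: algebra_simps)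
        then show ?thesis by (simp add: k_def s_simps r_def mult_ac)
      qed
      then have "exp (\<i> * z * of_real x) * (k False (x, z) * U (\<not> False) (x, z)) + (\<i> * z) * exp (\<i> * z * of_real x) * U False (x, z)
          = \<i> * (z * f2 x + 0 - fseries q x * f1 x)"
        by (simp add: f1_def f2_def algebra_simps)
      ultimately show "(f2 has_vector_derivative \<i> * (z * f2 x + 0 - fseries q x * f1 x)) (at x within {0..1})"
        by (simp only:)
    qed
  qed
qed

section \<open>Localization, uniqueness and simplicity of eigenvalues\<close>

lemma sobolev_wl2:
  assumes "u \<in> sobolev N" "sobolev_norm N u \<le> R"
  shows "wl2_le N (2 ^ N * R) (fourier u)"
proof (rule wl2_leI)
  fix F :: "int set" assume F: "finite F"
  let ?f = "\<lambda>n::int. (1 + (of_int n)\<^sup>2) ^ N * (cmod (fourier u n))\<^sup>2"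
  have sum: "?f summable_on UNIV" using assms(1) by (simp add: sobolev_def)
  have nn: "0 \<le> infsum ?f UNIV" by (intro infsum_nonneg) auto
  have R: "0 \<le> R" using assms(2) nn by (auto simp: sobolev_norm_def intro: order_trans[OF real_sqrt_ge_zero])
  have "(\<Sum>k\<in>F. (wgt k ^ N * cmod (fourier u k))\<^sup>2) \<le> (\<Sum>k\<in>F. 2 ^ N * ?f k)"
  proof (rule sum_mono)
    fix k :: int
    have "0 \<le> (\<bar>real_of_int k\<bar> - 1)\<^sup>2" by simp
    then have "(wgt k)\<^sup>2 \<le> 2 * (1 + (real_of_int k)\<^sup>2)"
      by (simp add: wgt_def power2_eq_square algebra_simps)
    then have "((wgt k)\<^sup>2) ^ N \<le> (2 * (1 + (real_of_int k)\<^sup>2)) ^ N"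
      by (intro power_mono) auto
    also have "((wgt k)\<^sup>2) ^ N = (wgt k ^ N)\<^sup>2"
      by (simp add: power_mult[symmetric] mult.commute)
    finally have "(wgt k ^ N)\<^sup>2 \<le> 2 ^ N * (1 + (real_of_int k)\<^sup>2) ^ N"
      by (simp only: power_mult_distrib)
    from mult_right_mono[OF this, of "(cmod (fourier u k))\<^sup>2"]
    show "(wgt k ^ N * cmod (fourier u k))\<^sup>2 \<le> 2 ^ N * ?f k"
      by (simp add: power_mult_distrib mult.assoc)
  qed
  also have "\<dots> = 2 ^ N * (\<Sum>k\<in>F. ?f k)" by (simp add: sum_distrib_left)
  also have "\<dots> \<le> 2 ^ N * infsum ?f UNIV"
    using finite_sum_le_infsum[OF sum F] by (intro mult_left_mono) auto
  also have "infsum ?f UNIV = (sobolev_norm N u)\<^sup>2" using nn by (simp add: sobolev_norm_def)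
  also have "2 ^ N * (sobolev_norm N u)\<^sup>2 \<le> 2 ^ N * R\<^sup>2"
    using assms(2) nn by (intro mult_left_mono power_mono) (auto simp: sobolev_norm_def)
  also have "\<dots> \<le> (2 ^ N)\<^sup>2 * R\<^sup>2"
    by (intro mult_right_mono) (auto simp: power2_eq_square)
  also have "\<dots> = (2 ^ N * R)\<^sup>2" by (simp add: power_mult_distrib)
  finally show "L2_set (\<lambda>k. wgt k ^ N * norm (fourier u k)) F \<le> 2 ^ N * R"
    unfolding L2_set_def using R by (intro real_le_lsqrt) (auto intro: sum_nonneg)
qed

lemma norm_exp_minus_one_le:
  fixes w :: complex
  assumes "norm w \<le> 1/2" shows "norm (exp w - 1) \<le> 2 * norm w"
proof -
  have "norm (exp w - (\<Sum>i\<le>0. w ^ i / fact i)) \<le> exp (norm w) * (norm w ^ Suc 0) / fact 0"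
    by (rule Taylor_exp_field)
  moreover have "exp (norm w) \<le> 2"
    using exp_bound_half[of "norm w"] assms by simp
  ultimately show ?thesis
    using mult_right_mono[of "exp (norm w)" 2 "norm w"] by simp
qed

text \<open>
  Beyond this bound for \<open>wgt n\<close>, all asymptotic estimates hold with errors of at most 1/100.
\<close>
definition large :: "nat \<Rightarrow> real \<Rightarrow> real" where
  "large P R = 100 * hbound P R + 10 * exconst R + 1"

text \<open>
  The potentials under consideration; by \<open>sobolev_wl2\<close>, a bound in the Sobolev norm of order \<open>Suc P\<close>
  gives \<open>R\<close>.
\<close>
locale bounded_potential =
  fixes \<phi> :: potential and P :: nat and R :: real
  assumes int1: "integrable M01 (fst \<phi>)" and int2: "integrable M01 (snd \<phi>)"
    and p: "wl2_le (Suc P) R (fourier (fst \<phi>))" and q: "wl2_le (Suc P) R (fourier (snd \<phi>))"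
begin

text \<open>
  Continuous representatives of the two components of the potential.
\<close>
definition "pf = fseries (fourier (fst \<phi>))"
definition "qf = fseries (fourier (snd \<phi>))"

lemma R_nonneg: "0 \<le> R" using p wl2_le_nonneg by blast

lemma hbound_nonneg: "0 \<le> hbound P R"
  using R_nonneg by (auto simp: hbound_def hbase_def hconst_def)

lemma exconst_nonneg: "0 \<le> exconst R"
  using R_nonneg by (auto simp: exconst_def intro!: mult_nonneg_nonneg add_nonneg_nonneg)

lemma pf_cont: "continuous_on S pf" and qf_cont: "continuous_on S qf"
  unfolding pf_def qf_def
  by (rule continuous_on_fseries[OF wl2_le_imp_l1_le_0], rule p q)+

lemma pf_le: "norm (pf x) \<le> 2 * R" and qf_le: "norm (qf x) \<le> 2 * R"
  unfolding pf_def qf_def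
  by (rule norm_fseries_le[OF wl2_le_imp_l1_le_0], rule p q)+

lemma AE_pf: "AE x in M01. fst \<phi> x = pf x" and AE_qf: "AE x in M01. snd \<phi> x = qf x"
  unfolding pf_def qf_def
  by (rule AE_eq_fseries[OF int1 wl2_le_imp_l1_le_0[OF p]], rule AE_eq_fseries[OF int2 wl2_le_imp_l1_le_0[OF q]])

lemma zs_csol:
  assumes "zs \<phi> F (\<lambda>x. z *s F x + G x)"
    and "continuous_on {0..1} (\<lambda>x. G x $ 1)" "continuous_on {0..1} (\<lambda>x. G x $ 2)"
  shows "csol pf qf z (\<lambda>x. G x $ 1) (\<lambda>x. G x $ 2) (\<lambda>x. F x $ 1) (\<lambda>x. F x $ 2)"
  by (rule zs_imp_csol[OF assms pf_cont qf_cont AE_pf AE_qf])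

lemma dir_shift_csol:
  assumes "dir_shift \<phi> z F 0"
  shows "csol pf qf z (\<lambda>x. 0) (\<lambda>x. 0) (\<lambda>x. F x $ 1) (\<lambda>x. F x $ 2)"
    "F 0 $ 1 = F 0 $ 2" "F 1 $ 1 = F 1 $ 2" "\<And>x. x \<notin> {0..1} \<Longrightarrow> F x = 0"
  using assms zs_csol[of F z "\<lambda>x. 0"]
  by (auto simp: dir_shift_def dir_domain_def)

lemma csol_dir_shift:
  assumes c: "csol pf qf z (\<lambda>x. 0) (\<lambda>x. 0) f1 f2" and bc: "f1 0 = f2 0" "f1 1 = f2 1"
    and F: "\<And>x. F x = (if x \<in> {0..1} then vec2 (f1 x) (f2 x) else 0)"
  shows "dir_shift \<phi> z F 0"
proof -
  have "zs \<phi> F (\<lambda>x. z *s F x + 0 x)" "\<exists>D. has_H1_deriv F D"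
    by (rule csol_imp_zs[where G = "\<lambda>x. z *s F x + 0 x", OF c _ _ pf_cont qf_cont AE_pf AE_qf]; simp add: F vec2_eq_iff)+
  then show ?thesis
    using bc by (simp add: dir_shift_def dir_domain_def F)
qed

lemma csol_linear:
  assumes "csol pf qf z (\<lambda>x. 0) (\<lambda>x. 0) f1 f2" "csol pf qf z (\<lambda>x. 0) (\<lambda>x. 0) h1 h2"
  shows "csol pf qf z (\<lambda>x. 0) (\<lambda>x. 0) (\<lambda>x. a * f1 x + b * h1 x) (\<lambda>x. a * f2 x + b * h2 x)"
  unfolding csol_def
proof (intro ballI conjI)
  fix x :: real assume x: "x \<in> {0..1}"
  have d: "(f1 has_vector_derivative - \<i> * (z * f1 x + 0 - pf x * f2 x)) (at x within {0..1})"
    "(f2 has_vector_derivative \<i> * (z * f2 x + 0 - qf x * f1 x)) (at x within {0..1})"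
    "(h1 has_vector_derivative - \<i> * (z * h1 x + 0 - pf x * h2 x)) (at x within {0..1})"
    "(h2 has_vector_derivative \<i> * (z * h2 x + 0 - qf x * h1 x)) (at x within {0..1})"
    using assms x unfolding csol_def by auto
  have "((\<lambda>x. a * f1 x + b * h1 x) has_vector_derivative a * (- \<i> * (z * f1 x + 0 - pf x * f2 x)) + b * (- \<i> * (z * h1 x + 0 - pf x * h2 x))) (at x within {0..1})"
    by (intro has_vector_derivative_add has_vector_derivative_mult_right d)
  then show "((\<lambda>x. a * f1 x + b * h1 x) has_vector_derivative - \<i> * (z * (a * f1 x + b * h1 x) + 0 - pf x * (a * f2 x + b * h2 x))) (at x within {0..1})"
    by (simp add: algebra_simps)
  have "((\<lambda>x. a * f2 x + b * h2 x) has_vector_derivative a * (\<i> * (z * f2 x + 0 - qf x * f1 x)) + b * (\<i> * (z * h2 x + 0 - qf x * h1 x))) (at x within {0..1})"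
    by (intro has_vector_derivative_add has_vector_derivative_mult_right d)
  then show "((\<lambda>x. a * f2 x + b * h2 x) has_vector_derivative \<i> * (z * (a * f2 x + b * h2 x) + 0 - qf x * (a * f1 x + b * h1 x))) (at x within {0..1})"
    by (simp add: algebra_simps)
qed

lemma csol_zero: "csol pf qf z (\<lambda>x. 0) (\<lambda>x. 0) (\<lambda>x. 0) (\<lambda>x. 0)"
  unfolding csol_def by simp

definition eigen :: "complex \<Rightarrow> (real \<Rightarrow> complex^2) \<Rightarrow> bool" where
  "eigen z F \<longleftrightarrow> dir_shift \<phi> z F 0 \<and> F \<noteq> 0"

text \<open>
  An eigenfunction that vanishes at one end in one component vanishes there in both, hence
  everywhere.
\<close>
lemma eigen_ends:
  assumes "eigen z F"
  shows "F 0 $ 1 \<noteq> 0" "F 1 $ 1 \<noteq> 0"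
proof -
  have d: "dir_shift \<phi> z F 0" and nz: "F \<noteq> 0" using assms by (auto simp: eigen_def)
  note c = dir_shift_csol[OF d]
  have "\<not> (F 0 $ 1 = 0 \<or> F 1 $ 1 = 0)"
  proof
    assume "F 0 $ 1 = 0 \<or> F 1 $ 1 = 0"
    then have "F 0 $ 1 = 0 \<and> F 0 $ 2 = 0 \<or> F 1 $ 1 = 0 \<and> F 1 $ 2 = 0"
      using c(2,3) by auto
    from csol_unique[OF c(1) pf_le qf_le this]
    have "F x = 0" for x using c(4)[of x] by (cases "x \<in> {0..1}") (auto simp: vec2_eq_iff)
    then show False using nz by (auto simp: fun_eq_iff)
  qed
  then show "F 0 $ 1 \<noteq> 0" "F 1 $ 1 \<noteq> 0" by auto
qed

lemma dir_shift_multiple: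
  assumes F: "eigen z F" and H: "dir_shift \<phi> z H 0"
  shows "H = fun_scale (H 0 $ 1 / F 0 $ 1) F"
proof
  fix x
  have dF: "dir_shift \<phi> z F 0" using F by (simp add: eigen_def)
  note f = dir_shift_csol[OF dF] and h = dir_shift_csol[OF H] and nz = eigen_ends(1)[OF F]
  let ?a = "H 0 $ 1 / F 0 $ 1"
  show "H x = fun_scale ?a F x"
  proof (cases "x \<in> {0..1}")
    case True
    have "(1 * H x $ 1 + (- ?a) * F x $ 1 = 0 \<and> 1 * H x $ 2 + (- ?a) * F x $ 2 = 0)"
      by (rule csol_unique[OF csol_linear[OF h(1) f(1)] pf_le qf_le _ True]) (use nz f(2) h(2) in auto)
    then show ?thesis by (simp add: fun_scale_def vec2_eq_iff)
  qed (use f(4) h(4) in \<open>auto simp: fun_scale_def\<close>)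
qed

lemma dir_shift_scale:
  assumes F: "dir_shift \<phi> z F 0" shows "dir_shift \<phi> z (fun_scale a F) 0"
proof -
  note f = dir_shift_csol[OF F]
  show ?thesis
    by (rule csol_dir_shift[OF csol_linear[OF f(1) f(1), of a 0]])
      (use f in \<open>auto simp: fun_scale_def vec2_eq_iff\<close>)
qed

text \<open>
  \<open>F\<close> is close to a multiple of the eigenfunction \<open>(exp(-\<i>\<pi>nx), exp(\<i>\<pi>nx))\<close> for the potential zero
  and the eigenvalue \<open>\<pi>n\<close>.
\<close>
definition close :: "int \<Rightarrow> (real \<Rightarrow> complex^2) \<Rightarrow> bool" where
  "close n F \<longleftrightarrow> (\<exists>d. d \<noteq> 0 \<and> (\<forall>x\<in>{0..1}.
     norm (exp (\<i> * of_real pi * of_int n * of_real x) * F x $ 1 - d) \<le> norm d / 10 \<and>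
     norm (exp (- \<i> * of_real pi * of_int n * of_real x) * F x $ 2 - d) \<le> norm d / 10))"

text \<open>
  The number \<open>n\<close> is found from the eigenfunction, not from the position of \<open>z\<close>. No bound
  for the imaginary part of \<open>z\<close> enters, so this also excludes eigenvalues far from the real axis in
  the region \<open>|Re z| \<ge> \<pi> * large P R\<close>.
\<close>
lemma eigen_asymptotics:
  assumes F: "eigen z F" and z: "pi * large P R \<le> \<bar>Re z\<bar>"
  obtains n \<tau> where "large P R \<le> wgt n" "norm (z - of_real pi * of_int n) \<le> 1/100" "close n F"
    "exp \<tau> = (-1) powi n * (F 1 $ 1 / F 0 $ 1)" "norm \<tau> \<le> 1/100"
    "norm (2 * \<tau> - \<i> * (fourier (fst \<phi>) (- n) - fourier (snd \<phi>) n))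
       \<le> hbound P R * (gmaj (\<lambda>m. fourier (fst \<phi>) (- m)) (fourier (snd \<phi>)) n + 1 / wgt n ^ Suc (Suc P)) / wgt n"
proof -
  have dF: "dir_shift \<phi> z F 0" using F by (simp add: eigen_def)
  note f = dir_shift_csol[OF dF] and nz = eigen_ends[OF F]
  let ?c = "F 0 $ 1" and ?c' = "F 1 $ 1"
  obtain n \<tau> where \<tau>: "exp \<tau> = (-1) powi n * (?c' / ?c)"
    and A: "\<bar>Re (z - of_real pi * of_int n - \<i> * \<tau>)\<bar> \<le> pi" and B: "\<bar>Re (z - of_real pi * of_int n + \<i> * \<tau>)\<bar> \<le> pi"
    using floquet_exponent_exists[of "?c' / ?c" z] nz by (metis divide_eq_0_iff)
  let ?A = "z - of_real pi * of_int n - \<i> * \<tau>" and ?B = "z - of_real pi * of_int n + \<i> * \<tau>"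
  have "\<bar>Re z - pi * of_int n\<bar> \<le> pi"
    using A B by (simp add: abs_le_iff)
  moreover have "\<bar>pi * real_of_int n\<bar> = pi * \<bar>real_of_int n\<bar>" by (simp add: abs_mult)
  ultimately have "\<bar>Re z\<bar> \<le> pi * wgt n"
    unfolding wgt_def distrib_left by linarith
  with z have "pi * large P R \<le> pi * wgt n" by linarith
  then have ln: "large P R \<le> wgt n" by simp
  then have n1: "hbound P R \<le> wgt n" and n100: "100 * hbound P R \<le> wgt n"
    using hbound_nonneg exconst_nonneg by (auto simp: large_def)
  have small: "hbound P R / wgt n \<le> 1/100" using n100 by (simp add: divide_le_eq)
  have \<tau>': "exp \<tau> * ?c = (-1) powi n * ?c'" using \<tau> nz by simp
  note as = dirichlet_solution_asymptotics[OF p q f(1)[unfolded pf_def qf_def] refl f(2)[symmetric] refl f(3)[symmetric] nz(1) \<tau>' A B n1]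
  have nA: "norm ?A \<le> 1/100" and nB: "norm ?B \<le> 1/100" using as(1,2) small by linarith+
  have "norm (2 * (z - of_real pi * of_int n)) \<le> 1/100 + 1/100"
  proof -
    have eq: "2 * (z - of_real pi * of_int n) = ?A + ?B" by simp
    show ?thesis unfolding eq by (rule order_trans[OF norm_triangle_ineq add_mono[OF nA nB]])
  qed
  then have zn: "norm (z - of_real pi * of_int n) \<le> 1/100" by (simp only: norm_mult) simp
  have AB: "?A - ?B = - \<i> * (2 * \<tau>)" by simp
  have "norm (- \<i> * (2 * \<tau>)) \<le> 1/100 + 1/100"
    using norm_triangle_ineq4[of ?A ?B] nA nB unfolding AB by linarith
  then have t1: "norm \<tau> \<le> 1/100" by (simp only: norm_mult norm_minus_cancel norm_ii) simp
  have kap: "norm (2 * \<tau> - \<i> * (fourier (fst \<phi>) (- n) - fourier (snd \<phi>) n))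
      = norm (?A - ?B - (fourier (fst \<phi>) (- n) - fourier (snd \<phi>) n))"
  proof -
    have "?A - ?B - (fourier (fst \<phi>) (- n) - fourier (snd \<phi>) n) = - \<i> * (2 * \<tau> - \<i> * (fourier (fst \<phi>) (- n) - fourier (snd \<phi>) n))"
      by (simp add: algebra_simps)
    then show ?thesis by (simp only: norm_mult norm_minus_cancel norm_ii mult_1)
  qed
  obtain d where d: "d \<noteq> 0" and near: "\<And>x. x \<in> {0..1} \<Longrightarrow>
       norm (exp ((\<i> * of_real pi * of_int n - \<tau>) * of_real x) * F x $ 1 - d) \<le> 2 * hbound P R / wgt n * norm d \<and>
       norm (exp ((- \<i> * of_real pi * of_int n - \<tau>) * of_real x) * F x $ 2 - d) \<le> 2 * hbound P R / wgt n * norm d"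
    using as(4) by blast
  have rem: "norm (exp (a * of_real x) * y - d) \<le> norm d / 10"
    if "norm (exp ((a - \<tau>) * of_real x) * y - d) \<le> 2 * hbound P R / wgt n * norm d" and x: "x \<in> {0..1}" for a y :: complex and x
  proof -
    let ?u = "exp ((a - \<tau>) * of_real x) * y" and ?e = "exp (\<tau> * of_real x)"
    have tx: "norm (\<tau> * of_real x) \<le> 1/100"
      using t1 x mult_mono[of "norm \<tau>" "1/100" "\<bar>x\<bar>" 1] by (simp add: norm_mult)
    have e1: "norm (?e - 1) \<le> 1/50" using norm_exp_minus_one_le[of "\<tau> * of_real x"] tx by simp
    have e2: "norm ?e \<le> 2" using exp_bound_half[of "\<tau> * of_real x"] tx by linarith
    have "2 * hbound P R / wgt n * norm d \<le> 1/50 * norm d" using small by (intro mult_right_mono) auto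
    with that(1) have u: "norm (?u - d) \<le> 1/50 * norm d" by linarith
    have "exp (a * of_real x) = ?e * exp ((a - \<tau>) * of_real x)"
      unfolding mult_exp_exp by (rule arg_cong[where f = exp]) (simp add: algebra_simps)
    then have "exp (a * of_real x) * y - d = ?e * (?u - d) + (?e - 1) * d"
      by (simp add: algebra_simps)
    then have "norm (exp (a * of_real x) * y - d) \<le> norm ?e * norm (?u - d) + norm (?e - 1) * norm d"
      by (simp only: norm_mult[symmetric] norm_triangle_ineq)
    also have "\<dots> \<le> 2 * (1/50 * norm d) + 1/50 * norm d"
      by (intro add_mono mult_mono e1 e2 u) auto
    finally show ?thesis using norm_ge_zero[of d] by linarith
  qed
  have "close n F"
    unfolding close_def using d near rem[of "\<i> * of_real pi * of_int n"] rem[of "- \<i> * of_real pi * of_int n"] by blast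
  then show ?thesis
    using that[OF ln zn _ \<tau> t1] as(3) unfolding kap by blast
qed

text \<open>
  The exponential factors cancel in the products \<open>F\<^sub>1H\<^sub>2\<close> and \<open>F\<^sub>2H\<^sub>1\<close>, so both are close to the
  product of the two constants.
\<close>
lemma close_pairing_nonzero:
  assumes F: "close n F" and H: "close n H"
    and c: "\<And>i. continuous_on {0..1} (\<lambda>x. F x $ i)" "\<And>i. continuous_on {0..1} (\<lambda>x. H x $ i)"
  shows "integral {0..1} (\<lambda>x. F x $ 1 * H x $ 2 + F x $ 2 * H x $ 1) \<noteq> 0"
proof -
  let ?a = "\<i> * of_real pi * of_int n :: complex" and ?b = "- \<i> * of_real pi * of_int n :: complex"
  obtain d where d: "d \<noteq> 0" "\<And>x. x \<in> {0..1} \<Longrightarrow> norm (exp (?a * of_real x) * F x $ 1 - d) \<le> norm d / 10"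
    "\<And>x. x \<in> {0..1} \<Longrightarrow> norm (exp (?b * of_real x) * F x $ 2 - d) \<le> norm d / 10"
    using F unfolding close_def by blast
  obtain e where e: "e \<noteq> 0" "\<And>x. x \<in> {0..1} \<Longrightarrow> norm (exp (?a * of_real x) * H x $ 1 - e) \<le> norm e / 10"
    "\<And>x. x \<in> {0..1} \<Longrightarrow> norm (exp (?b * of_real x) * H x $ 2 - e) \<le> norm e / 10"
    using H unfolding close_def by blast
  let ?D = "norm d * norm e"
  have prod: "norm (u * v - d * e) \<le> ?D / 4" if "norm (u - d) \<le> norm d / 10" "norm (v - e) \<le> norm e / 10" for u v
  proof -
    have "u * v - d * e = (u - d) * (v - e) + (u - d) * e + d * (v - e)" by (simp add: algebra_simps)
    also have "norm \<dots> \<le> norm (u - d) * norm (v - e) + norm (u - d) * norm e + norm d * norm (v - e)"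
      unfolding norm_mult[symmetric] by (intro order_trans[OF norm_triangle_ineq] add_mono order_refl)
    also have "\<dots> \<le> norm d / 10 * (norm e / 10) + norm d / 10 * norm e + norm d * (norm e / 10)"
      by (intro add_mono mult_mono that) auto
    also have "\<dots> \<le> ?D / 4" by (simp add: field_simps)
    finally show ?thesis .
  qed
  let ?f = "\<lambda>x. F x $ 1 * H x $ 2 + F x $ 2 * H x $ 1"
  have ab: "exp (?a * of_real x) * exp (?b * of_real x) = 1" for x
    unfolding mult_exp_exp by (simp add: algebra_simps)
  have swap: "(u * s) * (v * t) = s * t" if "u * v = 1" for u v s t :: complex
  proof -
    have "(u * s) * (v * t) = (u * v) * (s * t)" by (simp only: mult_ac)
    then show ?thesis using that by simp
  qed
  have pw: "norm (?f x - 2 * (d * e)) \<le> ?D / 2" if x: "x \<in> {0..1}" for x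
  proof -
    have 1: "F x $ 1 * H x $ 2 = (exp (?a * of_real x) * F x $ 1) * (exp (?b * of_real x) * H x $ 2)"
      by (rule swap[OF ab, symmetric])
    have 2: "F x $ 2 * H x $ 1 = (exp (?b * of_real x) * F x $ 2) * (exp (?a * of_real x) * H x $ 1)"
      by (rule swap[symmetric]) (subst mult.commute, rule ab)
    have "?f x - 2 * (d * e) = (F x $ 1 * H x $ 2 - d * e) + (F x $ 2 * H x $ 1 - d * e)" by simp
    also have "norm \<dots> \<le> norm (F x $ 1 * H x $ 2 - d * e) + norm (F x $ 2 * H x $ 1 - d * e)"
      by (rule norm_triangle_ineq)
    also have "\<dots> \<le> ?D / 4 + ?D / 4"
      unfolding 1 2 by (intro add_mono prod d e x)
    finally show ?thesis by simp
  qed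
  have fc: "continuous_on {0..1} ?f" by (intro continuous_intros c)
  have "norm (integral {0..1} (\<lambda>x. ?f x - 2 * (d * e))) \<le> ?D / 2 * (1 - 0)"
    by (rule integral_bound) (use pw in \<open>auto intro!: continuous_intros c\<close>)
  moreover have "integral {0..1} (\<lambda>x. ?f x - 2 * (d * e)) = integral {0..1} ?f - 2 * (d * e)"
    using integral_diff[OF integrable_continuous_real[OF fc] integrable_continuous_real[OF continuous_on_const[of _ "2 * (d * e)"]]]
    by simp
  ultimately have "norm (integral {0..1} ?f - 2 * (d * e)) \<le> ?D / 2" by simp
  moreover have "0 < ?D" using d e by simp
  ultimately show ?thesis by (auto simp: norm_mult)
qed

lemma eigen_cont: "eigen z F \<Longrightarrow> continuous_on {0..1} (\<lambda>x. F x $ i)"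
  using csol_continuous[OF dir_shift_csol(1), of z F] exhaust_2[of i] by (auto simp: eigen_def)

text \<open>
  Eigenfunctions for different eigenvalues are orthogonal for the pairing.
\<close>
lemma eigen_unique:
  assumes F: "eigen z F" "close n F" and H: "eigen y H" "close n H"
  shows "z = y"
proof -
  have d: "dir_shift \<phi> z F 0" "dir_shift \<phi> y H 0" using F H by (auto simp: eigen_def)
  have "((\<lambda>x. (y - z) * (F x $ 1 * H x $ 2 + F x $ 2 * H x $ 1) - (0 * H x $ 2 + 0 * H x $ 1)) has_integral 0) {0..1}"
    by (rule csol_pairing[OF dir_shift_csol(1)[OF d(1)] dir_shift_csol(1)[OF d(2)]])
      (use dir_shift_csol(2,3)[OF d(1)] dir_shift_csol(2,3)[OF d(2)] in auto)
  then have hi: "((\<lambda>x. (y - z) * (F x $ 1 * H x $ 2 + F x $ 2 * H x $ 1)) has_integral 0) {0..1}" by simp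
  from integral_unique[OF hi] have "(y - z) * integral {0..1} (\<lambda>x. F x $ 1 * H x $ 2 + F x $ 2 * H x $ 1) = 0" by simp
  then show ?thesis
    using close_pairing_nonzero[OF F(2) H(2) eigen_cont[OF F(1)] eigen_cont[OF H(1)]] by auto
qed

lemma dir_ker_1: "dir_ker \<phi> z 1 = {F. dir_shift \<phi> z F 0}"
  by simp

text \<open>
  If \<open>(L(\<phi>) - z) H = t F\<close>, then the pairing with \<open>F\<close> gives \<open>t\<close> times the pairing of \<open>F\<close> with itself on one side
  and zero on the other, so \<open>t = 0\<close> and generalized eigenfunctions are eigenfunctions.
\<close>
lemma simple_eigenvalue:
  assumes F: "eigen z F" "close n F"
  shows "dir_alg_mult \<phi> z = 1"
proof -
  have dF: "dir_shift \<phi> z F 0" using F by (simp add: eigen_def)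
  note f = dir_shift_csol[OF dF]
  have one: "dir_ker \<phi> z 1 = fun_vs.span {F}"
    unfolding fun_vs.span_singleton dir_ker_1
    using dir_shift_multiple[OF F(1)] dir_shift_scale[OF dF] by blast
  have sub: "dir_ker \<phi> z k \<subseteq> dir_ker \<phi> z 1" for k
  proof (induction k)
    case 0
    have "0 \<in> fun_vs.span {F}" by (rule fun_vs.span_zero)
    then show ?case unfolding one by simp
  next
    case (Suc k)
    show ?case
    proof
      fix H assume "H \<in> dir_ker \<phi> z (Suc k)"
      then obtain G where G: "G \<in> dir_ker \<phi> z k" and HG: "dir_shift \<phi> z H G" by auto
      from G Suc obtain t where t: "G = fun_scale t F"
        unfolding one fun_vs.span_singleton by blast
      have Gi: "G x $ i = t * F x $ i" for x i by (simp add: t fun_scale_def)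
      have Gc: "continuous_on {0..1} (\<lambda>x. G x $ i)" for i
        unfolding Gi by (intro continuous_intros eigen_cont[OF F(1)])
      have H: "csol pf qf z (\<lambda>x. G x $ 1) (\<lambda>x. G x $ 2) (\<lambda>x. H x $ 1) (\<lambda>x. H x $ 2)"
        "H 0 $ 1 = H 0 $ 2" "H 1 $ 1 = H 1 $ 2"
        using HG zs_csol[OF _ Gc Gc, of H z] by (auto simp: dir_shift_def dir_domain_def)
      have "((\<lambda>x. (z - z) * (H x $ 1 * F x $ 2 + H x $ 2 * F x $ 1) - (G x $ 1 * F x $ 2 + G x $ 2 * F x $ 1)) has_integral 0) {0..1}"
        by (rule csol_pairing[OF H(1) f(1) H(2,3) f(2,3)])
      then have "((\<lambda>x. - t * (F x $ 1 * F x $ 2 + F x $ 2 * F x $ 1)) has_integral 0) {0..1}"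
        by (simp add: Gi algebra_simps)
      then have "integral {0..1} (\<lambda>x. - t * (F x $ 1 * F x $ 2 + F x $ 2 * F x $ 1)) = 0"
        by (rule integral_unique)
      then have "- t * integral {0..1} (\<lambda>x. F x $ 1 * F x $ 2 + F x $ 2 * F x $ 1) = 0" by simp
      then have "t = 0"
        using close_pairing_nonzero[OF F(2) F(2) eigen_cont[OF F(1)] eigen_cont[OF F(1)]] by auto
      then have "G = 0" by (auto simp: t fun_scale_def fun_eq_iff)
      with HG show "H \<in> dir_ker \<phi> z 1" by simp
    qed
  qed
  have "(\<Union>k. dir_ker \<phi> z k) = dir_ker \<phi> z 1" using sub by blast
  then have "dir_alg_mult \<phi> z = fun_vs.dim (fun_vs.span {F})"
    unfolding dir_alg_mult_def one by simp
  also have "\<dots> = card {F}"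
    by (rule fun_vs.dim_span_eq_card_independent) (use F(1) in \<open>simp add: eigen_def\<close>)
  finally show ?thesis by simp
qed

lemma eigen_in_spectrum:
  assumes "eigen z F" shows "z \<in> dir_spectrum \<phi>"
proof -
  have "dir_shift \<phi> z 0 0"
    by (rule csol_dir_shift[OF csol_zero]) (auto simp: vec2_eq_iff)
  moreover have "dir_shift \<phi> z F 0" "F \<noteq> 0" using assms by (auto simp: eigen_def)
  moreover have "(0 :: real \<Rightarrow> complex^2) \<in> L2_01" by (rule continuous_L2_01) (simp add: zero_fun_def)
  ultimately have "z \<notin> dir_resolvent_set \<phi>"
    unfolding dir_resolvent_set_def by blast
  then show ?thesis by (simp add: dir_spectrum_def)
qed

lemma positive_mult_eigen:
  assumes "0 < dir_alg_mult \<phi> z"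
  obtains F where "eigen z F"
proof -
  have "\<exists>F. eigen z F"
  proof (rule ccontr)
    assume no: "\<not> (\<exists>F. eigen z F)"
    have "dir_ker \<phi> z k \<subseteq> {0}" for k
    proof (induction k)
      case (Suc k)
      show ?case
      proof
        fix F assume "F \<in> dir_ker \<phi> z (Suc k)"
        then obtain G where "G \<in> dir_ker \<phi> z k" "dir_shift \<phi> z F G" by auto
        moreover from this Suc have "G = 0" by blast
        ultimately have "dir_shift \<phi> z F 0" by simp
        with no show "F \<in> {0}" by (auto simp: eigen_def zero_fun_def)
      qed
    qed (simp add: zero_fun_def)
    then have "(\<Union>k. dir_ker \<phi> z k) \<subseteq> fun_vs.span {}" by auto
    from fun_vs.dim_le_card[OF this] have "dir_alg_mult \<phi> z = 0" by (simp add: dir_alg_mult_def)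
    with assms show False by simp
  qed
  then show ?thesis using that by blast
qed

lemma close_nonvanishing:
  assumes "close n F" "x \<in> {0..1}" shows "F x $ 1 \<noteq> 0"
proof
  assume z: "F x $ 1 = 0"
  obtain d where "d \<noteq> 0" "norm (exp (\<i> * of_real pi * of_int n * of_real x) * F x $ 1 - d) \<le> norm d / 10"
    using assms unfolding close_def by blast
  with z show False by simp
qed

text \<open>
  The sum of the two columns of the fundamental matrix is the solution with initial value \<open>(1, 1)\<close>, a
  multiple of \<open>F\<close>. Since the fundamental matrix is given by a choice, its existence has to be
  established first: as the first component of \<open>F\<close> has no zeros, a second solution is obtained from
  \<open>F\<close> by reduction of order.
\<close>
lemma fundamental_sum:
  assumes F: "eigen z F" "close n F"
  shows "(zs_Delta \<phi> z + zs_delta \<phi> z) / 2 = F 1 $ 1 / F 0 $ 1"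
proof -
  have dF: "dir_shift \<phi> z F 0" using F by (simp add: eigen_def)
  note F' = dir_shift_csol[OF dF] and c0 = eigen_ends(1)[OF F(1)]
  define f1 where "f1 x = (1 / F 0 $ 1) * F x $ 1 + 0 * F x $ 1" for x
  define f2 where "f2 x = (1 / F 0 $ 1) * F x $ 2 + 0 * F x $ 2" for x
  have f: "csol pf qf z (\<lambda>x. 0) (\<lambda>x. 0) f1 f2"
    unfolding f1_def[abs_def] f2_def[abs_def] by (rule csol_linear[OF F'(1) F'(1)])
  have f0: "f1 0 = 1" "f2 0 = 1" and f11: "f1 1 = F 1 $ 1 / F 0 $ 1" "f2 1 = F 1 $ 1 / F 0 $ 1"
    using c0 F'(2,3) by (simp_all add: f1_def f2_def)
  have nz: "f1 x \<noteq> 0" if "x \<in> {0..1}" for x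
    using close_nonvanishing[OF F(2) that] c0 by (simp add: f1_def)
  note fc = csol_continuous[OF f]
  \<comment> \<open>Variation of constants: \<open>(k f\<^sub>1, k f\<^sub>2 + 1/f\<^sub>1)\<close> has Wronskian 1 with \<open>(f\<^sub>1, f\<^sub>2)\<close>, and it is a
    solution if and only if \<open>k' = \<i> p / f\<^sub>1\<^sup>2\<close>.\<close>
  define g where "g x = \<i> * pf x / (f1 x)\<^sup>2" for x
  have gc: "continuous_on {0..1} g"
    unfolding g_def by (intro continuous_intros pf_cont fc) (use nz in auto)
  define k where "k x = integral {0..x} g" for x
  have kd: "(k has_vector_derivative g x) (at x within {0..1})" if "x \<in> {0..1}" for x
    unfolding k_def by (rule integral_has_vector_derivative[OF gc that])
  define h1 where "h1 x = k x * f1 x" for x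
  define h2 where "h2 x = k x * f2 x + inverse (f1 x)" for x
  have h: "csol pf qf z (\<lambda>x. 0) (\<lambda>x. 0) h1 h2"
    unfolding csol_def
  proof (intro ballI conjI)
    fix x :: real assume x: "x \<in> {0..1}"
    have d: "(f1 has_vector_derivative - \<i> * (z * f1 x + 0 - pf x * f2 x)) (at x within {0..1})"
      "(f2 has_vector_derivative \<i> * (z * f2 x + 0 - qf x * f1 x)) (at x within {0..1})"
      using f x unfolding csol_def by auto
    have i: "((\<lambda>x. inverse (f1 x)) has_vector_derivative - (inverse (f1 x) * (- \<i> * (z * f1 x + 0 - pf x * f2 x)) * inverse (f1 x))) (at x within {0..1})"
      using Deriv.has_derivative_inverse[OF nz[OF x] d(1)[unfolded has_vector_derivative_def]]
      unfolding has_vector_derivative_def by (simp add: algebra_simps)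
    have "(h1 has_vector_derivative k x * (- \<i> * (z * f1 x + 0 - pf x * f2 x)) + g x * f1 x) (at x within {0..1})"
      unfolding h1_def by (intro has_vector_derivative_mult kd d x)
    moreover have "k x * (- \<i> * (z * f1 x + 0 - pf x * f2 x)) + g x * f1 x = - \<i> * (z * h1 x + 0 - pf x * h2 x)"
      using nz[OF x] by (simp add: g_def h1_def h2_def power2_eq_square field_simps)
    ultimately show "(h1 has_vector_derivative - \<i> * (z * h1 x + 0 - pf x * h2 x)) (at x within {0..1})"
      by (simp only:)
    have "(h2 has_vector_derivative k x * (\<i> * (z * f2 x + 0 - qf x * f1 x)) + g x * f2 x + - (inverse (f1 x) * (- \<i> * (z * f1 x + 0 - pf x * f2 x)) * inverse (f1 x))) (at x within {0..1})"
      unfolding h2_def by (intro has_vector_derivative_add has_vector_derivative_mult kd d i x)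
    moreover have "k x * (\<i> * (z * f2 x + 0 - qf x * f1 x)) + g x * f2 x + - (inverse (f1 x) * (- \<i> * (z * f1 x + 0 - pf x * f2 x)) * inverse (f1 x))
        = \<i> * (z * h2 x + 0 - qf x * h1 x)"
      using nz[OF x] by (simp add: g_def h1_def h2_def power2_eq_square field_simps)
    ultimately show "(h2 has_vector_derivative \<i> * (z * h2 x + 0 - qf x * h1 x)) (at x within {0..1})"
      by (simp only:)
  qed
  have h0: "h1 0 = 0" "h2 0 = 1" using f0 by (simp_all add: h1_def h2_def k_def)
  define M :: "real \<Rightarrow> complex^2^2" where "M x = (\<chi> i j. if j = 1 then vec2 (1 * f1 x + (-1) * h1 x) (1 * f2 x + (-1) * h2 x) $ i else vec2 (h1 x) (h2 x) $ i)" for x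
  have M0: "M 0 = mat 1"
    using f0 h0 by (simp add: M_def mat_def vec_eq_iff forall_2)
  have col: "column j (M x) = (if j = 1 then vec2 (1 * f1 x + (-1) * h1 x) (1 * f2 x + (-1) * h2 x) else vec2 (h1 x) (h2 x))" for j x
    by (auto simp: column_def M_def vec_eq_iff)
  have zsM: "zs \<phi> (\<lambda>x. column j (M x)) (\<lambda>x. z *s column j (M x))" for j
  proof (cases "j = 1")
    case True
    show ?thesis
      by (rule csol_imp_zs(1)[OF csol_linear[OF f h, of 1 "-1"] _ _ pf_cont qf_cont AE_pf AE_qf])
        (simp_all add: col True vec2_eq_iff)
  next
    case False
    show ?thesis
      by (rule csol_imp_zs(1)[OF h _ _ pf_cont qf_cont AE_pf AE_qf])
        (simp_all add: col False vec2_eq_iff)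
  qed
  let ?M = "zs_fund \<phi> z"
  have fund: "?M 0 = mat 1 \<and> (\<forall>j. zs \<phi> (\<lambda>x. column j (?M x)) (\<lambda>x. z *s column j (?M x)))"
    unfolding zs_fund_def by (rule someI[where x = M]) (use M0 zsM in blast)
  have "csol pf qf z (\<lambda>x. 0) (\<lambda>x. 0) (\<lambda>x. column j (?M x) $ 1) (\<lambda>x. column j (?M x) $ 2)" for j
    using zs_csol[of "\<lambda>x. column j (?M x)" z "\<lambda>x. 0"] fund by simp
  note cc = csol_linear[OF this[of 1] this[of 2], of 1 1]
  have "1 * (1 * column 1 (?M 1) $ 1 + 1 * column 2 (?M 1) $ 1) + (-1) * f1 1 = 0
      \<and> 1 * (1 * column 1 (?M 1) $ 2 + 1 * column 2 (?M 1) $ 2) + (-1) * f2 1 = 0"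
    by (rule csol_unique[OF csol_linear[OF cc f] pf_le qf_le])
      (use fund f0 in \<open>auto simp: column_def mat_def\<close>)
  then have e: "?M 1 $ 1 $ 1 + ?M 1 $ 1 $ 2 = F 1 $ 1 / F 0 $ 1" "?M 1 $ 2 $ 1 + ?M 1 $ 2 $ 2 = F 1 $ 1 / F 0 $ 1"
    using f11 by (simp_all add: column_def)
  have "zs_Delta \<phi> z + zs_delta \<phi> z = (?M 1 $ 1 $ 1 + ?M 1 $ 1 $ 2) + (?M 1 $ 2 $ 1 + ?M 1 $ 2 $ 2)"
    by (simp add: zs_Delta_def zs_delta_def)
  then show ?thesis unfolding e by simp
qed

lemma eigen_exists:
  assumes "10 * exconst R \<le> wgt n"
  obtains z F where "eigen z F" "norm (z - of_real pi * of_int n) \<le> 1"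
proof -
  obtain z f1 f2 where z: "norm (z - of_real pi * of_int n) \<le> 1"
    and c: "csol pf qf z (\<lambda>x. 0) (\<lambda>x. 0) f1 f2" and bc: "f1 0 = 1" "f2 0 = 1" "f1 1 = f2 1"
    using dirichlet_eigenvalue_exists[OF p q assms] unfolding pf_def qf_def by blast
  define F where "F x = (if x \<in> {0..1} then vec2 (f1 x) (f2 x) else 0)" for x :: real
  have "dir_shift \<phi> z F 0" by (rule csol_dir_shift[OF c _ bc(3) F_def]) (use bc in simp)
  moreover have "F \<noteq> 0"
  proof
    assume "F = 0"
    then have "F 0 $ 1 = 0" by simp
    then show False using bc by (simp add: F_def)
  qed
  ultimately show ?thesis using that z by (simp add: eigen_def)
qed

end

section \<open>The index of an eigenvalue in the listing\<close>

text \<open>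
  Downward induction from the indices where \<open>near\<close> is known. If the entry with index \<open>i + 1\<close> is the
  one near \<open>\<pi>(i + 1)\<close>, then the entry near \<open>\<pi>i\<close> has an index \<open>m \<le> i\<close>. If \<open>m < i\<close>, then the entry with
  index \<open>i\<close> lies between these two entries, so it is near \<open>\<pi>i\<close> or near \<open>\<pi>(i + 1)\<close>, in
  contradiction to uniqueness. The base of the induction depends on the listing, but \<open>L\<close> does not.
\<close>
lemma listing_index_pos:
  fixes \<mu> :: "int \<Rightarrow> complex"
  assumes mono: "\<And>n. Re (\<mu> n) \<le> Re (\<mu> (n + 1))"
    and near: "\<And>n. b \<le> n \<Longrightarrow> norm (\<mu> n - of_real pi * of_int n) \<le> 1"
    and loc: "\<And>m. pi * L \<le> \<bar>Re (\<mu> m)\<bar> \<Longrightarrow> \<exists>n. norm (\<mu> m - of_real pi * of_int n) \<le> 1/100"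
    and uniq: "\<And>n m m'. L \<le> wgt n \<Longrightarrow> norm (\<mu> m - of_real pi * of_int n) \<le> 1 \<Longrightarrow>
       norm (\<mu> m' - of_real pi * of_int n) \<le> 1 \<Longrightarrow> m = m'"
    and ex: "\<And>n. L \<le> wgt n \<Longrightarrow> \<exists>m. norm (\<mu> m - of_real pi * of_int n) \<le> 1"
    and n: "L + 1 \<le> of_int n" "0 \<le> n"
  shows "norm (\<mu> n - of_real pi * of_int n) \<le> 1"
proof -
  have Re_mono: "Re (\<mu> i) \<le> Re (\<mu> j)" if "i \<le> j" for i j
    using that
  proof (induction j rule: int_ge_induct)
    case (step j)
    then show ?case using mono[of j] by linarith
  qed simp
  have re: "\<bar>Re w - pi * of_int k\<bar> \<le> r" if "norm (w - of_real pi * of_int k) \<le> r" for w k r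
    using abs_Re_le_cmod[of "w - of_real pi * of_int k"] that by simp
  have pi3: "3 < pi" by (rule pi_gt3)
  have "L + 1 \<le> of_int i \<and> 0 \<le> i \<longrightarrow> norm (\<mu> i - of_real pi * of_int i) \<le> 1" if "i \<le> max n b" for i
    using that
  proof (induction i rule: int_le_induct)
    case base
    then show ?case using near by simp
  next
    case (step j)
    define i where "i = j - 1"
    have j: "j = i + 1" by (simp add: i_def)
    show ?case
      unfolding i_def[symmetric]
    proof
      assume i: "L + 1 \<le> of_int i \<and> 0 \<le> i"
      have nj: "norm (\<mu> (i + 1) - of_real pi * of_int (i + 1)) \<le> 1"
        using step.IH i unfolding j by simp
      have Lw: "L \<le> wgt i" "L \<le> wgt (i + 1)" using i by (auto simp: wgt_def)
      obtain m where m: "norm (\<mu> m - of_real pi * of_int i) \<le> 1" using ex[OF Lw(1)] by blast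
      have rm: "pi * of_int i - 1 \<le> Re (\<mu> m)" "Re (\<mu> m) \<le> pi * of_int i + 1"
        using re[OF m] by linarith+
      have rj: "pi * of_int i + pi - 1 \<le> Re (\<mu> (i + 1))" "Re (\<mu> (i + 1)) \<le> pi * of_int i + pi + 1"
        using re[OF nj] by (simp_all add: distrib_left abs_le_iff)
      have "m < i + 1"
      proof (rule ccontr)
        assume "\<not> m < i + 1"
        then have "Re (\<mu> (i + 1)) \<le> Re (\<mu> m)" by (intro Re_mono) simp
        then show False using rm rj pi3 by linarith
      qed
      moreover have "\<not> m < i"
      proof
        assume mi: "m < i"
        have ri: "pi * of_int i - 1 \<le> Re (\<mu> i)" "Re (\<mu> i) \<le> pi * of_int i + pi + 1"
          using Re_mono[of m i] Re_mono[of i "i + 1"] mi rm rj by auto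
        have "pi * L \<le> pi * (of_int i - 1)" using i by (intro mult_left_mono) auto
        also have "\<dots> = pi * of_int i - pi" by (simp add: algebra_simps)
        also have "\<dots> \<le> \<bar>Re (\<mu> i)\<bar>" using ri pi3 by linarith
        finally obtain l where l: "norm (\<mu> i - of_real pi * of_int l) \<le> 1/100" using loc by blast
        have rl: "pi * of_int l - 1/100 \<le> Re (\<mu> i)" "Re (\<mu> i) \<le> pi * of_int l + 1/100"
          using re[OF l] by linarith+
        have l1: "norm (\<mu> i - of_real pi * of_int l) \<le> 1" using l by linarith
        have "l = i \<or> l = i + 1"
        proof (rule ccontr)
          assume "\<not> (l = i \<or> l = i + 1)"
          then consider "l + 1 \<le> i" | "i + 2 \<le> l" by linarith
          then show False
          proof cases
            case 1
            then have "real_of_int l + 1 \<le> of_int i" by linarith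
            then have "pi * (of_int l + 1) \<le> pi * of_int i" by (intro mult_left_mono) simp_all
            then show False using rl ri pi3 by (simp add: distrib_left)
          next
            case 2
            then have "real_of_int i + 2 \<le> of_int l" by linarith
            then have "pi * (of_int i + 2) \<le> pi * of_int l" by (intro mult_left_mono) simp_all
            then show False using rl ri pi3 by (simp add: distrib_left)
          qed
        qed
        then show False
        proof
          assume "l = i"
          then have "m = i" using uniq[OF Lw(1) m, of i] l1 by blast
          then show False using mi by simp
        next
          assume "l = i + 1"
          then have "i + 1 = i" using uniq[OF Lw(2) nj, of i] l1 by blast
          then show False by simp
        qed
      qed
      ultimately have "m = i" by simp
      then show "norm (\<mu> i - of_real pi * of_int i) \<le> 1" using m by simp
    qed
  qed
  then show ?thesis using n by simp
qed

text \<open>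
  The case of negative \<open>n\<close> follows by the reflection \<open>\<mu> n \<mapsto> - \<mu> (- n)\<close>.
\<close>
lemma listing_index:
  fixes \<mu> :: "int \<Rightarrow> complex"
  assumes mono: "\<And>n. Re (\<mu> n) \<le> Re (\<mu> (n + 1))"
    and near: "\<And>n. b \<le> \<bar>n\<bar> \<Longrightarrow> norm (\<mu> n - of_real pi * of_int n) \<le> 1"
    and loc: "\<And>m. pi * L \<le> \<bar>Re (\<mu> m)\<bar> \<Longrightarrow> \<exists>n. norm (\<mu> m - of_real pi * of_int n) \<le> 1/100"
    and uniq: "\<And>n m m'. L \<le> wgt n \<Longrightarrow> norm (\<mu> m - of_real pi * of_int n) \<le> 1 \<Longrightarrow>
       norm (\<mu> m' - of_real pi * of_int n) \<le> 1 \<Longrightarrow> m = m'"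
    and ex: "\<And>n. L \<le> wgt n \<Longrightarrow> \<exists>m. norm (\<mu> m - of_real pi * of_int n) \<le> 1"
    and n: "L + 1 \<le> of_int \<bar>n\<bar>"
  shows "norm (\<mu> n - of_real pi * of_int n) \<le> 1"
proof (cases "0 \<le> n")
  case True
  show ?thesis
  proof (rule listing_index_pos[where L = L and b = "max 0 b", OF mono _ loc uniq ex])
    show "norm (\<mu> k - of_real pi * of_int k) \<le> 1" if "max 0 b \<le> k" for k by (rule near) (use that in auto)
    show "L + 1 \<le> of_int n" "0 \<le> n" using n True by auto
  qed
next
  case False
  define \<nu> where "\<nu> k = - \<mu> (- k)" for k
  have flip: "norm (\<nu> m - of_real pi * of_int k) = norm (\<mu> (- m) - of_real pi * of_int (- k))" for m k
  proof -
    have "\<nu> m - of_real pi * of_int k = - (\<mu> (- m) - of_real pi * of_int (- k))" by (simp add: \<nu>_def)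
    then show ?thesis by (simp only: norm_minus_cancel)
  qed
  have "norm (\<nu> (- n) - of_real pi * of_int (- n)) \<le> 1"
  proof (rule listing_index_pos[where L = L and b = "max 0 b"])
    show "Re (\<nu> k) \<le> Re (\<nu> (k + 1))" for k using mono[of "- k - 1"] by (simp add: \<nu>_def)
    show "norm (\<nu> k - of_real pi * of_int k) \<le> 1" if "max 0 b \<le> k" for k
      unfolding flip by (rule near) (use that in auto)
    show "\<exists>k. norm (\<nu> m - of_real pi * of_int k) \<le> 1/100" if "pi * L \<le> \<bar>Re (\<nu> m)\<bar>" for m
    proof -
      have "pi * L \<le> \<bar>Re (\<mu> (- m))\<bar>" using that by (simp add: \<nu>_def)
      then obtain k where "norm (\<mu> (- m) - of_real pi * of_int k) \<le> 1/100" using loc by blast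
      then show ?thesis unfolding flip by (intro exI[of _ "- k"]) simp
    qed
    show "m = m'" if "L \<le> wgt k" "norm (\<nu> m - of_real pi * of_int k) \<le> 1" "norm (\<nu> m' - of_real pi * of_int k) \<le> 1" for k m m'
      using uniq[of "- k" "- m" "- m'"] that unfolding flip by simp
    show "\<exists>m. norm (\<nu> m - of_real pi * of_int k) \<le> 1" if k: "L \<le> wgt k" for k
    proof -
      obtain m where "norm (\<mu> m - of_real pi * of_int (- k)) \<le> 1" using ex[of "- k"] k by auto
      then show ?thesis unfolding flip by (intro exI[of _ "- m"]) simp
    qed
  qed (use n False in auto)
  then show ?thesis unfolding flip by simp
qed

lemma dir_listing_near:
  assumes "dir_listing \<phi> \<mu>"
  obtains n1 where "\<And>n. n1 \<le> \<bar>n\<bar> \<Longrightarrow> norm (\<mu> n - of_real pi * of_int n) \<le> 1"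
proof -
  let ?f = "\<lambda>n. (cmod (\<mu> n - of_int n * of_real pi))\<^sup>2"
  have "?f summable_on UNIV" using assms by (simp add: dir_listing_def)
  then have fin: "finite {n. 1 < ?f n}"
  proof -
    assume s: "?f summable_on UNIV"
    have "card G \<le> nat \<lceil>infsum ?f UNIV\<rceil>" if "G \<subseteq> {n. 1 < ?f n}" "finite G" for G
    proof -
      have "real (card G) = (\<Sum>n\<in>G. 1)" by simp
      also have "\<dots> \<le> (\<Sum>n\<in>G. ?f n)" using that by (intro sum_mono) (auto intro: less_imp_le)
      also have "\<dots> \<le> infsum ?f UNIV" by (rule finite_sum_le_infsum[OF s that(2)]) auto
      finally show ?thesis by linarith
    qed
    then show ?thesis using finite_if_finite_subsets_card_bdd by blast
  qed
  then obtain b where b: "\<And>n. 1 < ?f n \<Longrightarrow> \<bar>n\<bar> \<le> b"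
  proof -
    assume *: "\<And>b. (\<And>n. 1 < ?f n \<Longrightarrow> \<bar>n\<bar> \<le> b) \<Longrightarrow> thesis"
    have "bdd_above (abs ` {n. 1 < ?f n})" using fin by (intro bdd_above_finite finite_imageI)
    then obtain b where "\<And>y. y \<in> abs ` {n. 1 < ?f n} \<Longrightarrow> y \<le> b" unfolding bdd_above_def by blast
    then show thesis by (intro *[of b]) blast
  qed
  show ?thesis
  proof (rule that[of "b + 1"])
    fix n assume "b + 1 \<le> \<bar>n\<bar>"
    then have "\<not> 1 < ?f n" using b[of n] by linarith
    then have "(norm (\<mu> n - of_real pi * of_int n))\<^sup>2 \<le> 1\<^sup>2" by (simp add: mult.commute)
    then show "norm (\<mu> n - of_real pi * of_int n) \<le> 1" by (rule power2_le_imp_le) simp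
  qed
qed

lemma dir_listing_finite:
  assumes "dir_listing \<phi> \<mu>" shows "finite {n. \<mu> n = z}"
proof -
  obtain n1 where near: "\<And>n. n1 \<le> \<bar>n\<bar> \<Longrightarrow> norm (\<mu> n - of_real pi * of_int n) \<le> 1"
    using dir_listing_near[OF assms] by blast
  define b where "b = \<lceil>norm z + 1\<rceil>"
  have "\<bar>n\<bar> \<le> max n1 b" if "\<mu> n = z" for n
  proof (cases "n1 \<le> \<bar>n\<bar>")
    case True
    have "norm (of_real pi * of_int n :: complex) \<le> norm z + norm (z - of_real pi * of_int n)"
      using norm_triangle_ineq4[of z "z - of_real pi * of_int n"] by simp
    then have "pi * \<bar>of_int n\<bar> \<le> norm z + 1" using near[OF True] that by (simp add: norm_mult)
    moreover have "1 * \<bar>real_of_int n\<bar> \<le> pi * \<bar>of_int n\<bar>" using pi_ge_two by (intro mult_right_mono) auto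
    ultimately have "\<bar>real_of_int n\<bar> \<le> norm z + 1" by simp
    then have "\<bar>n\<bar> \<le> b" unfolding b_def by linarith
    then show ?thesis by simp
  qed simp
  then have "{n. \<mu> n = z} \<subseteq> {- max n1 b..max n1 b}" unfolding abs_le_iff by fastforce
  then show ?thesis by (rule finite_subset) simp
qed

context bounded_potential
begin

text \<open>
  The definition of a listing only puts its entries into the spectrum. They are eigenvalues because each
  of them is listed at least once and finitely often, so that its algebraic multiplicity is positive.
\<close>
lemma listing_eigen:
  assumes "dir_listing \<phi> \<mu>"
  obtains F where "eigen (\<mu> m) F"
proof -
  have "\<mu> m \<in> dir_spectrum \<phi>" using assms by (auto simp: dir_listing_def)
  then have "card {n. \<mu> n = \<mu> m} = dir_alg_mult \<phi> (\<mu> m)" using assms by (simp add: dir_listing_def)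
  moreover have "0 < card {n. \<mu> n = \<mu> m}"
    using dir_listing_finite[OF assms, of "\<mu> m"] by (auto simp: card_gt_0_iff)
  ultimately show ?thesis using positive_mult_eigen[of "\<mu> m"] that by auto
qed

lemma near_eigen_close:
  assumes F: "eigen z F" and n: "2 * large P R + 4 \<le> wgt n" and z: "norm (z - of_real pi * of_int n) \<le> 1"
  obtains \<tau> where "close n F"
    "exp \<tau> = (-1) powi n * (F 1 $ 1 / F 0 $ 1)" "norm \<tau> \<le> 1/100"
    "norm (2 * \<tau> - \<i> * (fourier (fst \<phi>) (- n) - fourier (snd \<phi>) n))
       \<le> hbound P R * (gmaj (\<lambda>m. fourier (fst \<phi>) (- m)) (fourier (snd \<phi>)) n + 1 / wgt n ^ Suc (Suc P)) / wgt n"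
proof -
  have re: "\<bar>Re z - pi * of_int n\<bar> \<le> 1"
    using abs_Re_le_cmod[of "z - of_real pi * of_int n"] z by simp
  have L: "0 \<le> large P R" using hbound_nonneg exconst_nonneg by (simp add: large_def)
  have "pi * large P R \<le> pi * (\<bar>of_int n\<bar> - 1)"
    using n L by (intro mult_left_mono) (auto simp: wgt_def)
  also have "\<dots> = \<bar>pi * of_int n\<bar> - pi" by (simp add: abs_mult right_diff_distrib)
  also have "\<dots> \<le> \<bar>Re z\<bar>" using re pi_ge_two by linarith
  finally obtain k \<tau> where k: "norm (z - of_real pi * of_int k) \<le> 1/100" and r: "close k F"
    "exp \<tau> = (-1) powi k * (F 1 $ 1 / F 0 $ 1)" "norm \<tau> \<le> 1/100"
    "norm (2 * \<tau> - \<i> * (fourier (fst \<phi>) (- k) - fourier (snd \<phi>) k))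
       \<le> hbound P R * (gmaj (\<lambda>m. fourier (fst \<phi>) (- m)) (fourier (snd \<phi>)) k + 1 / wgt k ^ Suc (Suc P)) / wgt k"
    using eigen_asymptotics[OF F] by metis
  have "k = n"
  proof (rule ccontr)
    assume "k \<noteq> n"
    then have "1 \<le> \<bar>real_of_int (k - n)\<bar>" by linarith
    then have "pi * 1 \<le> pi * \<bar>real_of_int (k - n)\<bar>" by (intro mult_left_mono) auto
    also have "\<dots> = norm (of_real pi * of_int (k - n) :: complex)" by (simp add: norm_mult del: of_int_diff)
    also have "\<dots> = norm ((z - of_real pi * of_int n) - (z - of_real pi * of_int k))" by (simp add: algebra_simps)
    also have "\<dots> \<le> 1 + 1/100" by (rule order_trans[OF norm_triangle_ineq4 add_mono[OF z k]])
    finally show False using pi_ge_two by simp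
  qed
  then show ?thesis using that r by blast
qed

text \<open>
  Uniqueness of the index combines uniqueness of the eigenvalue near \<open>\<pi>n\<close> with its simplicity, that
  is, with the fact that it is listed once.
\<close>
lemma listing_localized:
  assumes \<mu>: "dir_listing \<phi> \<mu>" and n: "2 * large P R + 5 \<le> of_int \<bar>n\<bar>"
  shows "norm (\<mu> n - of_real pi * of_int n) \<le> 1"
proof -
  obtain n1 where near: "\<And>n. n1 \<le> \<bar>n\<bar> \<Longrightarrow> norm (\<mu> n - of_real pi * of_int n) \<le> 1"
    using dir_listing_near[OF \<mu>] by blast
  let ?L = "2 * large P R + 4"
  have L: "0 \<le> large P R" using hbound_nonneg exconst_nonneg by (simp add: large_def)
  show ?thesis
  proof (rule listing_index[where L = ?L])
    show "Re (\<mu> k) \<le> Re (\<mu> (k + 1))" for k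
      using \<mu> by (auto simp: dir_listing_def lex_le_def intro: less_imp_le dest: spec[of _ k])
    show "norm (\<mu> k - of_real pi * of_int k) \<le> 1" if "n1 \<le> \<bar>k\<bar>" for k by (rule near[OF that])
    show "\<exists>k. norm (\<mu> m - of_real pi * of_int k) \<le> 1/100" if m: "pi * ?L \<le> \<bar>Re (\<mu> m)\<bar>" for m
    proof -
      obtain F where F: "eigen (\<mu> m) F" using listing_eigen[OF \<mu>] by blast
      have "pi * large P R \<le> pi * ?L" using L by (intro mult_left_mono) auto
      with m have "pi * large P R \<le> \<bar>Re (\<mu> m)\<bar>" by linarith
      from eigen_asymptotics[OF F this] show ?thesis by metis
    qed
    show "m = m'" if k: "?L \<le> wgt k" "norm (\<mu> m - of_real pi * of_int k) \<le> 1" "norm (\<mu> m' - of_real pi * of_int k) \<le> 1" for k m m'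
    proof -
      obtain F where F: "eigen (\<mu> m) F" using listing_eigen[OF \<mu>] by blast
      obtain H where H: "eigen (\<mu> m') H" using listing_eigen[OF \<mu>] by blast
      have cF: "close k F" using near_eigen_close[OF F k(1,2)] by metis
      have cH: "close k H" using near_eigen_close[OF H k(1,3)] by metis
      have eq: "\<mu> m = \<mu> m'" by (rule eigen_unique[OF F cF H cH])
      have "card {j. \<mu> j = \<mu> m} = 1"
        using simple_eigenvalue[OF F cF] eigen_in_spectrum[OF F] \<mu> by (simp add: dir_listing_def)
      then obtain x where x: "{j. \<mu> j = \<mu> m} = {x}" by (rule card_1_singletonE)
      have "m \<in> {x}" "m' \<in> {x}" unfolding x[symmetric] using eq by simp_all
      then show "m = m'" by simp
    qed
    show "\<exists>m. norm (\<mu> m - of_real pi * of_int k) \<le> 1" if k: "?L \<le> wgt k" for k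
    proof -
      have "10 * exconst R \<le> wgt k" using k hbound_nonneg exconst_nonneg by (simp add: large_def)
      then obtain z F where F: "eigen z F" and z: "norm (z - of_real pi * of_int k) \<le> 1"
        using eigen_exists by blast
      have "z \<in> range \<mu>" using eigen_in_spectrum[OF F] \<mu> by (simp add: dir_listing_def)
      then show ?thesis using z by blast
    qed
  qed (use n in simp)
qed

section \<open>Asymptotics of \<open>\<kappa>\<^sub>n\<close>\<close>

text \<open>
  The exponent \<open>\<tau>\<close> is small, so the principal branch of the logarithm recovers it from the multiplier.
\<close>
lemma kappa_estimate:
  assumes \<mu>: "dir_listing \<phi> \<mu>" and n: "2 * large P R + 5 \<le> of_int \<bar>n\<bar>"
  shows "norm (kappa \<phi> \<mu> n - \<i> * (fourier (fst \<phi>) (- n) - fourier (snd \<phi>) n))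
       \<le> hbound P R * (gmaj (\<lambda>m. fourier (fst \<phi>) (- m)) (fourier (snd \<phi>)) n + 1 / wgt n ^ Suc (Suc P)) / wgt n"
proof -
  have w: "2 * large P R + 4 \<le> wgt n" using n by (simp add: wgt_def)
  obtain F where F: "eigen (\<mu> n) F" using listing_eigen[OF \<mu>] by blast
  obtain \<tau> where c: "close n F" and \<tau>: "exp \<tau> = (-1) powi n * (F 1 $ 1 / F 0 $ 1)" and s: "norm \<tau> \<le> 1/100"
    and est: "norm (2 * \<tau> - \<i> * (fourier (fst \<phi>) (- n) - fourier (snd \<phi>) n))
       \<le> hbound P R * (gmaj (\<lambda>m. fourier (fst \<phi>) (- m)) (fourier (snd \<phi>)) n + 1 / wgt n ^ Suc (Suc P)) / wgt n"
    using near_eigen_close[OF F w listing_localized[OF \<mu> n]] by metis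
  have "\<bar>Im \<tau>\<bar> < pi" using abs_Im_le_cmod[of \<tau>] s pi_ge_two by linarith
  then have "Ln (exp \<tau>) = \<tau>" by (intro Ln_exp) (auto simp: abs_less_iff)
  then have "kappa \<phi> \<mu> n = 2 * \<tau>"
    unfolding kappa_def fundamental_sum[OF F c] \<tau>[symmetric] by simp
  then show ?thesis using est by simp
qed

text \<open>
  The two parts of the error are square summable after multiplication with \<open>|n|\<^sup>P\<^sup>+\<^sup>2\<close>: the first one
  because \<open>gmaj\<close> is bounded in the weighted \<open>l\<^sup>2\<close> space, the second one because \<open>1 / wgt n\<close> is square
  summable.
\<close>
lemma kappa_error_l2:
  assumes \<mu>: "dir_listing \<phi> \<mu>" and F: "finite F" and n: "\<And>n. n \<in> F \<Longrightarrow> 2 * large P R + 5 \<le> of_int \<bar>n\<bar>"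
  shows "L2_set (\<lambda>n. norm ((kappa \<phi> \<mu> n - \<i> * (fourier (fst \<phi>) (- n) - fourier (snd \<phi>) n)) * of_real (of_int \<bar>n\<bar> ^ (Suc P + 1)))) F
    \<le> hbound P R * (2 * R + 2 * (8 * 2 ^ P * R * (8 * 2 ^ P * R * R)) + 2)"
proof -
  let ?a = "\<lambda>m. fourier (fst \<phi>) (- m)" and ?b = "fourier (snd \<phi>)"
  let ?G = "gmaj ?a ?b"
  have G: "wl2_le (Suc P) (2 * R + 2 * (8 * 2 ^ P * R * (8 * 2 ^ P * R * R))) ?G"
    by (rule wl2_gmaj[OF wl2_le_reflect[OF p] q])
  have "L2_set (\<lambda>n. norm ((kappa \<phi> \<mu> n - \<i> * (fourier (fst \<phi>) (- n) - fourier (snd \<phi>) n)) * of_real (of_int \<bar>n\<bar> ^ (Suc P + 1)))) F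
      \<le> L2_set (\<lambda>n. hbound P R * (wgt n ^ Suc P * norm (?G n) + 1 / wgt n)) F"
  proof (rule L2_set_mono)
    fix n assume nF: "n \<in> F"
    let ?W = "wgt n ^ Suc (Suc P)"
    have "norm ((kappa \<phi> \<mu> n - \<i> * (fourier (fst \<phi>) (- n) - fourier (snd \<phi>) n)) * of_real (of_int \<bar>n\<bar> ^ (Suc P + 1)))
        = norm (kappa \<phi> \<mu> n - \<i> * (fourier (fst \<phi>) (- n) - fourier (snd \<phi>) n)) * \<bar>of_int n\<bar> ^ Suc (Suc P)"
      by (simp add: norm_mult norm_power)
    also have "\<dots> \<le> (hbound P R * (?G n + 1 / ?W) / wgt n) * ?W"
    proof (rule mult_mono)
      show "\<bar>real_of_int n\<bar> ^ Suc (Suc P) \<le> ?W" by (rule power_mono) (auto simp: wgt_def)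
      show "0 \<le> hbound P R * (?G n + 1 / ?W) / wgt n"
        using hbound_nonneg gmaj_nonneg by (intro divide_nonneg_nonneg mult_nonneg_nonneg add_nonneg_nonneg) auto
    qed (use kappa_estimate[OF \<mu> n[OF nF]] in auto)
    also have "\<dots> = hbound P R * (wgt n ^ Suc P * norm (?G n) + 1 / wgt n)"
      using gmaj_nonneg[of ?a ?b n] by (simp add: field_simps)
    finally show "norm ((kappa \<phi> \<mu> n - \<i> * (fourier (fst \<phi>) (- n) - fourier (snd \<phi>) n)) * of_real (of_int \<bar>n\<bar> ^ (Suc P + 1)))
        \<le> hbound P R * (wgt n ^ Suc P * norm (?G n) + 1 / wgt n)" .
  qed simp
  also have "\<dots> = hbound P R * L2_set (\<lambda>n. wgt n ^ Suc P * norm (?G n) + 1 / wgt n) F"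
    by (rule L2_set_right_distrib[OF hbound_nonneg, symmetric])
  also have "\<dots> \<le> hbound P R * (L2_set (\<lambda>n. wgt n ^ Suc P * norm (?G n)) F + L2_set (\<lambda>n. 1 / wgt n) F)"
    by (intro mult_left_mono L2_set_triangle_ineq hbound_nonneg)
  also have "\<dots> \<le> hbound P R * (2 * R + 2 * (8 * 2 ^ P * R * (8 * 2 ^ P * R * R)) + 2)"
    by (intro mult_left_mono add_mono wl2_leD[OF G F] L2_set_inverse_wgt_le[OF F] hbound_nonneg)
  finally show ?thesis .
qed

end

theorem corollary3p1:
  fixes N :: nat and B :: "potential set"
  assumes "N \<ge> 1"
    and "B \<subseteq> sobolev_c N"
    and "\<exists>R. \<forall>\<phi>\<in>B. sobolev_c_norm N \<phi> \<le> R"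
  shows "\<exists>(n0::int)\<ge>1. \<exists>C>0. \<forall>\<phi>\<in>B. \<forall>\<mu>. dir_listing \<phi> \<mu> \<longrightarrow>
    (\<exists>e :: int \<Rightarrow> complex.
       (\<forall>n. \<bar>n\<bar> \<ge> n0 \<longrightarrow>
          kappa \<phi> \<mu> n = \<i> * (fourier (fst \<phi>) (- n) - fourier (snd \<phi>) n)
                        + e n / complex_of_real (real_of_int \<bar>n\<bar> ^ (N + 1))) \<and>
       (\<lambda>n. (cmod (e n))\<^sup>2) summable_on {n. \<bar>n\<bar> \<ge> n0} \<and>
       (\<Sum>\<^sub>\<infinity>n\<in>{n. \<bar>n\<bar> \<ge> n0}. (cmod (e n))\<^sup>2) \<le> C)"
proof -
  obtain R0 where R0: "\<And>\<phi>. \<phi> \<in> B \<Longrightarrow> sobolev_c_norm N \<phi> \<le> R0" using assms(3) by blast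
  obtain P where N: "N = Suc P" using assms(1) by (cases N) auto
  \<comment> \<open>The factor \<open>2 ^ N\<close> compensates for the different weights in \<open>sobolev_norm\<close> and \<open>wl2_le\<close>.\<close>
  define R where "R = 2 ^ N * R0"
  define C0 where "C0 = hbound P R * (2 * R + 2 * (8 * 2 ^ P * R * (8 * 2 ^ P * R * R)) + 2)"
  define n0 where "n0 = max 1 \<lceil>2 * large P R + 5\<rceil>"
  have pot: "bounded_potential \<phi> P R" if \<phi>: "\<phi> \<in> B" for \<phi>
  proof -
    have s: "fst \<phi> \<in> sobolev N" "snd \<phi> \<in> sobolev N" using assms(2) \<phi> by (auto simp: sobolev_c_def)
    have "\<bar>sobolev_norm N (fst \<phi>)\<bar> \<le> sobolev_c_norm N \<phi>" "\<bar>sobolev_norm N (snd \<phi>)\<bar> \<le> sobolev_c_norm N \<phi>"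
      unfolding sobolev_c_norm_def by (intro real_le_rsqrt; simp)+
    then have "sobolev_norm N (fst \<phi>) \<le> R0" "sobolev_norm N (snd \<phi>) \<le> R0" using R0[OF \<phi>] by linarith+
    from sobolev_wl2[OF s(1) this(1)] sobolev_wl2[OF s(2) this(2)] show ?thesis
      using s by unfold_locales (auto simp: N R_def sobolev_def intro: L2_01_integrable)
  qed
  have key: "\<exists>e :: int \<Rightarrow> complex.
       (\<forall>n. \<bar>n\<bar> \<ge> n0 \<longrightarrow>
          kappa \<phi> \<mu> n = \<i> * (fourier (fst \<phi>) (- n) - fourier (snd \<phi>) n)
                        + e n / complex_of_real (real_of_int \<bar>n\<bar> ^ (N + 1))) \<and>
       (\<lambda>n. (cmod (e n))\<^sup>2) summable_on {n. \<bar>n\<bar> \<ge> n0} \<and>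
       (\<Sum>\<^sub>\<infinity>n\<in>{n. \<bar>n\<bar> \<ge> n0}. (cmod (e n))\<^sup>2) \<le> C0\<^sup>2 + 1" if \<phi>: "\<phi> \<in> B" and \<mu>: "dir_listing \<phi> \<mu>" for \<phi> \<mu>
  proof -
    interpret bounded_potential \<phi> P R by (rule pot[OF \<phi>])
    define e where "e n = (kappa \<phi> \<mu> n - \<i> * (fourier (fst \<phi>) (- n) - fourier (snd \<phi>) n)) * complex_of_real (of_int \<bar>n\<bar> ^ (Suc P + 1))" for n
    let ?S = "{n. \<bar>n\<bar> \<ge> n0}"
    have large: "2 * large P R + 5 \<le> of_int \<bar>n\<bar>" if "n \<in> ?S" for n
    proof -
      have "\<lceil>2 * large P R + 5\<rceil> \<le> \<bar>n\<bar>" using that by (simp add: n0_def)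
      then show ?thesis by (simp only: ceiling_le_iff)
    qed
    have bd: "(\<Sum>n\<in>F. (cmod (e n))\<^sup>2) \<le> C0\<^sup>2" if "finite F" "F \<subseteq> ?S" for F
    proof -
      have "sqrt (\<Sum>n\<in>F. (cmod (e n))\<^sup>2) \<le> C0"
        using kappa_error_l2[OF \<mu> that(1)] large that(2) unfolding L2_set_def e_def C0_def by blast
      then have "(sqrt (\<Sum>n\<in>F. (cmod (e n))\<^sup>2))\<^sup>2 \<le> C0\<^sup>2"
        by (intro power_mono) (auto intro: sum_nonneg)
      then show ?thesis by (simp add: sum_nonneg)
    qed
    have summ: "(\<lambda>n. (cmod (e n))\<^sup>2) summable_on ?S"
      by (rule nonneg_bounded_partial_sums_imp_summable_on[of _ _ "C0\<^sup>2"])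
        (auto intro!: eventually_finite_subsets_at_top_weakI bd)
    have le: "(\<Sum>\<^sub>\<infinity>n\<in>?S. (cmod (e n))\<^sup>2) \<le> C0\<^sup>2 + 1"
      by (rule order_trans[OF infsum_le_finite_sums[OF summ bd]]) auto
    have eq: "kappa \<phi> \<mu> n = \<i> * (fourier (fst \<phi>) (- n) - fourier (snd \<phi>) n) + e n / complex_of_real (real_of_int \<bar>n\<bar> ^ (N + 1))"
      if "n0 \<le> \<bar>n\<bar>" for n
    proof -
      have "n \<noteq> 0" using that by (auto simp: n0_def)
      then have "real_of_int \<bar>n\<bar> ^ (N + 1) \<noteq> 0" by simp
      then show ?thesis by (simp add: e_def N)
    qed
    show ?thesis
      by (intro exI[of _ e] conjI allI impI eq summ le)
  qed
  show ?thesis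
  proof (intro exI[of _ n0] conjI exI[of _ "C0\<^sup>2 + 1"] ballI allI impI key)
    show "1 \<le> n0" by (simp add: n0_def)
    show "0 < C0\<^sup>2 + 1" by (simp add: add_nonneg_pos)
  qed
qed

end
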